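(* Assume the stability condition $$\Big[1+\sum_{j=1}^{N}F_{0,j}(1,1)\Big]^{-1}\lim_{y\to1}\frac{\frac{d}{dy}\left[R(s(y),y)T(s(y),y)-s(y)y\right]}{\frac{d}{dy}\left[T(s(y),y)C(s(y),y)\right]}>0 .$$ Then the coefficients of the power series expansions $\Pi_k(x,y)=\sum_{m\ge0}V_m^{(k)}(x,y)w^m$, $k=0,1,\ldots,N$, satisfy $$V_m^{(0)}(x,y)=Q_{m-1}(x,y)\,\frac{G_{10}(x,y)}{G(x,y)},\qquad m>0,$$ $$V_0^{(0)}(x,y)=\frac{G_{00}(x,y)G_{10}(x,Y(x))-G_{00}(x,Y(x))G_{10}(x,y)}{G(x,y)\,G_{10}(x,Y(x))}\,V_0^{(0)}(0,0),$$ $$V_m^{(k)}(x,y)=F_{0,k}(x,y)V_m^{(0)}(x,y),\qquad k=1,\ldots,N,\ m\ge0,$$ where $Y(x)$, $|x|\le1$, is the only zero of $G(x,y)$ in the unit disc $|y|\le1$, and for $m\ge0$ $$Q_m(x,y)=V_m^{(0)}(x,y)-V_m^{(0)}(x,Y(x))-V_m^{(0)}(0,y)+V_m^{(0)}(0,Y(x)),$$ with $Q_{-1}(x,y)=0$.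
   Context: **The process.** Let $N\ge1$, $\mathbb{H}=\{-1,0,1,\ldots\}$, $\mathbb{H}^+=\{0,1,\ldots\}$. $\{Z(t)\}=\{(X_1(t),X_2(t),J(t))\}$ is a continuous-time Markov chain on $\mathbb{Z}_+^2\times\{0,1,\ldots,N\}$ with the following transition rates. (i) Within phase $0$, a jump of $(X_1,X_2)$ from $(x_1,x_2)$ by $(\Delta_1,\Delta_2)$ has rate: $q_{\Delta_1,\Delta_2}(0)$ if $x_1,x_2\ge1$ ($\Delta_1,\Delta_2\in\mathbb{H}$); $q^{(1)}_{\Delta_1,\Delta_2}(0)$ if $x_1\ge1,x_2=0$ ($\Delta_1\in\mathbb{H},\Delta_2\in\mathbb{H}^+$); $q^{(2)}_{\Delta_1,\Delta_2}(0)$ if $x_1=0,x_2\ge1$ ($\Delta_1\in\mathbb{H}^+,\Delta_2\in\mathbb{H}$); $q^{(0)}_{\Delta_1,\Delta_2}(0)$ if $x_1=x_2=0$ ($\Delta_1,\Delta_2\in\mathbb{H}^+$). Moreover $q^{(k)}_{i,j}(0)=q_{i,j}(0)$ for $k=0,1,2$ and $i,j\in\mathbb{H}^+$; $q_{-1,-1}(0)=0$; and for a parameter $w$, $q_{i,-1}(0)=(1-w)q^{(2)}_{i,-1}(0)$, $q_{-1,j}(0)=w\,q^{(1)}_{-1,j}(0)$ for $i,j\in\mathbb{H}^+$. (ii) Within phase $j\in\{1,\ldots,N\}$, a jump by $(\Delta_1,\Delta_2)$, $\Delta_1,\Delta_2\in\mathbb{H}^+$, has rate $q_{\Delta_1,\Delta_2}(j)$.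 (iii) For $j\ne j'$, a phase change from $j$ to $j'$ together with a jump by $(\Delta_1,\Delta_2)$, $\Delta_1,\Delta_2\in\mathbb{H}^+$, has rate $\theta_{j,j'}a^{(j,j')}_{\Delta_1,\Delta_2}$, where $(a^{(j,j')}_{i,l})_{i,l\ge0}$ is a probability distribution. It is assumed that $\theta_{k,0}>0$ for $k=1,\ldots,N$. Here $w\in(0,1)$; the quantities $q^{(1)},q^{(2)}$, $q_{i,j}(k)$ with $i,j\ge0$, $\theta_{j,j'}$, $a^{(j,j')}$ do not depend on $w$. **Stationary generating functions.** With $\pi^{(k)}_{i,j}=\lim_{t\to\infty}P(Z(t)=(i,j,k))$, $\Pi_k(x,y)=\sum_{i,j\ge0}\pi^{(k)}_{i,j}x^iy^j$ for $|x|,|y|\le1$, $k=0,\ldots,N$. They are expanded as power series in $w$, $\Pi_k(x,y)=\sum_{m=0}^\infty V^{(k)}_m(x,y)w^m$, which defines $V_m^{(k)}$. **Auxiliary functions.** For $|x|,|y|\le1$: $A_{k,m}(x,y)=\sum_{i,j\ge0}a^{(k,m)}_{i,j}x^iy^j$; $\theta_{k,.}=\sum_{m\ne k}\theta_{k,m}$; $D_k(x,y)=\theta_{k,.}+\sum_{i,j\ge0,(i,j)\ne(0,0)}q_{i,j}(k)(1-x^iy^j)$, $k=0,\ldots,N$; $$R(x,y)=xyD_0(x,y)+y\sum_{j\ge0}q_{-1,j}(0)(x-y^j)+x\sum_{i\ge0}q_{i,-1}(0)(y-x^i),$$ $$K(x,y)=x\sum_{i\ge0}q^{(2)}_{i,-1}(0)(y-x^i)-y\sum_{j\ge0}q^{(1)}_{-1,j}(0)(x-y^j),$$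 $$C(x,y)=wK(x,y)+y\sum_{j\ge0}q^{(1)}_{-1,j}(0)(x-y^j).$$ $\mathbf{L}(x,y)$ is the $N\times N$ matrix with diagonal entries $D_k(x,y)$ and off-diagonal $(k,m)$ entries $-\theta_{k,m}A_{k,m}(x,y)$, $k,m=1,\ldots,N$; $\mathbf{E}(x,y)=(\theta_{0,1}A_{0,1}(x,y),\ldots,\theta_{0,N}A_{0,N}(x,y))^T$; $F_{0,k}(x,y)$ is the $k$-th component of $(\mathbf{L}(x,y)^T)^{-1}\mathbf{E}(x,y)$ (so $\Pi_k=F_{0,k}\Pi_0$). $T(x,y)=\left[\sum_{k=1}^N\theta_{k,0}A_{k,0}(x,y)F_{0,k}(x,y)\right]^{-1}$. $$G(x,y)=T(x,y)\Big[yD_0(x,y)+\sum_{i\ge0}q^{(2)}_{i,-1}(0)(y-x^i)\Big]-y,$$ $$G_{10}(x,y)=T(x,y)\Big\{\sum_{i\ge0}q^{(2)}_{i,-1}(0)(y-x^i)-y\sum_{j\ge0}q^{(1)}_{-1,j}(0)(1-x^{-1}y^j)\Big\},$$ $$G_{00}(x,y)=y\,T(x,y)\sum_{j\ge0}q^{(1)}_{-1,j}(0)(1-x^{-1}y^j).$$ The function $x=s(y)$ is the solution of $K(s(y),y)=0$ with $s(y)\to1$ as $y\to1$. Under stability, $\Pi_0(0,0)$ equals the left-hand side of the stability condition in the claim. *)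

theory Defs
  imports "HOL-Analysis.Analysis" "HOL-Probability.Probability"
begin

section \<open>Continuous-time Markov chains with given transition rates\<close>

definition transition_semigroup :: "(real \<Rightarrow> 's \<Rightarrow> 's pmf) \<Rightarrow> bool" where
  "transition_semigroup K \<longleftrightarrow>
     (\<forall>s. K 0 s = return_pmf s) \<and>
     (\<forall>t\<ge>0. \<forall>u\<ge>0. \<forall>s. K (t + u) s = bind_pmf (K t s) (K u))"

text \<open>Off the diagonal \<^term>\<open>rt s s'\<close> is the rate of jumping from \<open>s\<close> to \<open>s'\<close>; the diagonal
  values of \<open>rt\<close> play no role.\<close>

definition has_transition_rates :: "(real \<Rightarrow> 's \<Rightarrow> 's pmf) \<Rightarrow> ('s \<Rightarrow> 's \<Rightarrow> real) \<Rightarrow> bool" where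
  "has_transition_rates K rt \<longleftrightarrow>
     (\<forall>s s'. s' \<noteq> s \<longrightarrow> ((\<lambda>h. pmf (K h s) s' / h) \<longlongrightarrow> rt s s') (at_right 0)) \<and>
     (\<forall>s. ((\<lambda>h. (1 - pmf (K h s) s) / h) \<longlongrightarrow> (\<Sum>\<^sub>\<infinity>s'\<in>-{s}. rt s s')) (at_right 0))"

text \<open>The Markov property is expressed by the finite-dimensional distributions; no regularity
  of the sample paths is required.  The initial distribution is arbitrary.\<close>

definition ctmc :: "'w measure \<Rightarrow> (real \<Rightarrow> 'w \<Rightarrow> 's) \<Rightarrow> ('s \<Rightarrow> 's \<Rightarrow> real) \<Rightarrow> bool" where
  "ctmc M Z rt \<longleftrightarrow>
     prob_space M \<and>
     (\<forall>t\<ge>0. Z t \<in> measurable M (count_space UNIV)) \<and>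
     (\<exists>K. transition_semigroup K \<and> has_transition_rates K rt \<and>
       (\<forall>(n::nat) (t :: nat \<Rightarrow> real) z.
          0 \<le> t 0 \<and> (\<forall>i<n. t i \<le> t (Suc i)) \<longrightarrow>
          measure M {\<omega> \<in> space M. \<forall>i\<le>n. Z (t i) \<omega> = z i} =
          measure M {\<omega> \<in> space M. Z (t 0) \<omega> = z 0} *
            (\<Prod>i<n. pmf (K (t (Suc i) - t i) (z i)) (z (Suc i)))))"


section \<open>The two-queue model\<close>

text \<open>The phases \<open>0, 1, \<dots>, N\<close> are the elements of \<open>'n option\<close> with \<open>N = CARD('n)\<close>:
  phase \<open>0\<close> is \<^term>\<open>None\<close>, the phases \<open>1, \<dots>, N\<close> are the \<^term>\<open>Some k\<close>.

  The parameters below are those that do not depend on \<open>w\<close>: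
  \<open>qrate k i j\<close> is \<open>q\<^sub>i\<^sub>,\<^sub>j(k)\<close> with \<open>i, j \<ge> 0\<close>, \<open>qone j\<close> is the rate \<open>q\<^sup>(\<^sup>1\<^sup>)\<close> of the jump
  \<open>(-1, j)\<close> in phase \<open>0\<close>, \<open>qtwo i\<close> is the rate \<open>q\<^sup>(\<^sup>2\<^sup>)\<close> of the jump \<open>(i, -1)\<close> in phase \<open>0\<close>,
  \<open>theta\<close> are the phase change rates, and \<open>batch k m\<close> is the distribution \<open>a\<^sup>(\<^sup>k\<^sup>,\<^sup>m\<^sup>)\<close> of the jump
  that goes with a phase change.\<close>

record 'n model =
  qrate :: "'n option \<Rightarrow> nat \<Rightarrow> nat \<Rightarrow> real"
  qone :: "nat \<Rightarrow> real"
  qtwo :: "nat \<Rightarrow> real"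
  theta :: "'n option \<Rightarrow> 'n option \<Rightarrow> real"
  batch :: "'n option \<Rightarrow> 'n option \<Rightarrow> (nat \<times> nat) pmf"

definition valid_model :: "'n model \<Rightarrow> bool" where
  "valid_model P \<longleftrightarrow>
     (\<forall>k i j. 0 \<le> qrate P k i j) \<and> (\<forall>k. (\<lambda>(i, j). qrate P k i j) summable_on UNIV) \<and>
     (\<forall>j. 0 \<le> qone P j) \<and> summable (qone P) \<and>
     (\<forall>i. 0 \<le> qtwo P i) \<and> summable (qtwo P) \<and>
     (\<forall>k m. 0 \<le> theta P k m) \<and>
     (\<forall>k. 0 < theta P (Some k) None)"

text \<open>Jump rates in phase \<open>0\<close>: in the interior, on the two axes, and at the origin.\<close>

definition rate_interior :: "'n model \<Rightarrow> real \<Rightarrow> int \<Rightarrow> int \<Rightarrow> real" where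
  "rate_interior P w d1 d2 =
     (if d1 \<ge> 0 \<and> d2 \<ge> 0 then qrate P None (nat d1) (nat d2)
      else if d1 \<ge> 0 \<and> d2 = -1 then (1 - w) * qtwo P (nat d1)
      else if d1 = -1 \<and> d2 \<ge> 0 then w * qone P (nat d2)
      else 0)"

definition rate_axis1 :: "'n model \<Rightarrow> int \<Rightarrow> int \<Rightarrow> real" where
  "rate_axis1 P d1 d2 =
     (if d1 \<ge> 0 \<and> d2 \<ge> 0 then qrate P None (nat d1) (nat d2)
      else if d1 = -1 \<and> d2 \<ge> 0 then qone P (nat d2)
      else 0)"

definition rate_axis2 :: "'n model \<Rightarrow> int \<Rightarrow> int \<Rightarrow> real" where
  "rate_axis2 P d1 d2 =
     (if d1 \<ge> 0 \<and> d2 \<ge> 0 then qrate P None (nat d1) (nat d2)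
      else if d1 \<ge> 0 \<and> d2 = -1 then qtwo P (nat d1)
      else 0)"

definition rate_origin :: "'n model \<Rightarrow> int \<Rightarrow> int \<Rightarrow> real" where
  "rate_origin P d1 d2 =
     (if d1 \<ge> 0 \<and> d2 \<ge> 0 then qrate P None (nat d1) (nat d2) else 0)"

definition transition_rate ::
  "'n model \<Rightarrow> real \<Rightarrow> nat \<times> nat \<times> 'n option \<Rightarrow> nat \<times> nat \<times> 'n option \<Rightarrow> real" where
  "transition_rate P w = (\<lambda>(x1, x2, k) (x1', x2', k').
     let d1 = int x1' - int x1; d2 = int x2' - int x2 in
     if k \<noteq> k' then
       (if d1 \<ge> 0 \<and> d2 \<ge> 0 then theta P k k' * pmf (batch P k k') (nat d1, nat d2) else 0)
     else if k \<noteq> None then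
       (if d1 \<ge> 0 \<and> d2 \<ge> 0 then qrate P k (nat d1) (nat d2) else 0)
     else if x1 \<ge> 1 \<and> x2 \<ge> 1 then rate_interior P w d1 d2
     else if x1 \<ge> 1 then rate_axis1 P d1 d2
     else if x2 \<ge> 1 then rate_axis2 P d1 d2
     else rate_origin P d1 d2)"


section \<open>Generating functions\<close>

text \<open>These functions are polymorphic because the stability condition differentiates them along
  a real curve, while the expansion concerns complex arguments.\<close>

definition Pi_gf :: "(nat \<times> nat \<times> 'n option \<Rightarrow> real) \<Rightarrow> 'n option \<Rightarrow>
    'a::{real_normed_field,banach} \<Rightarrow> 'a \<Rightarrow> 'a" where
  "Pi_gf p k x y = (\<Sum>\<^sub>\<infinity>(i, j). of_real (p (i, j, k)) * x ^ i * y ^ j)"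

definition A_gf :: "'n model \<Rightarrow> 'n option \<Rightarrow> 'n option \<Rightarrow>
    'a::{real_normed_field,banach} \<Rightarrow> 'a \<Rightarrow> 'a" where
  "A_gf P k m x y = (\<Sum>\<^sub>\<infinity>(i, j). of_real (pmf (batch P k m) (i, j)) * x ^ i * y ^ j)"

definition theta_out :: "'n::finite model \<Rightarrow> 'n option \<Rightarrow> real" where
  "theta_out P k = (\<Sum>m\<in>UNIV - {k}. theta P k m)"

definition D_fun :: "'n::finite model \<Rightarrow> 'n option \<Rightarrow>
    'a::{real_normed_field,banach} \<Rightarrow> 'a \<Rightarrow> 'a" where
  "D_fun P k x y = of_real (theta_out P k) +
     (\<Sum>\<^sub>\<infinity>(i, j)\<in>UNIV - {(0, 0)}. of_real (qrate P k i j) * (1 - x ^ i * y ^ j))"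

definition R_fun :: "'n::finite model \<Rightarrow> real \<Rightarrow> 'a::{real_normed_field,banach} \<Rightarrow> 'a \<Rightarrow> 'a" where
  "R_fun P w x y = x * y * D_fun P None x y +
     y * (\<Sum>\<^sub>\<infinity>j. of_real (rate_interior P w (-1) (int j)) * (x - y ^ j)) +
     x * (\<Sum>\<^sub>\<infinity>i. of_real (rate_interior P w (int i) (-1)) * (y - x ^ i))"

definition K_fun :: "'n model \<Rightarrow> 'a::{real_normed_field,banach} \<Rightarrow> 'a \<Rightarrow> 'a" where
  "K_fun P x y = x * (\<Sum>\<^sub>\<infinity>i. of_real (qtwo P i) * (y - x ^ i)) -
     y * (\<Sum>\<^sub>\<infinity>j. of_real (qone P j) * (x - y ^ j))"

definition C_fun :: "'n model \<Rightarrow> real \<Rightarrow> 'a::{real_normed_field,banach} \<Rightarrow> 'a \<Rightarrow> 'a" where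
  "C_fun P w x y = of_real w * K_fun P x y +
     y * (\<Sum>\<^sub>\<infinity>j. of_real (qone P j) * (x - y ^ j))"

definition L_mat :: "'n::finite model \<Rightarrow> 'a::{real_normed_field,banach} \<Rightarrow> 'a \<Rightarrow> 'a ^ 'n ^ 'n" where
  "L_mat P x y = (\<chi> k m. if k = m then D_fun P (Some k) x y
     else - of_real (theta P (Some k) (Some m)) * A_gf P (Some k) (Some m) x y)"

definition E_vec :: "'n::finite model \<Rightarrow> 'a::{real_normed_field,banach} \<Rightarrow> 'a \<Rightarrow> 'a ^ 'n" where
  "E_vec P x y = (\<chi> k. of_real (theta P None (Some k)) * A_gf P None (Some k) x y)"

definition F_fun :: "'n::finite model \<Rightarrow> 'n \<Rightarrow> 'a::{real_normed_field,banach} \<Rightarrow> 'a \<Rightarrow> 'a" where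
  "F_fun P k x y = (matrix_inv (transpose (L_mat P x y)) *v E_vec P x y) $ k"

text \<open>\<open>T\<close> is the reciprocal of the following sum, and is well defined only where it is nonzero.\<close>

definition T_denom :: "'n::finite model \<Rightarrow> 'a::{real_normed_field,banach} \<Rightarrow> 'a \<Rightarrow> 'a" where
  "T_denom P x y =
     (\<Sum>k\<in>UNIV. of_real (theta P (Some k) None) * A_gf P (Some k) None x y * F_fun P k x y)"

definition T_fun :: "'n::finite model \<Rightarrow> 'a::{real_normed_field,banach} \<Rightarrow> 'a \<Rightarrow> 'a" where
  "T_fun P x y = inverse (T_denom P x y)"

definition G_fun :: "'n::finite model \<Rightarrow> complex \<Rightarrow> complex \<Rightarrow> complex" where
  "G_fun P x y = T_fun P x y *
     (y * D_fun P None x y + (\<Sum>\<^sub>\<infinity>i. of_real (qtwo P i) * (y - x ^ i))) - y"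

definition G10_fun :: "'n::finite model \<Rightarrow> complex \<Rightarrow> complex \<Rightarrow> complex" where
  "G10_fun P x y = T_fun P x y *
     ((\<Sum>\<^sub>\<infinity>i. of_real (qtwo P i) * (y - x ^ i)) -
      y * (\<Sum>\<^sub>\<infinity>j. of_real (qone P j) * (1 - inverse x * y ^ j)))"

definition G00_fun :: "'n::finite model \<Rightarrow> complex \<Rightarrow> complex \<Rightarrow> complex" where
  "G00_fun P x y = y * T_fun P x y *
     (\<Sum>\<^sub>\<infinity>j. of_real (qone P j) * (1 - inverse x * y ^ j))"

text \<open>A zero of \<open>G(x, \<cdot>)\<close> in the closed unit disc, at a point where \<open>T\<close>, hence \<open>G\<close>, is defined.\<close>

definition is_G_zero :: "'n::finite model \<Rightarrow> complex \<Rightarrow> complex \<Rightarrow> bool" where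
  "is_G_zero P x y \<longleftrightarrow> norm y \<le> 1 \<and> T_denom P x y \<noteq> 0 \<and> G_fun P x y = 0"

definition Y_fun :: "'n::finite model \<Rightarrow> complex \<Rightarrow> complex" where
  "Y_fun P x = (THE y. is_G_zero P x y)"

text \<open>\<open>V k m\<close> is the coefficient \<open>V\<^sub>m\<^sup>(\<^sup>k\<^sup>)\<close>.  The index of \<open>Q\<close> is an integer because \<open>Q\<^sub>-\<^sub>1 = 0\<close> is used.\<close>

definition Q_fun :: "'n::finite model \<Rightarrow> ('n option \<Rightarrow> nat \<Rightarrow> complex \<Rightarrow> complex \<Rightarrow> complex) \<Rightarrow>
    int \<Rightarrow> complex \<Rightarrow> complex \<Rightarrow> complex" where
  "Q_fun P V m x y =
     (if m < 0 then 0
      else V None (nat m) x y - V None (nat m) x (Y_fun P x)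
           - V None (nat m) 0 y + V None (nat m) 0 (Y_fun P x))"


section \<open>The stability condition\<close>

text \<open>All functions involved are defined on the closed unit bidisc only, so \<open>y\<close> tends to \<open>1\<close> from the
  left along the reals and \<open>s(y)\<close> lies in \<open>[-1, 1]\<close>.  Differentiability of \<open>s\<close> is what gives the
  derivatives in the condition a meaning.\<close>

definition kernel_branch :: "'n model \<Rightarrow> (real \<Rightarrow> real) \<Rightarrow> bool" where
  "kernel_branch P s \<longleftrightarrow>
     (\<forall>\<^sub>F y in at_left 1. \<bar>s y\<bar> \<le> 1 \<and> K_fun P (s y) y = 0 \<and> s differentiable at y) \<and>
     (s \<longlongrightarrow> 1) (at_left 1)"

definition stability_condition :: "'n::finite model \<Rightarrow> real \<Rightarrow> (real \<Rightarrow> real) \<Rightarrow> bool" where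
  "stability_condition P w s \<longleftrightarrow> (\<exists>l.
     ((\<lambda>y. deriv (\<lambda>y. R_fun P w (s y) y * T_fun P (s y) y - s y * y) y /
           deriv (\<lambda>y. T_fun P (s y) y * C_fun P w (s y) y) y) \<longlongrightarrow> l) (at_left 1) \<and>
     inverse (1 + (\<Sum>k\<in>UNIV. F_fun P k (1::real) 1)) * l > 0)"

end

theory Submission
  imports Defs "HOL-Complex_Analysis.Conformal_Mappings"
begin

text \<open>
  A limit distribution is invariant under the transition semigroup, hence satisfies the balance
  equations (\<open>limit_distribution_balance\<close>).  Tested against monomials they become linear equations
  for the generating functions.  The equations of the phases other than \<open>0\<close> have the matrix \<open>L\<close>,
  whose diagonal dominates, so that \<open>\<Pi>\<^sub>k = F\<^sub>k \<Pi>\<^sub>0\<close> (\<open>Pi_gf_Some\<close>).  Substituting this in the equation of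
  phase \<open>0\<close>, multiplied by \<open>y T(x,y)\<close>, yields
  \[G(x,y)\, \Pi_0(x,y) = G_{10}(x,y)\, B(x,y) + G_{00}(x,y)\, \Pi_0(0,0),\]
  where the boundary term \<open>B(x,y)\<close> is the sum of \<open>\<Pi>\<^sub>0(x,0)\<close> and \<open>w\<close> times the part of \<open>\<Pi>\<^sub>0\<close> that belongs to
  two nonempty queues (\<open>G_equation\<close>).

  The stability condition is used through the curve \<open>x = s(y)\<close>, on which the two services balance.
  There the equation reduces to one between \<open>\<Pi>\<^sub>0(s(y),y)\<close> and \<open>\<Pi>\<^sub>0(0,0)\<close> with coefficients independent
  of \<open>w\<close>.  As \<open>\<Pi>\<^sub>0(1,1)\<close> does not depend on \<open>w\<close> either, letting \<open>y\<close> tend to \<open>1\<close> shows that \<open>\<Pi>\<^sub>0(0,0)\<close>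
  is the same for all \<open>w\<close> and positive (\<open>empty_probability_eq\<close>, \<open>empty_probability_pos\<close>).  What the
  condition contributes is that neither function whose derivative occurs in it vanishes identically
  near \<open>1\<close>.

  The zeros of \<open>G(x, \<cdot>)\<close> solve \<open>y = g(x,y)\<close> for a power series \<open>g\<close> with nonnegative coefficients
  of sum \<open>1\<close>.  To see this without writing down coefficients of \<open>L\<^sup>-\<^sup>1\<close>, the function \<open>T_denom\<close> is
  expressed by the solution \<open>return_gf\<close> of a linear system, and the relation \<open>majorizes\<close> is carried over
  to solutions by a maximum principle.  The derivative of \<open>g(1, \<cdot>)\<close> at \<open>1\<close> is less than \<open>1\<close>, since
  at \<open>x = 1\<close> the kernel equation says that the arrivals at the second queue are worked off although
  in phase \<open>0\<close> this queue is not served with probability at least \<open>\<Pi>\<^sub>0(0,0)\<close> (\<open>arrival_drift\<close>).  So \<open>g(x, \<cdot>)\<close> is a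
  contraction of the closed disc, which gives existence, uniqueness and continuity of its fixed
  point \<open>Y(x)\<close>, also for \<open>\<bar>x\<bar> = 1\<close>.

  Comparing coefficients of \<open>w\<^sup>m\<close> in the equation above, at \<open>y\<close> and at \<open>Y(x)\<close>, eliminates \<open>V\<^sub>m(x,0)\<close>
  and yields the claimed formulas, provided that \<open>G\<^sub>1\<^sub>0(x,Y(x)) \<noteq> 0\<close>.  At the remaining points \<open>x\<close> the
  formula for \<open>m > 0\<close> rests on a continuity argument: \<open>B(x,Y(x))\<close> is independent of \<open>w\<close> where \<open>G\<^sub>1\<^sub>0(x,Y(x))\<close> does not
  vanish, and these points are dense by the identity theorem (\<open>G10_nonzero_dense\<close>); as
  \<open>B(x,Y(x))\<close> is continuous in \<open>x\<close> for every fixed \<open>w\<close>, it is independent of \<open>w\<close> at all \<open>x\<close>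
  (\<open>boundary_term_constant\<close>).
\<close>


section \<open>Infinite sums with summable nonnegative weights\<close>

text \<open>Dominated convergence for unordered sums along an arbitrary filter.\<close>

lemma tendsto_infsum_dominated:
  fixes f :: "'b \<Rightarrow> 'c \<Rightarrow> 'd::banach"
  assumes bound: "\<And>x y. x \<in> X \<Longrightarrow> y \<in> Y \<Longrightarrow> norm (f x y) \<le> M x"
    and M: "M summable_on X"
    and lim: "\<And>x. x \<in> X \<Longrightarrow> (f x \<longlongrightarrow> g x) G"
    and ev: "eventually (\<lambda>y. y \<in> Y) G"
  shows "((\<lambda>y. \<Sum>\<^sub>\<infinity>x\<in>X. f x y) \<longlongrightarrow> (\<Sum>\<^sub>\<infinity>x\<in>X. g x)) G"
proof (cases "G = bot")
  case False
  have g: "norm (g x) \<le> M x" if x: "x \<in> X" for x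
  proof (rule tendsto_upperbound[OF tendsto_norm[OF lim[OF x]] _ False])
    show "\<forall>\<^sub>F y in G. norm (f x y) \<le> M x"
      using ev by eventually_elim (use bound x in auto)
  qed
  have "g summable_on X"
    by (rule abs_summable_summable, rule Infinite_Sum.abs_summable_on_comparison_test'[OF M g])
  then have "(sum g \<longlongrightarrow> infsum g X) (finite_subsets_at_top X)"
    by (simp add: has_sum_infsum flip: has_sum_def)
  moreover have "uniform_limit Y (\<lambda>F y. \<Sum>x\<in>F. f x y) (\<lambda>y. \<Sum>\<^sub>\<infinity>x\<in>X. f x y) (finite_subsets_at_top X)"
    by (rule Weierstrass_m_test_general[OF bound M])
  moreover have "\<forall>\<^sub>F F in finite_subsets_at_top X. ((\<lambda>y. \<Sum>x\<in>F. f x y) \<longlongrightarrow> sum g F) G"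
    by (rule eventually_finite_subsets_at_top_weakI) (auto intro!: tendsto_sum lim)
  ultimately show ?thesis
    by (intro swap_uniform_limit'[OF _ _ _ ev finite_subsets_at_top_neq_bot])
qed auto

lemma weighted_abs_summable:
  fixes g :: "'b \<Rightarrow> 'a::{real_normed_field,banach}"
  assumes "a summable_on A" "\<And>t. t \<in> A \<Longrightarrow> 0 \<le> a t" "\<And>t. t \<in> A \<Longrightarrow> norm (g t) \<le> B"
  shows "(\<lambda>t. norm (of_real (a t) * g t)) summable_on A"
proof (rule Infinite_Sum.abs_summable_on_comparison_test')
  show "(\<lambda>t. a t * B) summable_on A"
    by (intro summable_on_cmult_left assms)
  show "norm (of_real (a t) * g t) \<le> a t * B" if "t \<in> A" for t
    using assms(2,3)[OF that] by (simp add: norm_mult mult_left_mono)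
qed

lemma weighted_summable:
  fixes g :: "'b \<Rightarrow> 'a::{real_normed_field,banach}"
  assumes "a summable_on A" "\<And>t. t \<in> A \<Longrightarrow> 0 \<le> a t" "\<And>t. t \<in> A \<Longrightarrow> norm (g t) \<le> B"
  shows "(\<lambda>t. of_real (a t) * g t) summable_on A"
  by (rule abs_summable_summable, rule weighted_abs_summable[OF assms])

lemma norm_weighted_infsum_le:
  fixes g :: "'b \<Rightarrow> 'a::{real_normed_field,banach}"
  assumes "a summable_on A" "\<And>t. t \<in> A \<Longrightarrow> 0 \<le> a t" "\<And>t. t \<in> A \<Longrightarrow> norm (g t) \<le> h t"
    "\<And>t. t \<in> A \<Longrightarrow> h t \<le> (1::real)"
  shows "norm (\<Sum>\<^sub>\<infinity>t\<in>A. of_real (a t) * g t) \<le> (\<Sum>\<^sub>\<infinity>t\<in>A. a t * h t)"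
proof (rule norm_infsum_le)
  have h1: "norm (g t) \<le> 1" "norm (h t) \<le> 1" if "t \<in> A" for t
  proof -
    have "0 \<le> h t" by (rule order_trans[OF norm_ge_zero assms(3)[OF that]])
    then show "norm (g t) \<le> 1" "norm (h t) \<le> 1"
      using assms(3,4)[OF that] by auto
  qed
  show "((\<lambda>t. of_real (a t) * g t) has_sum (\<Sum>\<^sub>\<infinity>t\<in>A. of_real (a t) * g t)) A"
    by (intro has_sum_infsum weighted_summable[where B=1] assms h1)
  have "(\<lambda>t. of_real (a t) * h t) summable_on A"
    by (intro weighted_summable[where B=1] assms h1)
  then show "((\<lambda>t. a t * h t) has_sum (\<Sum>\<^sub>\<infinity>t\<in>A. a t * h t)) A"
    by (intro has_sum_infsum) simp
  show "norm (of_real (a t) * g t) \<le> a t * h t" if "t \<in> A" for t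
    using assms(2,3)[OF that] by (simp add: norm_mult mult_left_mono)
qed

lemma continuous_on_weighted_infsum:
  fixes g :: "'b \<Rightarrow> 'c::topological_space \<Rightarrow> 'a::{real_normed_field,banach}"
  assumes "a summable_on A" "\<And>t. t \<in> A \<Longrightarrow> 0 \<le> a t"
    and "\<And>t z. t \<in> A \<Longrightarrow> z \<in> U \<Longrightarrow> norm (g t z) \<le> B"
    and "\<And>t. t \<in> A \<Longrightarrow> continuous_on U (g t)"
  shows "continuous_on U (\<lambda>z. \<Sum>\<^sub>\<infinity>t\<in>A. of_real (a t) * g t z)"
  unfolding continuous_on_def
proof
  fix z assume z: "z \<in> U"
  show "((\<lambda>z. \<Sum>\<^sub>\<infinity>t\<in>A. of_real (a t) * g t z) \<longlongrightarrow> (\<Sum>\<^sub>\<infinity>t\<in>A. of_real (a t) * g t z)) (at z within U)"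
  proof (rule tendsto_infsum_dominated[where Y=U and M="\<lambda>t. a t * B"])
    show "(\<lambda>t. a t * B) summable_on A" by (intro summable_on_cmult_left assms)
    show "norm (of_real (a t) * g t y) \<le> a t * B" if "t \<in> A" "y \<in> U" for t y
      using assms(2)[of t] assms(3)[of t y] that by (simp add: norm_mult mult_left_mono)
    show "((\<lambda>z. of_real (a t) * g t z) \<longlongrightarrow> of_real (a t) * g t z) (at z within U)" if "t \<in> A" for t
      using assms(4)[OF that] z by (intro tendsto_intros) (auto simp: continuous_on_def)
  qed (auto simp: eventually_at_filter)
qed

lemma holomorphic_weighted_infsum:
  fixes g :: "'b \<Rightarrow> complex \<Rightarrow> complex"
  assumes "a summable_on A" "\<And>t. t \<in> A \<Longrightarrow> 0 \<le> a t"
    and "\<And>t z. t \<in> A \<Longrightarrow> z \<in> cball 0 1 \<Longrightarrow> norm (g t z) \<le> B"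
    and "\<And>t. t \<in> A \<Longrightarrow> continuous_on (cball 0 1) (g t)"
    and "\<And>t. t \<in> A \<Longrightarrow> g t holomorphic_on ball 0 1"
  shows "(\<lambda>z. \<Sum>\<^sub>\<infinity>t\<in>A. of_real (a t) * g t z) holomorphic_on ball 0 1"
proof -
  have ul: "uniform_limit (cball 0 1) (\<lambda>F z. \<Sum>t\<in>F. of_real (a t) * g t z)
      (\<lambda>z. \<Sum>\<^sub>\<infinity>t\<in>A. of_real (a t) * g t z) (finite_subsets_at_top A)"
  proof (rule Weierstrass_m_test_general)
    show "(\<lambda>t. a t * B) summable_on A" by (intro summable_on_cmult_left assms)
    show "norm (of_real (a t) * g t y) \<le> a t * B" if "t \<in> A" "y \<in> cball 0 1" for t y
      using assms(2)[of t] assms(3)[of t y] that by (simp add: norm_mult mult_left_mono)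
  qed
  have part: "\<forall>\<^sub>F F in finite_subsets_at_top A.
      continuous_on (cball 0 1) (\<lambda>z. \<Sum>t\<in>F. of_real (a t) * g t z) \<and>
      (\<lambda>z. \<Sum>t\<in>F. of_real (a t) * g t z) holomorphic_on ball 0 1"
    by (rule eventually_finite_subsets_at_top_weakI)
       (auto intro!: continuous_intros holomorphic_intros assms(4,5))
  show ?thesis
    by (rule holomorphic_uniform_limit[OF part ul finite_subsets_at_top_neq_bot])
qed


section \<open>Balance equations of the limit distribution\<close>

lemma has_sum_pmf: "(pmf \<mu> has_sum 1) UNIV"
  using infsetsum_pmf_eq_1[of \<mu> UNIV] pmf_abs_summable[of \<mu> UNIV]
  by (metis abs_summable_equivalent abs_summable_summable has_sum_infsum infsetsum_infsum subset_UNIV)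

lemma pmf_bind_ge: "pmf (bind_pmf \<mu> f) z \<ge> pmf \<mu> s * pmf (f s) z"
proof -
  have "pmf \<mu> s * pmf (f s) z = (LINT x|measure_pmf \<mu>. indicator {s} x * pmf (f s) z)"
    by (simp add: measure_pmf_single)
  also have "\<dots> \<le> (LINT x|measure_pmf \<mu>. pmf (f x) z)"
    by (intro integral_mono measure_pmf.integrable_const_bound[where B=1])
       (auto split: split_indicator simp: pmf_le_1)
  finally show ?thesis by (simp add: pmf_bind)
qed

text \<open>The interval is divided into \<open>n\<close> steps of length \<open>t / n\<close>.  By Bernoulli's inequality the
  probability of being elsewhere than in \<open>s\<close> at time \<open>t\<close> is at most \<open>n\<close> times the corresponding
  probability for a single step, and as \<open>n\<close> grows this bound tends to \<open>t\<close> times the exit rate.\<close>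

lemma leave_probability_le:
  assumes K: "transition_semigroup K" and t: "t > 0"
    and q: "((\<lambda>h. (1 - pmf (K h s) s) / h) \<longlongrightarrow> q) (at_right 0)"
  shows "1 - pmf (K t s) s \<le> t * q"
proof -
  have iter: "pmf (K (real n * h) s) s \<ge> pmf (K h s) s ^ n" if h: "h \<ge> 0" for h n
  proof (induction n)
    case 0
    then show ?case using K by (simp add: transition_semigroup_def)
  next
    case (Suc n)
    have "K (real (Suc n) * h) s = bind_pmf (K (real n * h) s) (K h)"
    proof -
      have "K (real n * h + h) s = bind_pmf (K (real n * h) s) (K h)"
        using K h by (simp add: transition_semigroup_def del: distrib_left distrib_right)
      moreover have "real (Suc n) * h = real n * h + h" by (simp add: algebra_simps)
      ultimately show ?thesis by simp
    qed
    then have "pmf (K (real (Suc n) * h) s) s \<ge> pmf (K (real n * h) s) s * pmf (K h s) s"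
      using pmf_bind_ge by metis
    moreover have "pmf (K (real n * h) s) s * pmf (K h s) s \<ge> pmf (K h s) s ^ n * pmf (K h s) s"
      by (intro mult_right_mono Suc) auto
    ultimately show ?case by (simp add: mult.commute)
  qed
  define h where "h n = t / real (Suc n)" for n
  have step: "1 - pmf (K t s) s \<le> t * ((1 - pmf (K (h n) s) s) / h n)" for n
  proof -
    have "1 - real (Suc n) * (1 - pmf (K (h n) s) s) \<le> pmf (K (h n) s) s ^ Suc n"
      using Bernoulli_inequality[of "pmf (K (h n) s) s - 1" "Suc n"] by (simp add: algebra_simps)
    also have "\<dots> \<le> pmf (K (real (Suc n) * h n) s) s"
      by (rule iter) (use t in \<open>simp add: h_def\<close>)
    finally have "1 - pmf (K t s) s \<le> real (Suc n) * (1 - pmf (K (h n) s) s)"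
      by (simp add: h_def)
    also have "\<dots> = t * ((1 - pmf (K (h n) s) s) / h n)"
      using t by (simp add: h_def field_simps)
    finally show ?thesis .
  qed
  have "h \<longlonglongrightarrow> 0"
    unfolding h_def by (rule real_tendsto_divide_at_top[OF tendsto_const])
      (rule filterlim_compose[OF filterlim_real_sequentially filterlim_Suc])
  then have "filterlim h (at_right 0) sequentially"
    using t by (intro tendsto_imp_filterlim_at_right) (auto simp: h_def)
  then have "(\<lambda>n. t * ((1 - pmf (K (h n) s) s) / h n)) \<longlonglongrightarrow> t * q"
    by (intro tendsto_intros) (rule filterlim_compose[OF q])
  then show ?thesis
    by (rule LIMSEQ_le_const) (use step in auto)
qed

text \<open>Summing the finite-dimensional distributions over finitely many initial states only and letting
  \<open>t\<close> tend to infinity gives one inequality for each state \<open>z\<close>.  Both sides have total mass \<open>1\<close>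
  because no mass is lost in the limit, so that equality holds for all \<open>z\<close>.\<close>

lemma limit_distribution_invariant:
  fixes Z :: "real \<Rightarrow> 'w \<Rightarrow> 's::countable"
  assumes M: "prob_space M" and meas: "\<And>t. t \<ge> 0 \<Longrightarrow> Z t \<in> measurable M (count_space UNIV)"
    and trans: "\<And>t s z. t \<ge> 0 \<Longrightarrow> measure M {\<omega> \<in> space M. Z t \<omega> = s \<and> Z (t + h) \<omega> = z} =
        measure M {\<omega> \<in> space M. Z t \<omega> = s} * pmf (K s) z"
    and limit: "\<And>z. ((\<lambda>t. measure M {\<omega> \<in> space M. Z t \<omega> = z}) \<longlongrightarrow> p z) at_top"
    and distribution: "(p has_sum 1) UNIV" and h: "h \<ge> 0"
  shows "((\<lambda>s. p s * pmf (K s) z) has_sum p z) UNIV"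
proof -
  interpret prob_space M by (rule M)
  define a where "a t s = measure M {\<omega> \<in> space M. Z t \<omega> = s}" for t s
  have p0: "p s \<ge> 0" for s
    by (rule tendsto_lowerbound[OF limit]) auto
  have ev[measurable]: "{\<omega> \<in> space M. Z t \<omega> = s} \<in> sets M" if "t \<ge> 0" for t s
    using measurable_sets[OF meas[OF that], of "{s}"] by (simp add: vimage_def Int_def conj_commute)
  have ev2: "{\<omega> \<in> space M. Z t \<omega> = s \<and> Z (t + h) \<omega> = z} \<in> sets M" if "t \<ge> 0" for t s z
  proof -
    have "{\<omega> \<in> space M. Z t \<omega> = s \<and> Z (t + h) \<omega> = z} =
        {\<omega> \<in> space M. Z t \<omega> = s} \<inter> {\<omega> \<in> space M. Z (t + h) \<omega> = z}" by auto
    then show ?thesis using ev[of t s] ev[of "t+h" z] h that by auto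
  qed
  have part: "(\<Sum>s\<in>F. a t s * pmf (K s) z) \<le> a (t + h) z" if F: "finite F" and t: "t \<ge> 0" for F t z
  proof -
    have "(\<Sum>s\<in>F. a t s * pmf (K s) z) = (\<Sum>s\<in>F. measure M {\<omega> \<in> space M. Z t \<omega> = s \<and> Z (t + h) \<omega> = z})"
      by (simp add: a_def trans[OF t])
    also have "\<dots> = measure M (\<Union>s\<in>F. {\<omega> \<in> space M. Z t \<omega> = s \<and> Z (t + h) \<omega> = z})"
      by (intro finite_measure_finite_Union[symmetric] F) (auto simp: disjoint_family_on_def ev2 t)
    also have "\<dots> \<le> a (t + h) z"
      unfolding a_def using t h by (intro finite_measure_mono ev) auto
    finally show ?thesis .
  qed
  have lim: "((\<lambda>t. a t s) \<longlongrightarrow> p s) at_top" for s unfolding a_def by (rule limit)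
  have part': "(\<Sum>s\<in>F. p s * pmf (K s) z) \<le> p z" if F: "finite F" for F z
  proof (rule tendsto_le[of "at_top :: real filter"])
    have "filterlim (\<lambda>t. t + h) at_top (at_top :: real filter)"
      by (rule filterlim_at_top_mono[OF filterlim_ident]) (use h in auto)
    then show "((\<lambda>t. a (t + h) z) \<longlongrightarrow> p z) at_top"
      by (rule filterlim_compose[OF lim])
    show "((\<lambda>t. \<Sum>s\<in>F. a t s * pmf (K s) z) \<longlongrightarrow> (\<Sum>s\<in>F. p s * pmf (K s) z)) at_top"
      by (intro tendsto_intros lim)
    show "\<forall>\<^sub>F t in at_top. (\<Sum>s\<in>F. a t s * pmf (K s) z) \<le> a (t + h) z"
      using eventually_ge_at_top[of 0] by eventually_elim (rule part[OF F])
  qed auto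
  have summ: "(\<lambda>s. p s * pmf (K s) z) summable_on UNIV" for z
    by (rule nonneg_bdd_above_summable_on) (auto intro!: bdd_aboveI[of _ "p z"] part' mult_nonneg_nonneg p0)
  define u where "u z = (\<Sum>\<^sub>\<infinity>s. p s * pmf (K s) z)" for z
  have u: "((\<lambda>s. p s * pmf (K s) z) has_sum u z) UNIV" for z
    unfolding u_def by (rule has_sum_infsum[OF summ])
  have ule: "u z \<le> p z" for z
    unfolding u_def by (rule infsum_le_finite_sums[OF summ]) (use part' in auto)
  have inner: "((\<lambda>z. p s * pmf (K s) z) has_sum p s) UNIV" for s
    using has_sum_cmult_right[OF has_sum_pmf[of "K s"], of "p s"] by simp
  have dbl: "(\<lambda>(s, z). p s * pmf (K s) z) summable_on UNIV \<times> UNIV"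
    by (rule summable_on_SigmaI[where g=p])
       (use inner distribution p0 in \<open>auto simp: summable_on_def\<close>)
  have "((\<lambda>(s, z). p s * pmf (K s) z) has_sum 1) (UNIV \<times> UNIV)"
    by (rule has_sum_SigmaI[where g=p, OF _ distribution dbl]) (use inner in simp)
  then have "((\<lambda>(z, s). p s * pmf (K s) z) has_sum 1) (UNIV \<times> UNIV)"
    by (subst (asm) has_sum_swap) simp
  then have "(u has_sum 1) UNIV"
    by (rule has_sum_SigmaD) (use u in auto)
  from has_sum_add[OF distribution has_sum_uminusI[OF this]]
  have d0: "((\<lambda>z. p z + - u z) has_sum 1 + - 1) UNIV" .
  have "p z + - u z = 0"
    by (rule nonneg_has_sum_le_0D[OF d0]) (use ule in auto)
  with u[of z] show ?thesis by simp
qed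

text \<open>The invariance of \<open>p\<close> under the transition semigroup, divided by the length of the time step,
  yields the balance equation at time \<open>0\<close>.  The bound on the exit rates dominates the sum over the
  states from which \<open>z\<close> is entered.\<close>

lemma limit_distribution_balance:
  fixes Z :: "real \<Rightarrow> 'w \<Rightarrow> 's::countable"
  assumes ctmc: "ctmc M Z rt"
    and B: "\<And>s. (\<Sum>\<^sub>\<infinity>s'\<in>-{s}. rt s s') \<le> B"
    and limit: "\<And>z. ((\<lambda>t. measure M {\<omega> \<in> space M. Z t \<omega> = z}) \<longlongrightarrow> p z) at_top"
    and distribution: "(p has_sum 1) UNIV"
  shows "p z * (\<Sum>\<^sub>\<infinity>s\<in>-{z}. rt z s) = (\<Sum>\<^sub>\<infinity>s\<in>-{z}. p s * rt s z)"
proof -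
  interpret prob_space M using ctmc by (simp add: ctmc_def)
  have meas: "Z t \<in> measurable M (count_space UNIV)" if "t \<ge> 0" for t
    using ctmc that by (simp add: ctmc_def)
  from ctmc obtain K where K: "transition_semigroup K" and rates: "has_transition_rates K rt"
    and fdd: "\<And>(n::nat) (t :: nat \<Rightarrow> real) z. 0 \<le> t 0 \<Longrightarrow> \<forall>i<n. t i \<le> t (Suc i) \<Longrightarrow>
          measure M {\<omega> \<in> space M. \<forall>i\<le>n. Z (t i) \<omega> = z i} =
          measure M {\<omega> \<in> space M. Z (t 0) \<omega> = z 0} *
            (\<Prod>i<n. pmf (K (t (Suc i) - t i) (z i)) (z (Suc i)))"
    unfolding ctmc_def by auto
  have trans: "measure M {\<omega> \<in> space M. Z t \<omega> = s \<and> Z (t + h) \<omega> = z} =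
        measure M {\<omega> \<in> space M. Z t \<omega> = s} * pmf (K h s) z" if "t \<ge> 0" "h \<ge> 0" for t h s z
  proof -
    have "(\<forall>i\<le>Suc 0. Z (if i = 0 then t else t + h) \<omega> = (if i = 0 then s else z)) \<longleftrightarrow>
        Z t \<omega> = s \<and> Z (t + h) \<omega> = z" for \<omega>
      by (auto simp: le_Suc_eq)
    then show ?thesis
      using fdd[of "\<lambda>i. if i = 0 then t else t + h" 1 "\<lambda>i. if i = 0 then s else z"] that by simp
  qed
  have p0: "p s \<ge> 0" for s
    by (rule tendsto_lowerbound[OF limit]) auto
  have inv: "((\<lambda>s. p s * pmf (K h s) z) has_sum p z) UNIV" if "h \<ge> 0" for h
    by (rule limit_distribution_invariant[OF prob_space_axioms meas trans[OF _ that] limit distribution that])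
  have rate: "((\<lambda>h. pmf (K h s) s' / h) \<longlongrightarrow> rt s s') (at_right 0)" if "s' \<noteq> s" for s s'
    using rates that by (simp add: has_transition_rates_def)
  have exit: "((\<lambda>h. (1 - pmf (K h s) s) / h) \<longlongrightarrow> (\<Sum>\<^sub>\<infinity>s'\<in>-{s}. rt s s')) (at_right 0)" for s
    using rates by (simp add: has_transition_rates_def)
  have pos: "\<forall>\<^sub>F h in at_right (0::real). h \<in> {0<..}"
    by (auto simp: eventually_at_right_less)
  have dom: "norm (p s * (pmf (K h s) z / h)) \<le> p s * B" if "s \<in> -{z}" "h \<in> {0<..}" for s h
  proof -
    have "pmf (K h s) z + pmf (K h s) s = measure (K h s) {s, z}"
      using that by (subst measure_measure_pmf_finite) auto
    then have "pmf (K h s) z \<le> 1 - pmf (K h s) s"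
      using measure_pmf.prob_le_1[of "K h s" "{s,z}"] by linarith
    also have "\<dots> \<le> h * (\<Sum>\<^sub>\<infinity>s'\<in>-{s}. rt s s')"
      using that by (intro leave_probability_le[OF K _ exit]) auto
    also have "\<dots> \<le> h * B"
      using that B[of s] by (intro mult_left_mono) auto
    finally have "pmf (K h s) z / h \<le> B" using that by (simp add: field_simps)
    then have "p s * (pmf (K h s) z / h) \<le> p s * B"
      by (rule mult_left_mono[OF _ p0])
    then show ?thesis using that p0[of s] by simp
  qed
  have "((\<lambda>h. \<Sum>\<^sub>\<infinity>s\<in>-{z}. p s * (pmf (K h s) z / h)) \<longlongrightarrow> (\<Sum>\<^sub>\<infinity>s\<in>-{z}. p s * rt s z)) (at_right 0)"
  proof (rule tendsto_infsum_dominated[OF dom _ _ pos])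
    show "(\<lambda>s. p s * B) summable_on -{z}"
      using distribution summable_on_subset_banach[of p UNIV "-{z}"]
      by (intro summable_on_cmult_left) (auto simp: summable_on_def)
    show "((\<lambda>h. p s * (pmf (K h s) z / h)) \<longlongrightarrow> p s * rt s z) (at_right 0)" if "s \<in> -{z}" for s
      using that by (intro tendsto_mult_left rate) auto
  qed
  moreover have "((\<lambda>h. \<Sum>\<^sub>\<infinity>s\<in>-{z}. p s * (pmf (K h s) z / h)) \<longlongrightarrow> p z * (\<Sum>\<^sub>\<infinity>s\<in>-{z}. rt z s)) (at_right 0)"
  proof (rule Lim_transform_eventually)
    show "((\<lambda>h. p z * ((1 - pmf (K h z) z) / h)) \<longlongrightarrow> p z * (\<Sum>\<^sub>\<infinity>s\<in>-{z}. rt z s)) (at_right 0)"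
      by (intro tendsto_intros exit)
    show "\<forall>\<^sub>F h in at_right 0. p z * ((1 - pmf (K h z) z) / h) = (\<Sum>\<^sub>\<infinity>s\<in>-{z}. p s * (pmf (K h s) z / h))"
      using pos
    proof eventually_elim
      case (elim h)
      have "((\<lambda>s. p s * pmf (K h s) z) has_sum (p z - p z * pmf (K h z) z)) (UNIV - {z})"
        using inv[of h] elim by (intro has_sum_Diff) (auto intro!: has_sum_finiteI)
      from has_sum_cmult_left[OF this, of "1 / h"]
      have "(\<Sum>\<^sub>\<infinity>s\<in>-{z}. p s * (pmf (K h s) z / h)) = (p z - p z * pmf (K h z) z) / h"
        by (intro infsumI) (simp add: Compl_eq_Diff_UNIV)
      then show ?case by (simp add: field_simps)
    qed
  qed
  ultimately show ?thesis
    using tendsto_unique[OF trivial_limit_at_right_real] by blast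
qed

text \<open>Testing the balance equations against a bounded function exchanges the two sums, which turns
  them into the statement that the generator has mean zero.\<close>

lemma balance_test_function:
  fixes f :: "'s \<Rightarrow> 'a::{real_normed_field,banach}"
  assumes rt0: "\<And>s s'. 0 \<le> rt s s'" and rt: "\<And>s. rt s summable_on UNIV"
    and B: "\<And>s. (\<Sum>\<^sub>\<infinity>s'\<in>-{s}. rt s s') \<le> B"
    and p0: "\<And>s. 0 \<le> p s" and p: "p summable_on UNIV"
    and balance: "\<And>z. p z * (\<Sum>\<^sub>\<infinity>s\<in>-{z}. rt z s) = (\<Sum>\<^sub>\<infinity>s\<in>-{z}. p s * rt s z)"
    and f: "\<And>s. norm (f s) \<le> 1"
  shows "(\<Sum>\<^sub>\<infinity>s. of_real (p s) * (\<Sum>\<^sub>\<infinity>s'. of_real (rt s s') * (f s' - f s))) = 0"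
proof -
  define r where "r s s' = (if s' = s then 0 else rt s s')" for s s'
  define q where "q s = (\<Sum>\<^sub>\<infinity>s'. r s s')" for s
  have r0: "0 \<le> r s s'" for s s' by (simp add: r_def rt0)
  have rs: "r s summable_on UNIV" for s
    by (rule summable_on_comparison_test[OF rt]) (auto simp: r_def rt0)
  have q: "q s = (\<Sum>\<^sub>\<infinity>s'\<in>-{s}. rt s s')" for s
    unfolding q_def by (rule infsum_cong_neutral) (auto simp: r_def)
  have q0: "0 \<le> q s" for s unfolding q_def by (intro infsum_nonneg r0)
  have pq: "(\<lambda>s. p s * q s) summable_on UNIV"
    by (rule summable_on_comparison_test[OF summable_on_cmult_left[OF p, of B]])
       (auto simp: q intro!: mult_left_mono B p0 mult_nonneg_nonneg q0[unfolded q])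
  have "(\<lambda>(s, s'). p s * r s s') summable_on UNIV \<times> UNIV"
    by (rule summable_on_SigmaI[where g="\<lambda>s. p s * q s"])
       (auto intro!: pq[unfolded q_def] mult_nonneg_nonneg p0 r0 has_sum_cmult_right has_sum_infsum rs simp: q_def)
  then have "(\<lambda>t. of_real (case t of (s, s') \<Rightarrow> p s * r s s') * f (snd t)) summable_on UNIV \<times> UNIV"
    by (rule weighted_summable[where B=1]) (auto intro!: mult_nonneg_nonneg p0 r0 f)
  then have dbl: "(\<lambda>(s, s'). of_real (p s * r s s') * f s') summable_on UNIV \<times> UNIV"
    by (simp add: case_prod_unfold)
  have outflow: "(\<Sum>\<^sub>\<infinity>s. of_real (p s * r s s') * f s') = of_real (p s' * q s') * f s'" for s'
  proof -
    have "((\<lambda>s. p s * r s s') has_sum p s' * q s') UNIV"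
    proof -
      have "(\<lambda>(s', s). p s * r s s') summable_on UNIV \<times> UNIV"
        using \<open>(\<lambda>(s, s'). p s * r s s') summable_on UNIV \<times> UNIV\<close>
        by (subst summable_on_swap) simp
      then have "(\<lambda>s. p s * r s s') summable_on UNIV"
        using summable_on_SigmaD1[of "\<lambda>s' s. p s * r s s'" UNIV "\<lambda>_. UNIV" s'] by simp
      moreover have "(\<Sum>\<^sub>\<infinity>s. p s * r s s') = (\<Sum>\<^sub>\<infinity>s\<in>-{s'}. p s * rt s s')"
        by (rule infsum_cong_neutral) (auto simp: r_def)
      ultimately show ?thesis using balance[of s'] by (simp add: has_sum_iff q)
    qed
    from has_sum_cmult_left[OF has_sum_of_real[OF this]] show ?thesis
      by (intro infsumI)
  qed
  have inflow: "(\<Sum>\<^sub>\<infinity>s'. of_real (p s * r s s') * f s') = of_real (p s) * (\<Sum>\<^sub>\<infinity>s'. of_real (r s s') * f s')" for s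
    by (simp add: mult.assoc infsum_cmult_right')
  have swap: "(\<Sum>\<^sub>\<infinity>s. of_real (p s) * (\<Sum>\<^sub>\<infinity>s'. of_real (r s s') * f s')) = (\<Sum>\<^sub>\<infinity>s. of_real (p s * q s) * f s)"
    using infsum_swap_banach[OF dbl] by (simp only: inflow outflow)
  have summ1: "(\<lambda>s. of_real (p s) * (\<Sum>\<^sub>\<infinity>s'. of_real (r s s') * f s')) summable_on UNIV"
    using summable_on_Sigma_banach[OF dbl] by (simp only: inflow)
  have summ2: "(\<lambda>s. of_real (p s * q s) * f s) summable_on UNIV"
    by (rule weighted_summable[OF pq, where B=1]) (auto intro!: mult_nonneg_nonneg p0 q0 f)
  have gen: "(\<Sum>\<^sub>\<infinity>s'. of_real (rt s s') * (f s' - f s)) =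
      (\<Sum>\<^sub>\<infinity>s'. of_real (r s s') * f s') - of_real (q s) * f s" for s
  proof -
    have "(\<lambda>s'. of_real (r s s') * f s') summable_on UNIV"
      by (rule weighted_summable[OF rs, where B=1]) (auto intro: r0 f)
    moreover have "((\<lambda>s'. of_real (r s s') * - f s) has_sum of_real (q s) * - f s) UNIV"
      by (intro has_sum_cmult_left has_sum_of_real) (simp add: q_def has_sum_infsum rs)
    ultimately have "((\<lambda>s'. of_real (r s s') * f s' + of_real (r s s') * - f s) has_sum
        (\<Sum>\<^sub>\<infinity>s'. of_real (r s s') * f s') + of_real (q s) * - f s) UNIV"
      by (intro has_sum_add has_sum_infsum)
    moreover have "of_real (r s s') * f s' + of_real (r s s') * - f s = of_real (rt s s') * (f s' - f s)" for s'
      by (simp add: r_def algebra_simps)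
    ultimately show ?thesis by (simp add: infsumI)
  qed
  have "((\<lambda>s. of_real (p s) * (\<Sum>\<^sub>\<infinity>s'. of_real (r s s') * f s') + - (of_real (p s * q s) * f s)) has_sum
      (\<Sum>\<^sub>\<infinity>s. of_real (p s) * (\<Sum>\<^sub>\<infinity>s'. of_real (r s s') * f s')) + - (\<Sum>\<^sub>\<infinity>s. of_real (p s * q s) * f s)) UNIV"
    by (intro has_sum_add has_sum_uminusI has_sum_infsum summ1 summ2)
  moreover have "of_real (p s) * (\<Sum>\<^sub>\<infinity>s'. of_real (r s s') * f s') + - (of_real (p s * q s) * f s) =
      of_real (p s) * (\<Sum>\<^sub>\<infinity>s'. of_real (rt s s') * (f s' - f s))" for s
    unfolding gen by (simp add: right_diff_distrib mult.assoc)
  ultimately have "((\<lambda>s. of_real (p s) * (\<Sum>\<^sub>\<infinity>s'. of_real (rt s s') * (f s' - f s))) has_sum 0) UNIV"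
    by (simp only: swap add.right_inverse)
  then show ?thesis by (rule infsumI)
qed


section \<open>The generator of the two-queue model\<close>

text \<open>Rates of the jumps that decrease neither queue.  They do not depend on the queue lengths, and
  treating jumps within a phase and phase changes alike makes the equations of all phases uniform.\<close>

definition jump_rate :: "'n model \<Rightarrow> 'n option \<Rightarrow> 'n option \<Rightarrow> nat \<times> nat \<Rightarrow> real" where
  "jump_rate P k k' = (\<lambda>(i, j). if k = k' then qrate P k i j else theta P k k' * pmf (batch P k k') (i, j))"

lemma jump_rate_nonneg: "valid_model P \<Longrightarrow> 0 \<le> jump_rate P k k' d"
  by (auto simp: valid_model_def jump_rate_def split: prod.split)

lemma jump_rate_summable:
  assumes "valid_model P"
  shows "jump_rate P k k' summable_on UNIV"
proof (cases "k = k'")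
  case True
  then show ?thesis using assms by (simp add: valid_model_def jump_rate_def)
next
  case False
  have "(\<lambda>d. theta P k k' * pmf (batch P k k') d) summable_on UNIV"
    using has_sum_pmf[of "batch P k k'"] by (intro summable_on_cmult_right) (auto simp: summable_on_def)
  then show ?thesis using False by (simp add: jump_rate_def case_prod_unfold)
qed

lemma qone_summable_on: "valid_model P \<Longrightarrow> qone P summable_on UNIV"
  and qtwo_summable_on: "valid_model P \<Longrightarrow> qtwo P summable_on UNIV"
  by (auto simp: valid_model_def summable_on_UNIV_nonneg_real_iff)

lemma qone_nonneg: "valid_model P \<Longrightarrow> 0 \<le> qone P j"
  and qtwo_nonneg: "valid_model P \<Longrightarrow> 0 \<le> qtwo P j"
  by (auto simp: valid_model_def)

lemma transition_rate_split:
  "transition_rate P w (x1, x2, k) (x1', x2', k') =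
     (if x1 \<le> x1' \<and> x2 \<le> x2' then jump_rate P k k' (x1' - x1, x2' - x2) else 0) +
     (if k = None \<and> k' = None \<and> x1' + 1 = x1 \<and> x2 \<le> x2'
      then (if x2 \<ge> 1 then w else 1) * qone P (x2' - x2) else 0) +
     (if k = None \<and> k' = None \<and> x1 \<le> x1' \<and> x2' + 1 = x2
      then (if x1 \<ge> 1 then 1 - w else 1) * qtwo P (x1' - x1) else 0)"
proof -
  have [simp]: "nat (int a - int b) = a - b" for a b by (simp flip: nat_minus_as_int)
  have [simp]: "int a - int b = - 1 \<longleftrightarrow> a + 1 = b" for a b by linarith
  show ?thesis
    by (cases "k = k'"; cases k)
       (auto simp: transition_rate_def jump_rate_def Let_def rate_interior_def rate_axis1_def
         rate_axis2_def rate_origin_def)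
qed

lemma transition_rate_nonneg:
  assumes "valid_model P" "0 < w" "w < 1"
  shows "0 \<le> transition_rate P w s s'"
  using assms jump_rate_nonneg[OF assms(1)] qone_nonneg[OF assms(1)] qtwo_nonneg[OF assms(1)]
  by (cases s; cases s') (simp add: transition_rate_split)

lemma has_sum_supported_on_image:
  fixes f :: "'b \<Rightarrow> 'a::{comm_monoid_add,topological_space}"
  assumes "((\<lambda>a. f (h a)) has_sum S) A" "inj_on h A" "\<And>b. b \<notin> h ` A \<Longrightarrow> f b = 0"
  shows "(f has_sum S) UNIV"
proof -
  have "(f has_sum S) (h ` A)"
    using assms(1) by (subst has_sum_reindex[OF assms(2)]) (simp add: o_def)
  then show ?thesis
    by (subst has_sum_cong_neutral[where T="h ` A" and g=f]) (use assms(3) in auto)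
qed

text \<open>The sum of \<open>g\<close> over the transitions from a state, weighted with their rates, in closed form:
  jumps that decrease neither queue, services of the first and services of the second queue.\<close>

definition rate_sum :: "'n::finite model \<Rightarrow> real \<Rightarrow> (nat \<times> nat \<times> 'n option \<Rightarrow> 'a::{real_normed_field,banach}) \<Rightarrow>
    nat \<times> nat \<times> 'n option \<Rightarrow> 'a" where
  "rate_sum P w g = (\<lambda>(x1, x2, k).
     (\<Sum>k'\<in>UNIV. \<Sum>\<^sub>\<infinity>d. of_real (jump_rate P k k' d) * g (x1 + fst d, x2 + snd d, k')) +
     (if k = None \<and> x1 \<ge> 1 then of_real (if x2 \<ge> 1 then w else 1) *
        (\<Sum>\<^sub>\<infinity>j. of_real (qone P j) * g (x1 - 1, x2 + j, None)) else 0) +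
     (if k = None \<and> x2 \<ge> 1 then of_real (if x1 \<ge> 1 then 1 - w else 1) *
        (\<Sum>\<^sub>\<infinity>i. of_real (qtwo P i) * g (x1 + i, x2 - 1, None)) else 0))"

lemma has_sum_transition_rate:
  fixes P :: "'n::finite model" and g :: "nat \<times> nat \<times> 'n option \<Rightarrow> 'a::{real_normed_field,banach}"
  assumes P: "valid_model P" and g: "\<And>s. norm (g s) \<le> B"
  shows "((\<lambda>s'. of_real (transition_rate P w s s') * g s') has_sum rate_sum P w g s) UNIV"
proof -
  obtain x1 x2 k where s: "s = (x1, x2, k)" by (cases s) auto
  define up where "up k'' = (\<lambda>(x1', x2', k'). of_real (if k' = k'' \<and> x1 \<le> x1' \<and> x2 \<le> x2'
      then jump_rate P k k' (x1' - x1, x2' - x2) else 0) * g (x1', x2', k'))" for k''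
  define left where "left = (\<lambda>(x1', x2', k'). of_real (if k = None \<and> k' = None \<and> x1' + 1 = x1 \<and> x2 \<le> x2'
      then (if x2 \<ge> 1 then w else 1) * qone P (x2' - x2) else 0) * g (x1', x2', k'))"
  define down where "down = (\<lambda>(x1', x2', k'). of_real (if k = None \<and> k' = None \<and> x1 \<le> x1' \<and> x2' + 1 = x2
      then (if x1 \<ge> 1 then 1 - w else 1) * qtwo P (x1' - x1) else 0) * g (x1', x2', k'))"
  have up: "(up k'' has_sum (\<Sum>\<^sub>\<infinity>d. of_real (jump_rate P k k'' d) * g (x1 + fst d, x2 + snd d, k''))) UNIV" for k''
  proof (rule has_sum_supported_on_image[where h="\<lambda>d. (x1 + fst d, x2 + snd d, k'')" and A=UNIV])
    show "((\<lambda>d. up k'' (x1 + fst d, x2 + snd d, k'')) has_sum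
        (\<Sum>\<^sub>\<infinity>d. of_real (jump_rate P k k'' d) * g (x1 + fst d, x2 + snd d, k''))) UNIV"
      using has_sum_infsum[OF weighted_summable[OF jump_rate_summable[OF P, of k k''] jump_rate_nonneg[OF P]],
          of "\<lambda>d. g (x1 + fst d, x2 + snd d, k'')" B] g by (simp add: up_def)
    show "up k'' b = 0" if "b \<notin> range (\<lambda>d. (x1 + fst d, x2 + snd d, k''))" for b
    proof (rule ccontr)
      assume "up k'' b \<noteq> 0"
      then have "b = (x1 + fst (fst b - x1, fst (snd b) - x2), x2 + snd (fst b - x1, fst (snd b) - x2), k'')"
        by (auto simp: up_def split: prod.splits if_splits)
      with that show False by blast
    qed
  qed (auto simp: inj_on_def)
  have left: "(left has_sum (if k = None \<and> x1 \<ge> 1 then of_real (if x2 \<ge> 1 then w else 1) *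
        (\<Sum>\<^sub>\<infinity>j. of_real (qone P j) * g (x1 - 1, x2 + j, None)) else 0)) UNIV"
  proof (cases "k = None \<and> x1 \<ge> 1")
    case True
    have "(left has_sum of_real (if x2 \<ge> 1 then w else 1) *
        (\<Sum>\<^sub>\<infinity>j. of_real (qone P j) * g (x1 - 1, x2 + j, None))) UNIV"
    proof (rule has_sum_supported_on_image[where h="\<lambda>j. (x1 - 1, x2 + j, None)" and A=UNIV])
      show "((\<lambda>j. left (x1 - 1, x2 + j, None)) has_sum of_real (if x2 \<ge> 1 then w else 1) *
        (\<Sum>\<^sub>\<infinity>j. of_real (qone P j) * g (x1 - 1, x2 + j, None))) UNIV"
        using has_sum_cmult_right[OF has_sum_infsum[OF weighted_summable[OF qone_summable_on[OF P] qone_nonneg[OF P]],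
          of "\<lambda>j. g (x1 - 1, x2 + j, None)" B]] g True by (simp add: left_def mult.assoc)
      show "left b = 0" if "b \<notin> range (\<lambda>j. (x1 - 1, x2 + j, None))" for b
      proof (rule ccontr)
        assume "left b \<noteq> 0"
        then have "b = (x1 - 1, x2 + (fst (snd b) - x2), None)"
          by (auto simp: left_def split: prod.splits if_splits)
        with that show False by blast
      qed
    qed (auto simp: inj_on_def)
    with True show ?thesis by simp
  next
    case False
    then have "left = (\<lambda>_. 0)" by (auto simp: left_def fun_eq_iff)
    with False show ?thesis by auto
  qed
  have down: "(down has_sum (if k = None \<and> x2 \<ge> 1 then of_real (if x1 \<ge> 1 then 1 - w else 1) *
        (\<Sum>\<^sub>\<infinity>i. of_real (qtwo P i) * g (x1 + i, x2 - 1, None)) else 0)) UNIV"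
  proof (cases "k = None \<and> x2 \<ge> 1")
    case True
    have "(down has_sum of_real (if x1 \<ge> 1 then 1 - w else 1) *
        (\<Sum>\<^sub>\<infinity>i. of_real (qtwo P i) * g (x1 + i, x2 - 1, None))) UNIV"
    proof (rule has_sum_supported_on_image[where h="\<lambda>i. (x1 + i, x2 - 1, None)" and A=UNIV])
      show "((\<lambda>i. down (x1 + i, x2 - 1, None)) has_sum of_real (if x1 \<ge> 1 then 1 - w else 1) *
        (\<Sum>\<^sub>\<infinity>i. of_real (qtwo P i) * g (x1 + i, x2 - 1, None))) UNIV"
        using has_sum_cmult_right[OF has_sum_infsum[OF weighted_summable[OF qtwo_summable_on[OF P] qtwo_nonneg[OF P]],
          of "\<lambda>i. g (x1 + i, x2 - 1, None)" B]] g True by (simp add: down_def mult.assoc)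
      show "down b = 0" if "b \<notin> range (\<lambda>i. (x1 + i, x2 - 1, None))" for b
      proof (rule ccontr)
        assume "down b \<noteq> 0"
        then have "b = (x1 + (fst b - x1), x2 - 1, None)"
          by (auto simp: down_def split: prod.splits if_splits)
        with that show False by blast
      qed
    qed (auto simp: inj_on_def)
    with True show ?thesis by simp
  next
    case False
    then have "down = (\<lambda>_. 0)" by (auto simp: down_def fun_eq_iff)
    with False show ?thesis by auto
  qed
  have ups: "((\<lambda>s'. \<Sum>k''\<in>UNIV. up k'' s') has_sum
      (\<Sum>k''\<in>UNIV. \<Sum>\<^sub>\<infinity>d. of_real (jump_rate P k k'' d) * g (x1 + fst d, x2 + snd d, k''))) UNIV"
    unfolding has_sum_def
  proof -
    have "((\<lambda>F. \<Sum>k''\<in>UNIV. sum (up k'') F) \<longlongrightarrow>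
      (\<Sum>k''\<in>UNIV. \<Sum>\<^sub>\<infinity>d. of_real (jump_rate P k k'' d) * g (x1 + fst d, x2 + snd d, k'')))
      (finite_subsets_at_top UNIV)"
      using up by (intro tendsto_sum) (auto simp: has_sum_def)
    moreover have "sum (\<lambda>s'. \<Sum>k''\<in>UNIV. up k'' s') = (\<lambda>F. \<Sum>k''\<in>UNIV. sum (up k'') F)"
      by (rule ext, rule sum.swap)
    ultimately show "(sum (\<lambda>s'. \<Sum>k''\<in>UNIV. up k'' s') \<longlongrightarrow>
      (\<Sum>k''\<in>UNIV. \<Sum>\<^sub>\<infinity>d. of_real (jump_rate P k k'' d) * g (x1 + fst d, x2 + snd d, k'')))
      (finite_subsets_at_top UNIV)"
      by simp
  qed
  have "of_real (transition_rate P w s s') * g s' = (\<Sum>k''\<in>UNIV. up k'' s') + left s' + down s'" for s'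
  proof -
    obtain x1' x2' k' where s': "s' = (x1', x2', k')" by (cases s') auto
    have "(\<Sum>k''\<in>UNIV. up k'' s') = (\<Sum>k''\<in>UNIV. if k'' = k' then up k' s' else 0)"
      by (intro sum.cong) (auto simp: up_def s')
    also have "\<dots> = up k' s'" by simp
    finally show ?thesis
      by (simp add: s s' transition_rate_split up_def left_def down_def distrib_right)
  qed
  then show ?thesis
    using has_sum_add[OF has_sum_add[OF ups left] down] by (simp add: s rate_sum_def)
qed

lemma transition_rate_bounded:
  fixes P :: "'n::finite model"
  assumes P: "valid_model P" and w: "0 < w" "w < 1"
  shows "transition_rate P w s summable_on UNIV"
    and "(\<Sum>\<^sub>\<infinity>s'\<in>-{s}. transition_rate P w s s') \<le>
      (\<Sum>k\<in>UNIV. \<Sum>k'\<in>UNIV. \<Sum>\<^sub>\<infinity>d. jump_rate P k k' d) + (\<Sum>\<^sub>\<infinity>j. qone P j) + (\<Sum>\<^sub>\<infinity>i. qtwo P i)" (is "_ \<le> ?B")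
proof -
  obtain x1 x2 k where s: "s = (x1, x2, k)" by (cases s) auto
  have hs: "(transition_rate P w s has_sum rate_sum P w (\<lambda>_. 1::real) s) UNIV"
    using has_sum_transition_rate[OF P, of "\<lambda>_. 1::real" 1 w s] by simp
  then show summ: "transition_rate P w s summable_on UNIV" by (auto simp: summable_on_def)
  have "(\<Sum>\<^sub>\<infinity>s'\<in>-{s}. transition_rate P w s s') \<le> rate_sum P w (\<lambda>_. 1::real) s"
    by (rule has_sum_mono2[OF has_sum_infsum hs])
       (auto intro!: transition_rate_nonneg assms summable_on_subset_banach[OF summ])
  also have "\<dots> \<le> ?B"
  proof -
    have a: "(\<Sum>k'\<in>UNIV. \<Sum>\<^sub>\<infinity>d. jump_rate P k k' d) \<le> (\<Sum>k\<in>UNIV. \<Sum>k'\<in>UNIV. \<Sum>\<^sub>\<infinity>d. jump_rate P k k' d)"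
      by (rule member_le_sum) (auto intro!: sum_nonneg infsum_nonneg jump_rate_nonneg P)
    have b: "0 \<le> (\<Sum>\<^sub>\<infinity>j. qone P j)" "0 \<le> (\<Sum>\<^sub>\<infinity>i. qtwo P i)"
      by (auto intro!: infsum_nonneg qone_nonneg qtwo_nonneg P)
    have c: "c * t \<le> t" if "c \<le> 1" "0 \<le> t" for c t :: real
      using mult_right_mono[OF that] by simp
    show ?thesis
      using a b w c[of w "\<Sum>\<^sub>\<infinity>j. qone P j"] c[of "1-w" "\<Sum>\<^sub>\<infinity>j. qtwo P j"] by (auto simp: s rate_sum_def)
  qed
  finally show "(\<Sum>\<^sub>\<infinity>s'\<in>-{s}. transition_rate P w s s') \<le> ?B" .
qed

section \<open>Generating functions of the jump rates\<close>

definition jump_gf :: "'n model \<Rightarrow> 'n option \<Rightarrow> 'n option \<Rightarrow> 'a::{real_normed_field,banach} \<Rightarrow> 'a \<Rightarrow> 'a" where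
  "jump_gf P k k' x y = (\<Sum>\<^sub>\<infinity>d. of_real (jump_rate P k k' d) * (x ^ fst d * y ^ snd d))"

text \<open>The total rate includes fictitious jumps by \<open>(0, 0)\<close> within phase \<open>k\<close>, which cancel in
  \<open>D_fun\<close>.\<close>

definition out_rate :: "'n::finite model \<Rightarrow> 'n option \<Rightarrow> real" where
  "out_rate P k = (\<Sum>k'\<in>UNIV. \<Sum>\<^sub>\<infinity>d. jump_rate P k k' d)"

lemma norm_monomial_le:
  fixes x y :: "'a::real_normed_div_algebra"
  assumes "norm x \<le> 1" "norm y \<le> 1"
  shows "norm (x ^ i * y ^ j) \<le> 1"
  using assms by (simp add: norm_mult norm_power mult_le_one power_le_one)

lemma has_sum_jump_gf:
  assumes "valid_model P" "norm x \<le> 1" "norm y \<le> 1"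
  shows "((\<lambda>d. of_real (jump_rate P k k' d) * (x ^ fst d * y ^ snd d)) has_sum jump_gf P k k' x y) UNIV"
  unfolding jump_gf_def
  by (intro has_sum_infsum weighted_summable[where B=1] jump_rate_summable jump_rate_nonneg
      norm_monomial_le assms)

lemma A_gf_eq_jump_gf:
  assumes "k \<noteq> k'"
  shows "of_real (theta P k k') * A_gf P k k' x y = jump_gf P k k' x y"
  using assms by (simp add: A_gf_def jump_gf_def jump_rate_def case_prod_unfold mult.assoc
      flip: infsum_cmult_right')

lemma out_rate_eq:
  "out_rate P k = theta_out P k + (\<Sum>\<^sub>\<infinity>d. qrate P k (fst d) (snd d))"
proof -
  have "(\<Sum>\<^sub>\<infinity>d. jump_rate P k k' d) = theta P k k'" if "k' \<noteq> k" for k'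
    using that infsumI[OF has_sum_pmf[of "batch P k k'"]]
    by (simp add: jump_rate_def case_prod_unfold infsum_cmult_right')
  then show ?thesis
    by (simp add: out_rate_def theta_out_def sum.remove[of UNIV k] jump_rate_def case_prod_unfold)
qed

lemma D_fun_eq:
  assumes P: "valid_model P" and "norm x \<le> 1" "norm y \<le> 1"
  shows "D_fun P k x y = of_real (out_rate P k) - jump_gf P k k x y"
proof -
  define q where "q = (\<lambda>d. qrate P k (fst d) (snd d))"
  have qj: "q = jump_rate P k k" by (auto simp: q_def jump_rate_def fun_eq_iff)
  have "((\<lambda>d. of_real (q d) + - (of_real (q d) * (x ^ fst d * y ^ snd d))) has_sum
      of_real (\<Sum>\<^sub>\<infinity>d. q d) + - jump_gf P k k x y) UNIV"
    unfolding qj by (intro has_sum_add has_sum_uminusI has_sum_of_real has_sum_infsum has_sum_jump_gf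
        jump_rate_summable assms)
  then have "(\<Sum>\<^sub>\<infinity>d. of_real (q d) * (1 - x ^ fst d * y ^ snd d)) = of_real (\<Sum>\<^sub>\<infinity>d. q d) - jump_gf P k k x y"
    by (intro infsumI) (simp add: algebra_simps)
  moreover have "(\<Sum>\<^sub>\<infinity>d\<in>UNIV - {(0, 0)}. of_real (q d) * (1 - x ^ fst d * y ^ snd d)) =
      (\<Sum>\<^sub>\<infinity>d. of_real (q d) * (1 - x ^ fst d * y ^ snd d))"
    by (rule infsum_cong_neutral) auto
  ultimately show ?thesis
    by (simp add: D_fun_def out_rate_eq q_def case_prod_unfold)
qed

lemma L_mat_eq:
  assumes "valid_model P" "norm x \<le> 1" "norm y \<le> 1"
  shows "L_mat P x y $ k $ m =
    (if k = m then of_real (out_rate P (Some k)) else 0) - jump_gf P (Some k) (Some m) x y"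
  using assms by (auto simp: L_mat_def D_fun_eq simp flip: A_gf_eq_jump_gf)

lemma E_vec_eq: "E_vec P x y $ k = jump_gf P None (Some k) x y"
  by (simp add: E_vec_def A_gf_eq_jump_gf)

lemma T_denom_eq: "T_denom P x y = (\<Sum>k\<in>UNIV. jump_gf P (Some k) None x y * F_fun P k x y)"
  by (simp add: T_denom_def A_gf_eq_jump_gf)

lemma norm_jump_gf_le:
  assumes "valid_model P" "norm x \<le> 1" "norm y \<le> r" "r \<le> 1"
  shows "norm (jump_gf P k k' x y) \<le> jump_gf P k k' 1 r"
proof -
  have r: "0 \<le> r" using assms(3) norm_ge_zero[of y] by linarith
  have "norm (jump_gf P k k' x y) \<le> (\<Sum>\<^sub>\<infinity>d. jump_rate P k k' d * r ^ snd d)"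
    unfolding jump_gf_def
  proof (rule norm_weighted_infsum_le[OF jump_rate_summable jump_rate_nonneg])
    show "norm (x ^ fst d * y ^ snd d) \<le> r ^ snd d" for d :: "nat \<times> nat"
      using mult_mono[of "norm x ^ fst d" 1 "norm y ^ snd d" "r ^ snd d"] assms r
      by (simp add: norm_mult norm_power power_le_one power_mono)
    show "r ^ snd d \<le> 1" for d :: "nat \<times> nat"
      using r assms by (simp add: power_le_one)
  qed (use assms in auto)
  then show ?thesis by (simp add: jump_gf_def)
qed

lemma jump_gf_real_nonneg:
  assumes "valid_model P" "0 \<le> x" "0 \<le> (y::real)"
  shows "0 \<le> jump_gf P k k' x y"
  unfolding jump_gf_def using assms by (auto intro!: infsum_nonneg mult_nonneg_nonneg jump_rate_nonneg)

lemma sum_jump_gf_one: "(\<Sum>k'\<in>UNIV. jump_gf P k k' (1::real) 1) = out_rate P k"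
  by (simp add: jump_gf_def out_rate_def)

lemma inner_rate_less_out_rate:
  assumes "valid_model P"
  shows "(\<Sum>m\<in>UNIV. jump_gf P (Some k) (Some m) (1::real) 1) < out_rate P (Some k)"
proof -
  have "jump_gf P (Some k) None (1::real) 1 = theta P (Some k) None"
    using infsumI[OF has_sum_pmf[of "batch P (Some k) None"]]
    by (simp add: A_gf_def case_prod_unfold flip: A_gf_eq_jump_gf)
  also have "\<dots> > 0" using assms by (simp add: valid_model_def)
  finally show ?thesis
    by (simp flip: sum_jump_gf_one add: UNIV_option_conv sum.reindex)
qed

lemma out_rate_pos:
  assumes "valid_model P"
  shows "0 < out_rate P (Some k)"
  using inner_rate_less_out_rate[OF assms, of k] sum_nonneg[of UNIV "\<lambda>m. jump_gf P (Some k) (Some m) (1::real) 1"]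
    jump_gf_real_nonneg[OF assms, of 1 1 "Some k"] by (meson order_le_less_trans zero_le_one)

lemma continuous_on_jump_gf:
  assumes "valid_model P"
  shows "continuous_on (cball 0 1 \<times> cball 0 1) (\<lambda>z::'a::{real_normed_field,banach} \<times> 'a. jump_gf P k k' (fst z) (snd z))"
  unfolding jump_gf_def using assms
  by (intro continuous_on_weighted_infsum[where B=1] jump_rate_summable jump_rate_nonneg norm_monomial_le
      continuous_intros) (auto simp: dist_norm)


section \<open>The phases other than phase 0\<close>

text \<open>A system of inequalities with nonnegative coefficients and dominant diagonal has only
  nonpositive solutions.  It yields the regularity of \<open>L_mat\<close> as well as the comparison of its
  inverse at complex points with that at real points.\<close>

lemma weighted_maximum_principle:
  fixes v :: "'n::finite \<Rightarrow> real"
  assumes B: "\<And>k m. 0 \<le> B k m" "\<And>k. (\<Sum>m\<in>UNIV. B k m) < d k"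
    and v: "\<And>k. d k * v k \<le> (\<Sum>m\<in>UNIV. B k m * v m)"
  shows "v k \<le> 0"
proof -
  have "finite (range v)" "range v \<noteq> {}" by auto
  from Max_in[OF this] obtain k0 where "Max (range v) = v k0" by (rule rangeE)
  then have max: "v m \<le> v k0" for m using Max_ge[of "range v" "v m"] by simp
  have "v k0 \<le> 0"
  proof (rule ccontr)
    assume "\<not> v k0 \<le> 0"
    then have pos: "v k0 > 0" by simp
    have "d k0 * v k0 \<le> (\<Sum>m\<in>UNIV. B k0 m * v k0)"
      by (rule order_trans[OF v]) (intro sum_mono mult_left_mono max B)
    also have "\<dots> = (\<Sum>m\<in>UNIV. B k0 m) * v k0" by (simp add: sum_distrib_right)
    also have "\<dots> < d k0 * v k0" using B(2) pos by (rule mult_strict_right_mono)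
    finally show False by simp
  qed
  with max show ?thesis by (rule order_trans)
qed

lemma L_mat_mult_eq_iff:
  assumes "valid_model P" "norm x \<le> 1" "norm y \<le> 1"
  shows "L_mat P x y *v u = c \<longleftrightarrow>
    (\<forall>k. of_real (out_rate P (Some k)) * u $ k = (\<Sum>m\<in>UNIV. jump_gf P (Some k) (Some m) x y * u $ m) + c $ k)"
proof -
  have "(L_mat P x y *v u) $ k = of_real (out_rate P (Some k)) * u $ k -
      (\<Sum>m\<in>UNIV. jump_gf P (Some k) (Some m) x y * u $ m)" for k
  proof -
    have "(L_mat P x y *v u) $ k = (\<Sum>m\<in>UNIV. (if k = m then of_real (out_rate P (Some k)) * u $ m else 0)
        - jump_gf P (Some k) (Some m) x y * u $ m)"
      unfolding matrix_vector_mult_def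
      by (auto simp: L_mat_eq[OF assms] algebra_simps intro!: sum.cong)
    then show ?thesis by (simp add: sum_subtractf)
  qed
  then show ?thesis by (auto simp: vec_eq_iff algebra_simps)
qed

text \<open>The diagonal dominates since phase \<open>0\<close> is entered from every other phase at a positive rate.\<close>

lemma det_L_mat_nonzero:
  fixes x y :: "'a::{real_normed_field,banach}"
  assumes P: "valid_model P" and xy: "norm x \<le> 1" "norm y \<le> 1"
  shows "det (L_mat P x y) \<noteq> 0"
proof -
  have "u = 0" if "L_mat P x y *v u = 0" for u
  proof -
    have eq: "of_real (out_rate P (Some k)) * u $ k = (\<Sum>m\<in>UNIV. jump_gf P (Some k) (Some m) x y * u $ m)" for k
      using that L_mat_mult_eq_iff[OF P xy, of u 0] by simp
    have "norm (u $ k) \<le> 0" for k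
    proof (rule weighted_maximum_principle[where d="\<lambda>k. out_rate P (Some k)"
          and B="\<lambda>k m. jump_gf P (Some k) (Some m) 1 1"])
      fix k
      have "out_rate P (Some k) * norm (u $ k) = norm (\<Sum>m\<in>UNIV. jump_gf P (Some k) (Some m) x y * u $ m)"
        using out_rate_pos[OF P, of k] by (simp flip: eq add: norm_mult)
      also have "\<dots> \<le> (\<Sum>m\<in>UNIV. jump_gf P (Some k) (Some m) 1 1 * norm (u $ m))"
        by (rule sum_norm_le) (auto simp: norm_mult intro!: mult_right_mono norm_jump_gf_le P xy)
      finally show "out_rate P (Some k) * norm (u $ k) \<le> (\<Sum>m\<in>UNIV. jump_gf P (Some k) (Some m) 1 1 * norm (u $ m))" .
    qed (use inner_rate_less_out_rate[OF P] jump_gf_real_nonneg[OF P] in auto)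
    then show "u = 0" by (simp add: vec_eq_iff)
  qed
  then have "\<exists>B. B ** L_mat P x y = mat 1"
    using matrix_left_invertible_ker[of "L_mat P x y"] by blast
  then show ?thesis
    using invertible_left_inverse invertible_det_nz by blast
qed

lemma matrix_inv_inverse:
  assumes "invertible A"
  shows "A ** matrix_inv A = mat 1" "matrix_inv A ** A = mat 1"
  using assms someI_ex[of "\<lambda>A'. A ** A' = mat 1 \<and> A' ** A = mat 1"]
  unfolding invertible_def matrix_inv_def by auto

lemma transpose_L_mat_F_fun:
  assumes P: "valid_model P" and xy: "norm x \<le> 1" "norm y \<le> 1"
  shows "transpose (L_mat P x y) *v u = c *s E_vec P x y \<longleftrightarrow> (\<forall>k. u $ k = c * F_fun P k x y)"
proof -
  let ?L = "transpose (L_mat P x y)"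
  have inv: "invertible ?L"
    using det_L_mat_nonzero[OF assms] by (simp add: invertible_det_nz det_transpose)
  have "?L *v u = c *s E_vec P x y \<longleftrightarrow> u = matrix_inv ?L *v (c *s E_vec P x y)"
    using inv by (metis matrix_inv_inverse matrix_vector_mul_assoc matrix_vector_mul_lid)
  also have "\<dots> \<longleftrightarrow> (\<forall>k. u $ k = c * F_fun P k x y)"
    by (auto simp: vec_eq_iff F_fun_def matrix_vector_mult_scaleR vector_scalar_commute)
  finally show ?thesis .
qed

text \<open>\<open>return_gf P x y $ k\<close> is the generating function of the numbers of customers that arrive until
  phase \<open>0\<close> is entered, starting from phase \<open>k\<close>.\<close>

definition return_gf :: "'n::finite model \<Rightarrow> 'a::{real_normed_field,banach} \<Rightarrow> 'a \<Rightarrow> 'a ^ 'n" where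
  "return_gf P x y = matrix_inv (L_mat P x y) *v (\<chi> k. jump_gf P (Some k) None x y)"

lemma return_gf_eq:
  assumes P: "valid_model P" and xy: "norm x \<le> 1" "norm y \<le> 1"
  shows "L_mat P x y *v u = (\<chi> k. jump_gf P (Some k) None x y) \<longleftrightarrow> u = return_gf P x y"
proof -
  have "invertible (L_mat P x y)"
    using det_L_mat_nonzero[OF assms] by (simp add: invertible_det_nz)
  then show ?thesis unfolding return_gf_def
    by (metis matrix_inv_inverse matrix_vector_mul_assoc matrix_vector_mul_lid)
qed

text \<open>This expresses \<open>T_denom\<close> by a system of equations in which all coefficients of the power
  series are nonnegative; it is the generating function of the arrivals during an excursion from
  phase \<open>0\<close>, weighted with the rate of such excursions.\<close>

lemma T_denom_return_gf:
  assumes P: "valid_model P" and xy: "norm x \<le> 1" "norm y \<le> 1"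
  shows "T_denom P x y = (\<Sum>k\<in>UNIV. jump_gf P None (Some k) x y * return_gf P x y $ k)"
proof -
  let ?L = "L_mat P x y" and ?u = "return_gf P x y"
  define F where "F = (\<chi> k. F_fun P k x y)"
  have F: "transpose ?L *v F = E_vec P x y"
    using transpose_L_mat_F_fun[OF assms, of F 1] by (simp add: F_def)
  have u: "(?L *v ?u) $ k = jump_gf P (Some k) None x y" for k
    using return_gf_eq[OF assms, of ?u] by simp
  have "T_denom P x y = (\<Sum>k\<in>UNIV. (\<Sum>m\<in>UNIV. ?L $ k $ m * ?u $ m) * F $ k)"
    by (simp add: T_denom_eq F_def flip: u) (simp add: matrix_vector_mult_def)
  also have "\<dots> = (\<Sum>m\<in>UNIV. (\<Sum>k\<in>UNIV. ?L $ k $ m * F $ k) * ?u $ m)"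
    unfolding sum_distrib_right by (subst sum.swap) (simp add: algebra_simps)
  also have "\<dots> = (\<Sum>m\<in>UNIV. E_vec P x y $ m * ?u $ m)"
    by (simp flip: F add: matrix_vector_mult_def transpose_def)
  finally show ?thesis by (simp add: E_vec_eq)
qed

section \<open>The equations for the stationary generating functions\<close>

text \<open>Multiplied by \<open>- x\<^sup>i y\<^sup>j / (x y)\<close>, this is the rate of change of the monomial \<open>x\<^sup>i y\<^sup>j\<close> through
  services of the first queue; \<open>service2\<close> does the same for the second queue.\<close>

definition service1 :: "'n model \<Rightarrow> 'a::{real_normed_field,banach} \<Rightarrow> 'a \<Rightarrow> 'a" where
  "service1 P x y = y * (\<Sum>\<^sub>\<infinity>j. of_real (qone P j) * (x - y ^ j))"

definition service2 :: "'n model \<Rightarrow> 'a::{real_normed_field,banach} \<Rightarrow> 'a \<Rightarrow> 'a" where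
  "service2 P x y = x * (\<Sum>\<^sub>\<infinity>i. of_real (qtwo P i) * (y - x ^ i))"

text \<open>The part of \<open>\<Pi>\<^sub>0\<close> that belongs to states with two nonempty queues.\<close>

definition both_busy :: "(nat \<times> nat \<times> 'n option \<Rightarrow> real) \<Rightarrow> 'a::{real_normed_field,banach} \<Rightarrow> 'a \<Rightarrow> 'a" where
  "both_busy p x y = Pi_gf p None x y - Pi_gf p None x 0 - Pi_gf p None 0 y + Pi_gf p None 0 0"

locale stationary =
  fixes P :: "'n::finite model" and w :: real and p :: "nat \<times> nat \<times> 'n option \<Rightarrow> real"
  assumes P: "valid_model P" and w: "0 < w" "w < 1"
    and p_nonneg: "0 \<le> p s" and p_total: "(p has_sum 1) UNIV"
    and balance: "p z * (\<Sum>\<^sub>\<infinity>s\<in>-{z}. transition_rate P w z s) = (\<Sum>\<^sub>\<infinity>s\<in>-{z}. p s * transition_rate P w s z)"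
begin

lemma phase_summable: "(\<lambda>d. p (fst d, snd d, k)) summable_on UNIV"
proof -
  have "p summable_on range (\<lambda>d. (fst d, snd d, k))"
    using p_total summable_on_subset_banach[of p UNIV] by (auto simp: summable_on_def)
  then show ?thesis by (subst (asm) summable_on_reindex) (auto simp: inj_on_def o_def)
qed

lemma has_sum_phases:
  fixes g :: "nat \<times> nat \<times> 'n option \<Rightarrow> 'a::{real_normed_field,banach}"
  assumes g: "\<And>s. norm (g s) \<le> B"
  shows "((\<lambda>s. of_real (p s) * g s) has_sum
    (\<Sum>k\<in>UNIV. \<Sum>\<^sub>\<infinity>d. of_real (p (fst d, snd d, k)) * g (fst d, snd d, k))) UNIV"
proof -
  have p: "p summable_on UNIV" using p_total by (auto simp: summable_on_def)
  have bij: "bij_betw (\<lambda>(k, d). (fst d, snd d, k)) (UNIV \<times> UNIV) UNIV"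
    by (rule bij_betwI[of _ _ _ "\<lambda>(i, j, k). (k, (i, j))"]) auto
  have hs: "((\<lambda>s. of_real (p s) * g s) has_sum (\<Sum>\<^sub>\<infinity>s. of_real (p s) * g s)) UNIV"
    by (intro has_sum_infsum weighted_summable[OF p, where B=B] p_nonneg g)
  then have "((\<lambda>(k, d). of_real (p (fst d, snd d, k)) * g (fst d, snd d, k)) has_sum
      (\<Sum>\<^sub>\<infinity>s. of_real (p s) * g s)) (UNIV \<times> UNIV)"
    by (subst (asm) has_sum_reindex_bij_betw[OF bij, symmetric]) (simp add: case_prod_unfold)
  then have "((\<lambda>k. \<Sum>\<^sub>\<infinity>d. of_real (p (fst d, snd d, k)) * g (fst d, snd d, k)) has_sum
      (\<Sum>\<^sub>\<infinity>s. of_real (p s) * g s)) UNIV"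
    by (rule has_sum_SigmaD)
       (auto intro!: has_sum_infsum weighted_summable[OF phase_summable, where B=B] p_nonneg g)
  then have "(\<Sum>\<^sub>\<infinity>s. of_real (p s) * g s) =
      (\<Sum>k\<in>UNIV. \<Sum>\<^sub>\<infinity>d. of_real (p (fst d, snd d, k)) * g (fst d, snd d, k))"
    by (simp add: has_sum_finite_iff)
  with hs show ?thesis by simp
qed

lemma has_sum_Pi_gf:
  fixes x y :: "'a::{real_normed_field,banach}"
  assumes "norm x \<le> 1" "norm y \<le> 1"
  shows "((\<lambda>d. of_real (p (fst d, snd d, k)) * (x ^ fst d * y ^ snd d)) has_sum Pi_gf p k x y) UNIV"
proof -
  have "Pi_gf p k x y = (\<Sum>\<^sub>\<infinity>d. of_real (p (fst d, snd d, k)) * (x ^ fst d * y ^ snd d))"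
    by (simp add: Pi_gf_def case_prod_unfold mult.assoc)
  then show ?thesis
    by (auto intro!: has_sum_infsum weighted_summable[OF phase_summable, where B=1] p_nonneg norm_monomial_le assms)
qed

lemma continuous_on_Pi_gf:
  "continuous_on (cball 0 1 \<times> cball 0 1)
     (\<lambda>z::'a::{real_normed_field,banach} \<times> 'a. Pi_gf p k (fst z) (snd z))"
proof -
  have "continuous_on (cball 0 1 \<times> cball 0 1)
      (\<lambda>z::'a \<times> 'a. \<Sum>\<^sub>\<infinity>d. of_real (p (fst d, snd d, k)) * (fst z ^ fst d * snd z ^ snd d))"
    by (intro continuous_on_weighted_infsum[where B=1] phase_summable p_nonneg norm_monomial_le
      continuous_intros) (auto simp: dist_norm)
  then show ?thesis
    by (simp add: Pi_gf_def case_prod_unfold mult.assoc)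
qed

lemma norm_Pi_gf_le:
  fixes x y :: "'a::{real_normed_field,banach}"
  assumes "norm x \<le> 1" "norm y \<le> 1"
  shows "norm (Pi_gf p k x y) \<le> Pi_gf p k 1 (1::real)"
  using norm_infsum_le[OF has_sum_Pi_gf[OF assms, of k] has_sum_Pi_gf[of "1::real" 1 k]]
    norm_monomial_le[OF assms] p_nonneg by (simp add: norm_mult mult_left_le)

lemma Pi_gf_one: "(\<Sum>k\<in>UNIV. Pi_gf p k (1::real) 1) = 1"
proof -
  have "(p has_sum (\<Sum>k\<in>UNIV. \<Sum>\<^sub>\<infinity>d. p (fst d, snd d, k))) UNIV"
    using has_sum_phases[of "\<lambda>_. 1::real" 1] by simp
  from has_sum_unique[OF this p_total] show ?thesis
    using infsumI[OF has_sum_Pi_gf[of "1::real" 1]] by simp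
qed

text \<open>Rate of change of the monomial through service completions.\<close>

definition departure :: "'a::{real_normed_field,banach} \<Rightarrow> 'a \<Rightarrow> nat \<Rightarrow> nat \<Rightarrow> 'a" where
  "departure x y i j =
     (if i \<ge> 1 then of_real (if j \<ge> 1 then w else 1) *
        (\<Sum>\<^sub>\<infinity>l. of_real (qone P l) * (x ^ (i - 1) * y ^ (j + l) - x ^ i * y ^ j)) else 0) +
     (if j \<ge> 1 then of_real (if i \<ge> 1 then 1 - w else 1) *
        (\<Sum>\<^sub>\<infinity>l. of_real (qtwo P l) * (x ^ (i + l) * y ^ (j - 1) - x ^ i * y ^ j)) else 0)"

text \<open>The powers of \<open>0\<close> serve as indicators: \<open>0 ^ i\<close> is \<open>1\<close> if the first queue is empty and \<open>0\<close>
  otherwise.  Multiplication by \<open>x y\<close> keeps the identity valid on the axes.\<close>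

lemma departure_eq:
  fixes x y :: "'a::{real_normed_field,banach}"
  shows "x * y * departure x y i j =
    - service1 P x y * (of_real w * (x ^ i * y ^ j - x ^ i * 0 ^ j - 0 ^ i * y ^ j + 0 ^ i * 0 ^ j)
        + (x ^ i * 0 ^ j - 0 ^ i * 0 ^ j))
    - service2 P x y * (of_real (1 - w) * (x ^ i * y ^ j - x ^ i * 0 ^ j - 0 ^ i * y ^ j + 0 ^ i * 0 ^ j)
        + (0 ^ i * y ^ j - 0 ^ i * 0 ^ j))"
proof -
  have one: "x * y * (\<Sum>\<^sub>\<infinity>l. of_real (qone P l) * (x ^ (i - 1) * y ^ (j + l) - x ^ i * y ^ j)) =
      - service1 P x y * (x ^ i * y ^ j)" if i: "i \<ge> 1"
  proof -
    have "x * y * (of_real (qone P l) * (x ^ (i - 1) * y ^ (j + l) - x ^ i * y ^ j)) =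
        (- y * (x ^ i * y ^ j)) * (of_real (qone P l) * (x - y ^ l))" for l
      using i by (cases i) (auto simp: algebra_simps power_add)
    then have "x * y * (\<Sum>\<^sub>\<infinity>l. of_real (qone P l) * (x ^ (i - 1) * y ^ (j + l) - x ^ i * y ^ j)) =
      (- y * (x ^ i * y ^ j)) * (\<Sum>\<^sub>\<infinity>l. of_real (qone P l) * (x - y ^ l))"
      by (simp only: infsum_cmult_right'[symmetric])
    then show ?thesis by (simp add: service1_def)
  qed
  have two: "x * y * (\<Sum>\<^sub>\<infinity>l. of_real (qtwo P l) * (x ^ (i + l) * y ^ (j - 1) - x ^ i * y ^ j)) =
      - service2 P x y * (x ^ i * y ^ j)" if j: "j \<ge> 1"
  proof -
    have "x * y * (of_real (qtwo P l) * (x ^ (i + l) * y ^ (j - 1) - x ^ i * y ^ j)) =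
        (- x * (x ^ i * y ^ j)) * (of_real (qtwo P l) * (y - x ^ l))" for l
      using j by (cases j) (auto simp: algebra_simps power_add)
    then have "x * y * (\<Sum>\<^sub>\<infinity>l. of_real (qtwo P l) * (x ^ (i + l) * y ^ (j - 1) - x ^ i * y ^ j)) =
      (- x * (x ^ i * y ^ j)) * (\<Sum>\<^sub>\<infinity>l. of_real (qtwo P l) * (y - x ^ l))"
      by (simp only: infsum_cmult_right'[symmetric])
    then show ?thesis by (simp add: service2_def)
  qed
  consider "i \<ge> 1" "j \<ge> 1" | "i \<ge> 1" "j = 0" | "i = 0" "j \<ge> 1" | "i = 0" "j = 0" by linarith
  then show ?thesis
  proof cases
    case 1
    have eq: "x * y * departure x y i j = of_real w * (x * y * (\<Sum>\<^sub>\<infinity>l. of_real (qone P l) * (x ^ (i - 1) * y ^ (j + l) - x ^ i * y ^ j)))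
      + of_real (1 - w) * (x * y * (\<Sum>\<^sub>\<infinity>l. of_real (qtwo P l) * (x ^ (i + l) * y ^ (j - 1) - x ^ i * y ^ j)))"
      using 1 by (simp add: departure_def distrib_left mult.left_commute)
    have z: "(0::'a) ^ i = 0" "(0::'a) ^ j = 0" using 1 by auto
    show ?thesis unfolding eq one[OF 1(1)] two[OF 1(2)] z by algebra
  next
    case 2
    then have eq: "x * y * departure x y i j = x * y * (\<Sum>\<^sub>\<infinity>l. of_real (qone P l) * (x ^ (i - 1) * y ^ (j + l) - x ^ i * y ^ j))"
      by (simp add: departure_def)
    show ?thesis unfolding eq one[OF 2(1)] using 2 by (simp add: power_0_left)
  next
    case 3
    then have eq: "x * y * departure x y i j = x * y * (\<Sum>\<^sub>\<infinity>l. of_real (qtwo P l) * (x ^ (i + l) * y ^ (j - 1) - x ^ i * y ^ j))"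
      by (simp add: departure_def)
    show ?thesis unfolding eq two[OF 3(2)] using 3 by (simp add: power_0_left)
  next
    case 4
    then show ?thesis by (simp add: departure_def)
  qed
qed

lemma has_sum_departure:
  fixes x y :: "'a::{real_normed_field,banach}"
  assumes xy: "norm x \<le> 1" "norm y \<le> 1"
  shows "((\<lambda>d. of_real (p (fst d, snd d, None)) * (x * y * departure x y (fst d) (snd d))) has_sum
    - service1 P x y * (of_real w * both_busy p x y + (Pi_gf p None x 0 - Pi_gf p None 0 0))
    - service2 P x y * (of_real (1 - w) * both_busy p x y + (Pi_gf p None 0 y - Pi_gf p None 0 0))) UNIV"
proof -
  let ?f = "\<lambda>u v d. of_real (p (fst d, snd d, None)) * (u ^ fst d * v ^ snd d :: 'a)"
  let ?b = "\<lambda>d. ?f x y d + - ?f x 0 d + - ?f 0 y d + ?f 0 0 d"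
  have alg: "\<pi> * (- s1 * (W * (a - b - c + e) + (b - e)) - s2 * (W' * (a - b - c + e) + (c - e))) =
      - s1 * (W * (\<pi> * a + - (\<pi> * b) + - (\<pi> * c) + \<pi> * e) + (\<pi> * b + - (\<pi> * e))) +
      - s2 * (W' * (\<pi> * a + - (\<pi> * b) + - (\<pi> * c) + \<pi> * e) + (\<pi> * c + - (\<pi> * e)))"
    for \<pi> s1 s2 W W' a b c e :: 'a
    by algebra
  have b: "(?b has_sum Pi_gf p None x y + - Pi_gf p None x 0 + - Pi_gf p None 0 y + Pi_gf p None 0 0) UNIV"
    by (intro has_sum_add has_sum_uminusI has_sum_Pi_gf) (use xy in auto)
  have "((\<lambda>d. - service1 P x y * (of_real w * ?b d + (?f x 0 d + - ?f 0 0 d)) +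
      - service2 P x y * (of_real (1 - w) * ?b d + (?f 0 y d + - ?f 0 0 d))) has_sum
    - service1 P x y * (of_real w * (Pi_gf p None x y + - Pi_gf p None x 0 + - Pi_gf p None 0 y + Pi_gf p None 0 0)
       + (Pi_gf p None x 0 + - Pi_gf p None 0 0)) +
    - service2 P x y * (of_real (1 - w) * (Pi_gf p None x y + - Pi_gf p None x 0 + - Pi_gf p None 0 y + Pi_gf p None 0 0)
       + (Pi_gf p None 0 y + - Pi_gf p None 0 0))) UNIV"
    by (intro has_sum_add has_sum_cmult_right b has_sum_uminusI has_sum_Pi_gf) (use xy in auto)
  also have "(\<lambda>d. - service1 P x y * (of_real w * ?b d + (?f x 0 d + - ?f 0 0 d)) +
      - service2 P x y * (of_real (1 - w) * ?b d + (?f 0 y d + - ?f 0 0 d))) =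
      (\<lambda>d. of_real (p (fst d, snd d, None)) * (x * y * departure x y (fst d) (snd d)))"
    unfolding departure_eq alg by (rule refl)
  finally show ?thesis by (simp add: both_busy_def)
qed

lemma rate_sum_monomial:
  fixes x y :: "'a::{real_normed_field,banach}" and k k0 :: "'n option"
  assumes xy: "norm x \<le> 1" "norm y \<le> 1"
  defines "f \<equiv> \<lambda>(x1, x2, k). if k = k0 then x ^ x1 * y ^ x2 else 0"
  shows "rate_sum P w (\<lambda>s'. f s' - f (i, j, k)) (i, j, k) =
    jump_gf P k k0 x y * (x ^ i * y ^ j) - (if k = k0 then of_real (out_rate P k) * (x ^ i * y ^ j) else 0)
    + (if k = None \<and> k0 = None then departure x y i j else 0)"
proof -
  have jump: "(\<Sum>\<^sub>\<infinity>d. of_real (jump_rate P k k' d) * (f (i + fst d, j + snd d, k') - f (i, j, k))) =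
      (if k' = k0 then jump_gf P k k0 x y * (x ^ i * y ^ j) else 0) - of_real (\<Sum>\<^sub>\<infinity>d. jump_rate P k k' d) * f (i, j, k)"
    (is "?lhs = ?rhs") for k'
  proof -
    have e: "((\<lambda>d. if k' = k0 then of_real (jump_rate P k k' d) * (x ^ fst d * y ^ snd d) * (x ^ i * y ^ j) else 0)
        has_sum (if k' = k0 then jump_gf P k k' x y * (x ^ i * y ^ j) else 0)) UNIV"
      by (cases "k' = k0") (auto intro!: has_sum_cmult_left has_sum_jump_gf P xy)
    have "((\<lambda>d. (if k' = k0 then of_real (jump_rate P k k' d) * (x ^ fst d * y ^ snd d) * (x ^ i * y ^ j) else 0)
        + - (of_real (jump_rate P k k' d) * f (i, j, k))) has_sum
        (if k' = k0 then jump_gf P k k' x y * (x ^ i * y ^ j) else 0) +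
        - (of_real (\<Sum>\<^sub>\<infinity>d. jump_rate P k k' d) * f (i, j, k))) UNIV"
      by (intro has_sum_add e has_sum_uminusI has_sum_cmult_left has_sum_of_real has_sum_infsum
          jump_rate_summable P)
    also have "(\<lambda>d. (if k' = k0 then of_real (jump_rate P k k' d) * (x ^ fst d * y ^ snd d) * (x ^ i * y ^ j) else 0)
        + - (of_real (jump_rate P k k' d) * f (i, j, k))) =
        (\<lambda>d. of_real (jump_rate P k k' d) * (f (i + fst d, j + snd d, k') - f (i, j, k)))"
      by (auto simp: f_def algebra_simps power_add)
    finally have "?lhs = (if k' = k0 then jump_gf P k k' x y * (x ^ i * y ^ j) else 0) +
        - (of_real (\<Sum>\<^sub>\<infinity>d. jump_rate P k k' d) * f (i, j, k))"
      by (rule infsumI)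
    then show ?thesis by auto
  qed
  have "(\<Sum>k'\<in>UNIV. \<Sum>\<^sub>\<infinity>d. of_real (jump_rate P k k' d) * (f (i + fst d, j + snd d, k') - f (i, j, k))) =
      jump_gf P k k0 x y * (x ^ i * y ^ j) - of_real (out_rate P k) * f (i, j, k)"
    unfolding jump by (simp add: sum_subtractf out_rate_def sum_distrib_right)
  then show ?thesis
    by (auto simp: rate_sum_def departure_def f_def)
qed

text \<open>The balance equations tested against the monomial \<open>x\<^sup>i y\<^sup>j\<close> on phase \<open>k0\<close>.\<close>

lemma phase_equation:
  fixes x y :: "'a::{real_normed_field,banach}" and k0 :: "'n option"
  assumes xy: "norm x \<le> 1" "norm y \<le> 1"
  shows "x * y * ((\<Sum>k\<in>UNIV. jump_gf P k k0 x y * Pi_gf p k x y) - of_real (out_rate P k0) * Pi_gf p k0 x y) +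
    (if k0 = None then
      - service1 P x y * (of_real w * both_busy p x y + (Pi_gf p None x 0 - Pi_gf p None 0 0))
      - service2 P x y * (of_real (1 - w) * both_busy p x y + (Pi_gf p None 0 y - Pi_gf p None 0 0)) else 0) = 0"
    (is ?main)
    and "k0 \<noteq> None \<Longrightarrow> (\<Sum>k\<in>UNIV. jump_gf P k k0 x y * Pi_gf p k x y) = of_real (out_rate P k0) * Pi_gf p k0 x y"
proof -
  define f :: "nat \<times> nat \<times> 'n option \<Rightarrow> 'a"
    where "f = (\<lambda>(x1, x2, k). if k = k0 then x ^ x1 * y ^ x2 else 0)"
  have f: "norm (f s) \<le> 1" for s
    using norm_monomial_le[OF xy] by (auto simp: f_def split: prod.split)
  have f2: "norm (f s' - f s) \<le> 2" for s s'
    using norm_triangle_ineq4[of "f s'" "f s"] f[of s] f[of s'] by linarith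
  have gen: "(\<Sum>\<^sub>\<infinity>s'. of_real (transition_rate P w s s') * (f s' - f s)) = rate_sum P w (\<lambda>s'. f s' - f s) s" for s
    by (rule infsumI, rule has_sum_transition_rate[OF P f2])
  define B where "B = (\<Sum>k\<in>UNIV. \<Sum>k'\<in>UNIV. \<Sum>\<^sub>\<infinity>d. jump_rate P k k' d) + (\<Sum>\<^sub>\<infinity>j. qone P j) + (\<Sum>\<^sub>\<infinity>i. qtwo P i)"
  define L where "L s = rate_sum P w (\<lambda>s'. f s' - f s) s" for s
  have "(\<Sum>\<^sub>\<infinity>s. of_real (p s) * (\<Sum>\<^sub>\<infinity>s'. of_real (transition_rate P w s s') * (f s' - f s))) = 0"
  proof (rule balance_test_function[where B=B])
    show "p summable_on UNIV" using p_total by (auto simp: summable_on_def)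
  qed (unfold B_def, (rule transition_rate_nonneg transition_rate_bounded P w p_nonneg balance f)+)
  then have zero: "(\<Sum>\<^sub>\<infinity>s. of_real (p s) * L s) = 0"
    by (simp only: gen L_def)
  define c where "c k = jump_gf P k k0 x y - (if k = k0 then of_real (out_rate P k) else 0)" for k
  have L: "L (i, j, k) = c k * (x ^ i * y ^ j) + (if k = None \<and> k0 = None then departure x y i j else 0)" for i j k
    unfolding L_def f_def c_def rate_sum_monomial[OF xy] by (simp add: algebra_simps)
  have L_bounded: "\<exists>C. \<forall>s. norm (L s) \<le> C"
  proof (intro exI allI)
    fix s
    let ?rt = "transition_rate P w s"
    have "((\<lambda>s'. of_real (?rt s') * (f s' - f s)) has_sum L s) UNIV"
      unfolding L_def by (rule has_sum_transition_rate[OF P f2])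
    then have "((\<lambda>s'. of_real (?rt s') * (f s' - f s)) has_sum L s) (-{s})"
      by (subst has_sum_cong_neutral[where T=UNIV]) auto
    moreover have "((\<lambda>s'. ?rt s' * 2) has_sum (\<Sum>\<^sub>\<infinity>s'\<in>-{s}. ?rt s') * 2) (-{s})"
      by (intro has_sum_cmult_left has_sum_infsum summable_on_subset_banach[OF transition_rate_bounded(1)[OF P w]]) auto
    ultimately have "norm (L s) \<le> (\<Sum>\<^sub>\<infinity>s'\<in>-{s}. ?rt s') * 2"
    proof (rule norm_infsum_le)
      fix s'
      show "norm (of_real (?rt s') * (f s' - f s)) \<le> ?rt s' * 2"
        using mult_left_mono[OF f2[of s' s] transition_rate_nonneg[OF P w, of s s']]
          transition_rate_nonneg[OF P w, of s s'] by (simp add: norm_mult)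
    qed
    then show "norm (L s) \<le> B * 2"
      using transition_rate_bounded(2)[OF P w, of s] by (simp add: B_def)
  qed
  then obtain C where C: "\<And>s. norm (L s) \<le> C" by blast
  have phases: "(\<Sum>k\<in>UNIV. \<Sum>\<^sub>\<infinity>d. of_real (p (fst d, snd d, k)) * L (fst d, snd d, k)) = 0"
    using infsumI[OF has_sum_phases[OF C]] zero by simp
  have other: "(\<Sum>\<^sub>\<infinity>d. of_real (p (fst d, snd d, k)) * L (fst d, snd d, k)) = c k * Pi_gf p k x y"
    if "\<not> (k = None \<and> k0 = None)" for k
  proof -
    have "((\<lambda>d. c k * (of_real (p (fst d, snd d, k)) * (x ^ fst d * y ^ snd d))) has_sum c k * Pi_gf p k x y) UNIV"
      by (intro has_sum_cmult_right has_sum_Pi_gf xy)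
    moreover have "c k * (of_real (p (fst d, snd d, k)) * (x ^ fst d * y ^ snd d)) =
        of_real (p (fst d, snd d, k)) * L (fst d, snd d, k)" for d
      using that by (auto simp: L)
    ultimately show ?thesis by (intro infsumI) simp
  qed
  have csum: "(\<Sum>k\<in>UNIV. c k * Pi_gf p k x y) =
      (\<Sum>k\<in>UNIV. jump_gf P k k0 x y * Pi_gf p k x y) - of_real (out_rate P k0) * Pi_gf p k0 x y"
  proof -
    have "(\<Sum>k\<in>UNIV. c k * Pi_gf p k x y) = (\<Sum>k\<in>UNIV. jump_gf P k k0 x y * Pi_gf p k x y
        - (if k = k0 then of_real (out_rate P k) * Pi_gf p k x y else 0))"
      by (intro sum.cong) (auto simp: c_def algebra_simps)
    then show ?thesis by (simp add: sum_subtractf)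
  qed
  show some: "(\<Sum>k\<in>UNIV. jump_gf P k k0 x y * Pi_gf p k x y) = of_real (out_rate P k0) * Pi_gf p k0 x y"
    if "k0 \<noteq> None"
    using phases other csum that by simp
  show ?main
  proof (cases "k0 = None")
    case True
    let ?dep = "- service1 P x y * (of_real w * both_busy p x y + (Pi_gf p None x 0 - Pi_gf p None 0 0))
      - service2 P x y * (of_real (1 - w) * both_busy p x y + (Pi_gf p None 0 y - Pi_gf p None 0 0))"
    have none: "x * y * (\<Sum>\<^sub>\<infinity>d. of_real (p (fst d, snd d, None)) * L (fst d, snd d, None)) =
        x * y * (c None * Pi_gf p None x y) + ?dep"
    proof -
      have "((\<lambda>d. x * y * c None * (of_real (p (fst d, snd d, None)) * (x ^ fst d * y ^ snd d)) +
          of_real (p (fst d, snd d, None)) * (x * y * departure x y (fst d) (snd d))) has_sum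
          x * y * c None * Pi_gf p None x y + ?dep) UNIV"
        by (intro has_sum_add has_sum_cmult_right has_sum_Pi_gf has_sum_departure xy)
      moreover have "x * y * c None * (of_real (p (fst d, snd d, None)) * (x ^ fst d * y ^ snd d)) +
          of_real (p (fst d, snd d, None)) * (x * y * departure x y (fst d) (snd d)) =
          x * y * (of_real (p (fst d, snd d, None)) * L (fst d, snd d, None))" for d
        using True by (simp add: L algebra_simps)
      ultimately have "(\<Sum>\<^sub>\<infinity>d. x * y * (of_real (p (fst d, snd d, None)) * L (fst d, snd d, None))) =
          x * y * c None * Pi_gf p None x y + ?dep"
        by (intro infsumI) simp
      then show ?thesis by (simp add: infsum_cmult_right' mult.assoc)
    qed
    have "(\<Sum>k\<in>UNIV - {None}. \<Sum>\<^sub>\<infinity>d. of_real (p (fst d, snd d, k)) * L (fst d, snd d, k)) =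
        (\<Sum>k\<in>UNIV - {None}. c k * Pi_gf p k x y)"
      by (intro sum.cong other) auto
    then have "x * y * ((\<Sum>k\<in>UNIV. c k * Pi_gf p k x y)) + ?dep =
        x * y * (\<Sum>k\<in>UNIV. \<Sum>\<^sub>\<infinity>d. of_real (p (fst d, snd d, k)) * L (fst d, snd d, k))"
      using none by (simp add: sum.remove[of UNIV "None :: 'n option"] distrib_left)
    then show ?thesis unfolding phases csum using True by simp
  next
    case False
    show ?thesis by (simp only: some[OF False] False if_False) simp
  qed
qed

lemma Pi_gf_Some:
  fixes x y :: "'a::{real_normed_field,banach}"
  assumes xy: "norm x \<le> 1" "norm y \<le> 1"
  shows "Pi_gf p (Some k) x y = F_fun P k x y * Pi_gf p None x y"
proof -
  define u where "u = (\<chi> k. Pi_gf p (Some k) x y)"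
  have "(transpose (L_mat P x y) *v u) $ k = Pi_gf p None x y * E_vec P x y $ k" for k
  proof -
    have "(transpose (L_mat P x y) *v u) $ k = (\<Sum>m\<in>UNIV.
        (if m = k then of_real (out_rate P (Some k)) * u $ k else 0) - jump_gf P (Some m) (Some k) x y * u $ m)"
      unfolding matrix_vector_mult_def transpose_def
      by (auto simp: L_mat_eq[OF P xy] algebra_simps intro!: sum.cong)
    also have "\<dots> = of_real (out_rate P (Some k)) * u $ k - (\<Sum>m\<in>UNIV. jump_gf P (Some m) (Some k) x y * u $ m)"
      by (simp add: sum_subtractf)
    also have "\<dots> = jump_gf P None (Some k) x y * Pi_gf p None x y"
      using phase_equation(2)[OF xy, of "Some k"]
      by (simp add: UNIV_option_conv sum.reindex u_def algebra_simps)
    finally show ?thesis by (simp add: E_vec_eq)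
  qed
  then have "transpose (L_mat P x y) *v u = Pi_gf p None x y *s E_vec P x y"
    by (simp add: vec_eq_iff)
  then have "u $ k = Pi_gf p None x y * F_fun P k x y"
    using transpose_L_mat_F_fun[OF P xy] by blast
  then show ?thesis by (simp add: u_def)
qed

text \<open>The equation of phase \<open>0\<close> after elimination of the other phases.\<close>

lemma kernel_equation:
  fixes x y :: "'a::{real_normed_field,banach}"
  assumes xy: "norm x \<le> 1" "norm y \<le> 1"
  shows "x * y * (D_fun P None x y - T_denom P x y) * Pi_gf p None x y
    + service1 P x y * (of_real w * both_busy p x y + (Pi_gf p None x 0 - Pi_gf p None 0 0))
    + service2 P x y * (of_real (1 - w) * both_busy p x y + (Pi_gf p None 0 y - Pi_gf p None 0 0)) = 0"
proof -
  have sum: "(\<Sum>k\<in>UNIV. jump_gf P k None x y * Pi_gf p k x y) =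
      (jump_gf P None None x y + T_denom P x y) * Pi_gf p None x y"
    by (simp add: UNIV_option_conv sum.reindex Pi_gf_Some[OF xy] T_denom_eq distrib_right sum_distrib_right mult.assoc)
  show ?thesis
    using phase_equation(1)[OF xy, of None] unfolding sum D_fun_eq[OF P xy] if_P[OF refl] by algebra
qed

lemma Pi_gf_None_one: "Pi_gf p None (1::real) 1 * (1 + (\<Sum>k\<in>UNIV. F_fun P k (1::real) 1)) = 1"
  using Pi_gf_one
  by (simp add: UNIV_option_conv sum.reindex Pi_gf_Some algebra_simps sum_distrib_left)

end

section \<open>Majorants\<close>

text \<open>A power series with nonnegative coefficients majorizes, in the following sense, every power
  series whose coefficients are bounded by its own: this is clear for monomials, where the second
  inequality compares the sums of \<open>y\<^sup>a z\<^sup>b\<close> and \<open>r\<^sup>a s\<^sup>b\<close> over \<open>a + b = j - 1\<close>.  Stated without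
  coefficients, the relation passes to products and to the solutions of linear systems.\<close>

definition majorizes :: "(real \<Rightarrow> real) \<Rightarrow> ('a::{real_normed_field,banach} \<Rightarrow> 'a) \<Rightarrow> bool" where
  "majorizes F f \<longleftrightarrow> (\<forall>r s y z. 0 \<le> s \<longrightarrow> s \<le> r \<longrightarrow> r \<le> 1 \<longrightarrow> norm y \<le> r \<longrightarrow> norm z \<le> s \<longrightarrow>
     norm (f y) \<le> F r \<and> (r - s) * norm (f y - f z) \<le> norm (y - z) * (F r - F s))"

lemma majorizesI:
  assumes "\<And>r y. 0 \<le> r \<Longrightarrow> r \<le> 1 \<Longrightarrow> norm y \<le> r \<Longrightarrow> norm (f y) \<le> F r"
    and "\<And>r s y z. 0 \<le> s \<Longrightarrow> s \<le> r \<Longrightarrow> r \<le> 1 \<Longrightarrow> norm y \<le> r \<Longrightarrow> norm z \<le> s \<Longrightarrow>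
      (r - s) * norm (f y - f z) \<le> norm (y - z) * (F r - F s)"
  shows "majorizes F f"
  using assms unfolding majorizes_def by auto

lemma majorizes_norm: "majorizes F f \<Longrightarrow> r \<le> 1 \<Longrightarrow> norm y \<le> r \<Longrightarrow> norm (f y) \<le> F r"
  unfolding majorizes_def using norm_ge_zero order_trans by blast

lemma majorizes_diff:
  "majorizes F f \<Longrightarrow> 0 \<le> s \<Longrightarrow> s \<le> r \<Longrightarrow> r \<le> 1 \<Longrightarrow> norm y \<le> r \<Longrightarrow> norm z \<le> s \<Longrightarrow>
    (r - s) * norm (f y - f z) \<le> norm (y - z) * (F r - F s)"
  unfolding majorizes_def by blast

lemma majorizes_add:
  fixes f g :: "'a::{real_normed_field,banach} \<Rightarrow> 'a"
  assumes "majorizes F f" "majorizes G g"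
  shows "majorizes (\<lambda>r. F r + G r) (\<lambda>y. f y + g y)"
proof (rule majorizesI)
  fix r s :: real and y z :: 'a assume a: "0 \<le> s" "s \<le> r" "r \<le> 1" "norm y \<le> r" "norm z \<le> s"
  have "norm (f y + g y - (f z + g z)) \<le> norm (f y - f z) + norm (g y - g z)"
    by (rule norm_diff_triangle_ineq)
  then have "(r - s) * norm (f y + g y - (f z + g z)) \<le> (r - s) * (norm (f y - f z) + norm (g y - g z))"
    using a by (intro mult_left_mono) auto
  also have "\<dots> \<le> norm (y - z) * (F r - F s) + norm (y - z) * (G r - G s)"
    using majorizes_diff[OF assms(1) a] majorizes_diff[OF assms(2) a] by (simp add: distrib_left)
  finally show "(r - s) * norm (f y + g y - (f z + g z)) \<le> norm (y - z) * (F r + G r - (F s + G s))"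
    by (simp add: algebra_simps)
next
  fix r :: real and y :: 'a assume "r \<le> 1" "norm y \<le> r"
  then show "norm (f y + g y) \<le> F r + G r"
    using majorizes_norm[OF assms(1)] majorizes_norm[OF assms(2)] by (intro norm_triangle_le add_mono) auto
qed

lemma majorizes_sum:
  assumes "\<And>i. i \<in> I \<Longrightarrow> majorizes (F i) (f i)"
  shows "majorizes (\<lambda>r. \<Sum>i\<in>I. F i r) (\<lambda>y. \<Sum>i\<in>I. f i y)"
  using assms
proof (induction I rule: infinite_finite_induct)
  case (insert i I)
  then show ?case by (simp add: majorizes_add)
qed (auto simp: majorizes_def)

lemma majorizes_mult:
  fixes f g :: "'a::{real_normed_field,banach} \<Rightarrow> 'a"
  assumes f: "majorizes F f" and g: "majorizes G g"
  shows "majorizes (\<lambda>r. F r * G r) (\<lambda>y. f y * g y)"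
proof (rule majorizesI)
  fix r s :: real and y z :: 'a assume a: "0 \<le> s" "s \<le> r" "r \<le> 1" "norm y \<le> r" "norm z \<le> s"
  have F: "norm (f y) \<le> F r" and G: "norm (g z) \<le> G s"
    using majorizes_norm[OF f, of r y] majorizes_norm[OF g, of s z] a by auto
  have F0: "0 \<le> F r" and G0: "0 \<le> G s"
    using order_trans[OF norm_ge_zero F] order_trans[OF norm_ge_zero G] by auto
  have "norm (f y * g y - f z * g z) = norm (f y * (g y - g z) + (f y - f z) * g z)"
    by (simp add: algebra_simps)
  also have "\<dots> \<le> norm (f y) * norm (g y - g z) + norm (f y - f z) * norm (g z)"
    by (rule norm_triangle_le) (simp add: norm_mult)
  also have "\<dots> \<le> F r * norm (g y - g z) + norm (f y - f z) * G s"
    by (intro add_mono mult_right_mono mult_left_mono F G) auto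
  finally have "(r - s) * norm (f y * g y - f z * g z) \<le> (r - s) * (F r * norm (g y - g z) + norm (f y - f z) * G s)"
    using a by (intro mult_left_mono) auto
  also have "\<dots> = F r * ((r - s) * norm (g y - g z)) + ((r - s) * norm (f y - f z)) * G s"
    by (simp add: algebra_simps)
  also have "\<dots> \<le> F r * (norm (y - z) * (G r - G s)) + (norm (y - z) * (F r - F s)) * G s"
    by (intro add_mono mult_right_mono mult_left_mono majorizes_diff[OF f a] majorizes_diff[OF g a] F0 G0)
  also have "\<dots> = norm (y - z) * (F r * G r - F s * G s)" by (simp add: algebra_simps)
  finally show "(r - s) * norm (f y * g y - f z * g z) \<le> norm (y - z) * (F r * G r - F s * G s)" .
next
  fix r :: real and y :: 'a assume "r \<le> 1" "norm y \<le> r"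
  then show "norm (f y * g y) \<le> F r * G r"
    using majorizes_norm[OF f, of r y] majorizes_norm[OF g, of r y]
    by (simp add: norm_mult mult_mono')
qed

lemma majorizes_ident: "majorizes (\<lambda>r. r) (\<lambda>y. y)"
  by (rule majorizesI) (auto simp: mult.commute)

lemma majorizes_const: "norm c \<le> C \<Longrightarrow> majorizes (\<lambda>r. C) (\<lambda>y. c)"
  by (rule majorizesI) auto

lemma majorizes_power: "majorizes (\<lambda>r. r ^ j) (\<lambda>y. y ^ j)"
proof (induction j)
  case (Suc j)
  then show ?case using majorizes_mult[OF majorizes_ident Suc] by simp
qed (simp add: majorizes_const)

lemma majorizes_jump_gf:
  fixes x :: "'a::{real_normed_field,banach}"
  assumes P: "valid_model P" and x: "norm x \<le> 1"
  shows "majorizes (\<lambda>r. jump_gf P k k' 1 r) (\<lambda>y. jump_gf P k k' x y)"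
proof (rule majorizesI)
  fix r s :: real and y z :: 'a assume a: "0 \<le> s" "s \<le> r" "r \<le> 1" "norm y \<le> r" "norm z \<le> s"
  have n: "norm y \<le> 1" "norm z \<le> 1" "norm r \<le> 1" "norm s \<le> 1" using a by auto
  let ?a = "jump_rate P k k'"
  let ?f = "\<lambda>y d. of_real (?a d) * (x ^ fst d * y ^ snd d)"
  have "norm (of_real (r - s) * (jump_gf P k k' x y + - jump_gf P k k' x z)) \<le>
      norm (y - z) * (jump_gf P k k' 1 r + - jump_gf P k k' 1 s)"
  proof (rule norm_infsum_le)
    show "((\<lambda>d. of_real (r - s) * (?f y d + - ?f z d)) has_sum
        of_real (r - s) * (jump_gf P k k' x y + - jump_gf P k k' x z)) UNIV"
      by (intro has_sum_cmult_right has_sum_add has_sum_uminusI has_sum_jump_gf P x n)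
    show "((\<lambda>d. norm (y - z) * (of_real (?a d) * (1 ^ fst d * r ^ snd d) + - (of_real (?a d) * (1 ^ fst d * s ^ snd d)))) has_sum
        norm (y - z) * (jump_gf P k k' 1 r + - jump_gf P k k' 1 s)) UNIV"
      by (intro has_sum_cmult_right has_sum_add has_sum_uminusI has_sum_jump_gf P n) auto
    fix d
    have "norm (of_real (r - s) * (?f y d + - ?f z d)) =
        norm (x ^ fst d) * (?a d * ((r - s) * norm (y ^ snd d - z ^ snd d)))"
      using a jump_rate_nonneg[OF P, of k k' d]
      by (simp add: norm_mult right_diff_distrib[symmetric] flip: of_real_diff)
    also have "\<dots> \<le> 1 * (?a d * (norm (y - z) * (r ^ snd d - s ^ snd d)))"
      using a x jump_rate_nonneg[OF P, of k k' d]
      by (intro mult_mono mult_left_mono majorizes_diff[OF majorizes_power])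
         (auto simp: norm_power power_le_one intro!: mult_nonneg_nonneg power_mono)
    finally show "norm (of_real (r - s) * (?f y d + - ?f z d)) \<le>
        norm (y - z) * (of_real (?a d) * (1 ^ fst d * r ^ snd d) + - (of_real (?a d) * (1 ^ fst d * s ^ snd d)))"
      by (simp add: algebra_simps)
  qed
  then show "(r - s) * norm (jump_gf P k k' x y - jump_gf P k k' x z) \<le>
      norm (y - z) * (jump_gf P k k' 1 r - jump_gf P k k' 1 s)"
    using a by (simp add: norm_mult flip: of_real_diff)
next
  fix r :: real and y :: 'a assume "r \<le> 1" "norm y \<le> r"
  then show "norm (jump_gf P k k' x y) \<le> jump_gf P k k' 1 r"
    using norm_jump_gf_le[OF P x] by blast
qed

lemma return_gf_system:
  assumes P: "valid_model P" and xy: "norm x \<le> 1" "norm y \<le> 1"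
  shows "of_real (out_rate P (Some k)) * return_gf P x y $ k =
    (\<Sum>m\<in>UNIV. jump_gf P (Some k) (Some m) x y * return_gf P x y $ m) + jump_gf P (Some k) None x y"
  using return_gf_eq[OF assms, of "return_gf P x y"] unfolding L_mat_mult_eq_iff[OF assms] by simp

lemma jump_gf_one_mono:
  assumes "valid_model P" "0 \<le> r" "r \<le> (1::real)"
  shows "jump_gf P k k' 1 r \<le> jump_gf P k k' 1 1"
  using norm_jump_gf_le[of P "1::real" r 1 k k'] assms by auto

text \<open>The two estimates follow from the maximum principle, applied to the differences between the two
  sides over all phases at once.\<close>

lemma majorizes_return_gf:
  fixes x :: "'a::{real_normed_field,banach}"
  assumes P: "valid_model P" and x: "norm x \<le> 1"
  shows "majorizes (\<lambda>r. return_gf P 1 r $ k) (\<lambda>y. return_gf P x y $ k)"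
proof -
  let ?d = "\<lambda>k. out_rate P (Some k)" and ?B = "\<lambda>k m. jump_gf P (Some k) (Some m)"
    and ?C = "\<lambda>k. jump_gf P (Some k) None" and ?u = "\<lambda>x y m. return_gf P x y $ m"
  have d: "0 \<le> ?d k" for k using out_rate_pos[OF P] by (simp add: less_imp_le)
  have B0: "0 \<le> ?B k m 1 r" if "0 \<le> r" for k m and r :: real
    by (rule jump_gf_real_nonneg[OF P _ that]) simp
  have Bd: "(\<Sum>m\<in>UNIV. ?B k m 1 r) < ?d k" if r: "0 \<le> r" "r \<le> 1" for k and r :: real
    by (rule le_less_trans[OF sum_mono[OF jump_gf_one_mono[OF P r]] inner_rate_less_out_rate[OF P]])
  have real_sys: "?d k * ?u 1 r k = (\<Sum>m\<in>UNIV. ?B k m 1 r * ?u 1 r m) + ?C k 1 r"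
    if "0 \<le> r" "r \<le> 1" for k and r :: real
    using return_gf_system[OF P, of "1::real" r k] that by simp
  have bound: "norm (?u x y k) - ?u 1 r k \<le> 0" if r: "0 \<le> r" "r \<le> 1" and y: "norm y \<le> r" for r y k
  proof (rule weighted_maximum_principle[where d="?d" and B="\<lambda>k m. ?B k m 1 r"])
    fix k
    have y1: "norm y \<le> 1" using y r by simp
    have "?d k * norm (?u x y k) = norm (of_real (?d k) * ?u x y k)"
      using d by (simp add: norm_mult)
    also have "\<dots> \<le> (\<Sum>m\<in>UNIV. norm (?B k m x y * ?u x y m)) + norm (?C k x y)"
      unfolding return_gf_system[OF P x y1] by (intro norm_triangle_le add_mono norm_sum order_refl)
    also have "\<dots> \<le> (\<Sum>m\<in>UNIV. ?B k m 1 r * norm (?u x y m)) + ?C k 1 r"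
      by (intro add_mono sum_mono norm_jump_gf_le P x y r)
         (auto simp: norm_mult intro!: mult_right_mono norm_jump_gf_le P x y r)
    finally show "?d k * (norm (?u x y k) - ?u 1 r k) \<le> (\<Sum>m\<in>UNIV. ?B k m 1 r * (norm (?u x y m) - ?u 1 r m))"
      using real_sys[OF r, of k] by (simp add: right_diff_distrib sum_subtractf)
  qed (use B0 Bd r in auto)
  show ?thesis
  proof (rule majorizesI)
    fix r :: real and y :: 'a assume "0 \<le> r" "r \<le> 1" "norm y \<le> r"
    then show "norm (?u x y k) \<le> ?u 1 r k" using bound[of r y k] by simp
  next
    fix r s :: real and y z :: 'a assume a: "0 \<le> s" "s \<le> r" "r \<le> 1" "norm y \<le> r" "norm z \<le> s"
    have b: "norm y \<le> 1" "norm z \<le> 1" "0 \<le> r" "s \<le> 1" using a by auto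
    let ?e = "norm (y - z)"
    have "(r - s) * norm (?u x y k - ?u x z k) - ?e * (?u 1 r k - ?u 1 s k) \<le> 0"
    proof (rule weighted_maximum_principle[where d="?d" and B="\<lambda>k m. ?B k m 1 r"])
      fix k
      have "of_real (?d k) * (?u x y k - ?u x z k) =
          (\<Sum>m\<in>UNIV. ?B k m x y * (?u x y m - ?u x z m) + (?B k m x y - ?B k m x z) * ?u x z m)
          + (?C k x y - ?C k x z)"
        unfolding right_diff_distrib left_diff_distrib return_gf_system[OF P x b(1)] return_gf_system[OF P x b(2)]
        by (simp add: sum_subtractf)
      then have "?d k * norm (?u x y k - ?u x z k) = norm (
          (\<Sum>m\<in>UNIV. ?B k m x y * (?u x y m - ?u x z m) + (?B k m x y - ?B k m x z) * ?u x z m)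
          + (?C k x y - ?C k x z))"
        using d by (metis norm_mult norm_of_real abs_of_nonneg)
      also have "\<dots> \<le> (\<Sum>m\<in>UNIV. norm (?B k m x y) * norm (?u x y m - ?u x z m)
          + norm (?B k m x y - ?B k m x z) * norm (?u x z m)) + norm (?C k x y - ?C k x z)"
        by (intro norm_triangle_le add_mono order_refl sum_norm_le norm_mult_ineq)
      finally have "(r - s) * (?d k * norm (?u x y k - ?u x z k)) \<le> (r - s) * (
          (\<Sum>m\<in>UNIV. norm (?B k m x y) * norm (?u x y m - ?u x z m)
          + norm (?B k m x y - ?B k m x z) * norm (?u x z m)) + norm (?C k x y - ?C k x z))"
        using a by (intro mult_left_mono) auto
      also have "\<dots> = (\<Sum>m\<in>UNIV. norm (?B k m x y) * ((r - s) * norm (?u x y m - ?u x z m))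
          + ((r - s) * norm (?B k m x y - ?B k m x z)) * norm (?u x z m)) + (r - s) * norm (?C k x y - ?C k x z)"
        by (simp add: distrib_left sum_distrib_left mult_ac)
      also have "\<dots> \<le> (\<Sum>m\<in>UNIV. ?B k m 1 r * ((r - s) * norm (?u x y m - ?u x z m))
          + (?e * (?B k m 1 r - ?B k m 1 s)) * ?u 1 s m) + ?e * (?C k 1 r - ?C k 1 s)"
      proof (intro add_mono sum_mono)
        have dJ: "(r - s) * norm (jump_gf P k k' x y - jump_gf P k k' x z) \<le>
            ?e * (jump_gf P k k' 1 r - jump_gf P k k' 1 s)" for k k'
          by (rule majorizes_diff[OF majorizes_jump_gf[OF P x] a])
        then show "(r - s) * norm (?C k x y - ?C k x z) \<le> ?e * (?C k 1 r - ?C k 1 s)" .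
        show "norm (?B k m x y) * ((r - s) * norm (?u x y m - ?u x z m)) \<le>
            ?B k m 1 r * ((r - s) * norm (?u x y m - ?u x z m))" for m
          using a by (intro mult_right_mono norm_jump_gf_le[OF P x] mult_nonneg_nonneg) auto
        show "((r - s) * norm (?B k m x y - ?B k m x z)) * norm (?u x z m) \<le>
            (?e * (?B k m 1 r - ?B k m 1 s)) * ?u 1 s m" for m
        proof (rule mult_mono[OF dJ])
          show "norm (?u x z m) \<le> ?u 1 s m" using bound[of s z m] a by simp
          show "0 \<le> ?e * (?B k m 1 r - ?B k m 1 s)"
            by (rule order_trans[OF _ dJ]) (use a in auto)
        qed auto
      qed
      also have "\<dots> = (\<Sum>m\<in>UNIV. ?B k m 1 r * ((r - s) * norm (?u x y m - ?u x z m) - ?e * (?u 1 r m - ?u 1 s m)))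
          + ?e * ?d k * (?u 1 r k - ?u 1 s k)"
      proof -
        have E1: "?d k * (?u 1 r k - ?u 1 s k) = (\<Sum>m\<in>UNIV. ?B k m 1 r * ?u 1 r m) + ?C k 1 r
            - ((\<Sum>m\<in>UNIV. ?B k m 1 s * ?u 1 s m) + ?C k 1 s)"
          using real_sys[of r k] real_sys[of s k] a b by (simp add: right_diff_distrib)
        have E2: "(\<Sum>m\<in>UNIV. ?B k m 1 r * ((r - s) * norm (?u x y m - ?u x z m))
            + (?e * (?B k m 1 r - ?B k m 1 s)) * ?u 1 s m) =
          (\<Sum>m\<in>UNIV. ?B k m 1 r * ((r - s) * norm (?u x y m - ?u x z m) - ?e * (?u 1 r m - ?u 1 s m))
            + ?e * (?B k m 1 r * ?u 1 r m - ?B k m 1 s * ?u 1 s m))"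
          by (intro sum.cong) (auto simp: algebra_simps)
        also have "\<dots> = (\<Sum>m\<in>UNIV. ?B k m 1 r * ((r - s) * norm (?u x y m - ?u x z m) - ?e * (?u 1 r m - ?u 1 s m)))
            + ?e * ((\<Sum>m\<in>UNIV. ?B k m 1 r * ?u 1 r m) - (\<Sum>m\<in>UNIV. ?B k m 1 s * ?u 1 s m))"
          by (simp only: sum.distrib sum_distrib_left[symmetric] sum_subtractf)
        finally show ?thesis
          unfolding mult.assoc[of ?e "?d k"] E1 by (simp add: distrib_left right_diff_distrib)
      qed
      finally show "?d k * ((r - s) * norm (?u x y k - ?u x z k) - ?e * (?u 1 r k - ?u 1 s k)) \<le>
          (\<Sum>m\<in>UNIV. ?B k m 1 r * ((r - s) * norm (?u x y m - ?u x z m) - ?e * (?u 1 r m - ?u 1 s m)))"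
        by (simp add: algebra_simps)
    qed (use B0 Bd a b in auto)
    then show "(r - s) * norm (?u x y k - ?u x z k) \<le> ?e * (?u 1 r k - ?u 1 s k)" by simp
  qed
qed

text \<open>The difference quotient of \<open>F\<close> at \<open>1\<close> bounds that of \<open>f\<close> between \<open>y\<close> and a point inside the
  disc.  As \<open>z\<close> may lie on the circle, it is approached along the radius by points \<open>r z\<close>.\<close>

lemma majorizes_lipschitz:
  fixes y z :: "'a::{real_normed_field,banach}"
  assumes f: "majorizes F f" and F: "\<And>r. 0 < r \<Longrightarrow> r < 1 \<Longrightarrow> F 1 - F r \<le> \<kappa> * (1 - r)"
    and yz: "norm y \<le> 1" "norm z \<le> 1"
  shows "norm (f y - f z) \<le> \<kappa> * norm (y - z)"
proof -
  have step: "norm (f v - f (of_real r * z)) \<le> \<kappa> * norm (v - of_real r * z)"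
    if r: "0 < r" "r < 1" and v: "norm v \<le> 1" for r v
  proof -
    have "norm (of_real r * z) \<le> r" using r yz by (simp add: norm_mult mult_left_le)
    then have "(1 - r) * norm (f v - f (of_real r * z)) \<le> norm (v - of_real r * z) * (F 1 - F r)"
      using r v by (intro majorizes_diff[OF f]) auto
    also have "\<dots> \<le> norm (v - of_real r * z) * (\<kappa> * (1 - r))"
      by (intro mult_left_mono F r) auto
    finally have "(1 - r) * norm (f v - f (of_real r * z)) \<le> (1 - r) * (\<kappa> * norm (v - of_real r * z))"
      by (simp only: mult_ac)
    then show ?thesis using r by (simp add: mult_le_cancel_left_pos)
  qed
  have lim: "((\<lambda>r. \<kappa> * norm (y - of_real r * z) + \<kappa> * norm (z - of_real r * z)) \<longlongrightarrow>
      \<kappa> * norm (y - of_real 1 * z) + \<kappa> * norm (z - of_real 1 * z)) (at_left 1)"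
    by (intro tendsto_intros)
  have "\<forall>\<^sub>F r in at_left (1::real). 0 < r \<and> r < 1"
    using eventually_at_left_real[of 0 "1::real"] by simp
  then have "\<forall>\<^sub>F r in at_left (1::real). norm (f y - f z) \<le>
      \<kappa> * norm (y - of_real r * z) + \<kappa> * norm (z - of_real r * z)"
  proof eventually_elim
    case (elim r)
    have "norm (f y - f z) \<le> norm (f y - f (of_real r * z)) + norm (f z - f (of_real r * z))"
      using norm_triangle_ineq4[of "f y - f (of_real r * z)" "f z - f (of_real r * z)"] by simp
    also have "\<dots> \<le> \<kappa> * norm (y - of_real r * z) + \<kappa> * norm (z - of_real r * z)"
      by (intro add_mono step) (use elim yz in auto)
    finally show ?case .
  qed
  from tendsto_lowerbound[OF lim this] show ?thesis by simp
qed

section \<open>The zero of the kernel\<close>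

lemma infsum_weighted_diff_power:
  fixes x c :: "'a::{real_normed_field,banach}"
  assumes a: "a summable_on UNIV" "\<And>i. 0 \<le> a i" and x: "norm x \<le> 1"
  shows "(\<Sum>\<^sub>\<infinity>i. of_real (a i) * (c - x ^ i)) = of_real (\<Sum>\<^sub>\<infinity>i. a i) * c - (\<Sum>\<^sub>\<infinity>i. of_real (a i) * x ^ i)"
proof -
  have "((\<lambda>i. of_real (a i) * c + - (of_real (a i) * x ^ i)) has_sum
      of_real (\<Sum>\<^sub>\<infinity>i. a i) * c + - (\<Sum>\<^sub>\<infinity>i. of_real (a i) * x ^ i)) UNIV"
    by (intro has_sum_add has_sum_uminusI has_sum_cmult_left has_sum_of_real has_sum_infsum
        weighted_summable[where B=1] a) (use x in \<open>simp add: norm_power power_le_one\<close>)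
  then show ?thesis by (intro infsumI) (simp add: algebra_simps)
qed

definition qone_gf :: "'n model \<Rightarrow> 'a::{real_normed_field,banach} \<Rightarrow> 'a" where
  "qone_gf P y = (\<Sum>\<^sub>\<infinity>j. of_real (qone P j) * y ^ j)"

definition qtwo_gf :: "'n model \<Rightarrow> 'a::{real_normed_field,banach} \<Rightarrow> 'a" where
  "qtwo_gf P x = (\<Sum>\<^sub>\<infinity>i. of_real (qtwo P i) * x ^ i)"

definition qone_total :: "'n model \<Rightarrow> real" where "qone_total P = (\<Sum>\<^sub>\<infinity>j. qone P j)"

definition qtwo_total :: "'n model \<Rightarrow> real" where "qtwo_total P = (\<Sum>\<^sub>\<infinity>i. qtwo P i)"

lemma infsum_qone:
  assumes "valid_model P" "norm y \<le> 1"
  shows "(\<Sum>\<^sub>\<infinity>j. of_real (qone P j) * (c - y ^ j)) = of_real (qone_total P) * c - qone_gf P y"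
  unfolding qone_total_def qone_gf_def
  by (rule infsum_weighted_diff_power) (auto intro: assms qone_summable_on qone_nonneg)

lemma infsum_qtwo:
  assumes "valid_model P" "norm x \<le> 1"
  shows "(\<Sum>\<^sub>\<infinity>i. of_real (qtwo P i) * (c - x ^ i)) = of_real (qtwo_total P) * c - qtwo_gf P x"
  unfolding qtwo_total_def qtwo_gf_def
  by (rule infsum_weighted_diff_power) (auto intro: assms qtwo_summable_on qtwo_nonneg)

lemma infsum_qone_scaled:
  assumes "valid_model P" "norm y \<le> 1" "x \<noteq> 0"
  shows "(\<Sum>\<^sub>\<infinity>j. of_real (qone P j) * (1 - inverse x * y ^ j)) =
    inverse x * (of_real (qone_total P) * x - qone_gf P y)"
proof -
  have "(\<Sum>\<^sub>\<infinity>j. of_real (qone P j) * (1 - inverse x * y ^ j)) =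
      (\<Sum>\<^sub>\<infinity>j. inverse x * (of_real (qone P j) * (x - y ^ j)))"
    using assms(3) by (intro infsum_cong) (simp add: field_simps)
  then show ?thesis by (simp add: infsum_cmult_right' infsum_qone[OF assms(1,2)])
qed

lemma norm_qtwo_gf_le:
  assumes P: "valid_model P" and x: "norm x \<le> 1"
  shows "norm (qtwo_gf P x) \<le> qtwo_total P"
proof -
  have "norm (qtwo_gf P x) \<le> (\<Sum>\<^sub>\<infinity>i. qtwo P i * 1)"
    unfolding qtwo_gf_def
    by (rule norm_weighted_infsum_le) (use x in \<open>auto simp: norm_power power_le_one qtwo_summable_on[OF P] qtwo_nonneg[OF P]\<close>)
  then show ?thesis by (simp add: qtwo_total_def)
qed

lemma continuous_on_qtwo_gf: "valid_model P \<Longrightarrow> continuous_on (cball 0 1) (qtwo_gf P)"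
  unfolding qtwo_gf_def[abs_def]
  by (intro continuous_on_weighted_infsum[where B=1] qtwo_summable_on qtwo_nonneg continuous_intros)
     (auto simp: norm_power power_le_one)

lemma qone_gf_of_real:
  assumes P: "valid_model P" and y: "\<bar>y\<bar> \<le> 1"
  shows "qone_gf P (of_real y :: 'a::{real_normed_field,banach}) = of_real (qone_gf P y)"
proof -
  have "(\<lambda>j. of_real (qone P j) * y ^ j) summable_on UNIV"
    using y by (intro weighted_summable[where B=1] qone_summable_on qone_nonneg P) (simp add: power_abs power_le_one)
  from has_sum_of_real[OF has_sum_infsum[OF this], where 'a='a] show ?thesis
    unfolding qone_gf_def by (intro infsumI) simp
qed

lemma qtwo_gf_of_real:
  assumes P: "valid_model P" and y: "\<bar>y\<bar> \<le> 1"
  shows "qtwo_gf P (of_real y :: 'a::{real_normed_field,banach}) = of_real (qtwo_gf P y)"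
proof -
  have "(\<lambda>j. of_real (qtwo P j) * y ^ j) summable_on UNIV"
    using y by (intro weighted_summable[where B=1] qtwo_summable_on qtwo_nonneg P) (simp add: power_abs power_le_one)
  from has_sum_of_real[OF has_sum_infsum[OF this], where 'a='a] show ?thesis
    unfolding qtwo_gf_def by (intro infsumI) simp
qed

text \<open>All arrivals during phase \<open>0\<close>, weighted with their rates, where the customers that arrive
  during an excursion into the other phases are counted as one batch.  The coefficients of this
  power series are nonnegative, and their sum is \<open>out_rate P None\<close>.\<close>

definition arrival_gf :: "'n::finite model \<Rightarrow> 'a::{real_normed_field,banach} \<Rightarrow> 'a \<Rightarrow> 'a" where
  "arrival_gf P x y = T_denom P x y + jump_gf P None None x y"

lemma majorizes_excursions:
  fixes x :: "'a::{real_normed_field,banach}"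
  assumes P: "valid_model P" and x: "norm x \<le> 1"
  shows "majorizes (\<lambda>r. \<Sum>k\<in>UNIV. jump_gf P None (Some k) 1 r * return_gf P 1 r $ k)
      (\<lambda>y. \<Sum>k\<in>UNIV. jump_gf P None (Some k) x y * return_gf P x y $ k)"
  by (intro majorizes_sum majorizes_mult majorizes_jump_gf majorizes_return_gf assms)

lemma majorizes_cong:
  fixes f f' :: "'a::{real_normed_field,banach} \<Rightarrow> 'a"
  assumes "majorizes F f" "\<And>r. 0 \<le> r \<Longrightarrow> r \<le> 1 \<Longrightarrow> F' r = F r" "\<And>y. norm y \<le> 1 \<Longrightarrow> f' y = f y"
  shows "majorizes F' f'"
proof (rule majorizesI)
  fix r s :: real and y z :: 'a
  assume a: "0 \<le> s" "s \<le> r" "r \<le> 1" "norm y \<le> r" "norm z \<le> s"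
  then show "(r - s) * norm (f' y - f' z) \<le> norm (y - z) * (F' r - F' s)"
    using majorizes_diff[OF assms(1) a] by (simp add: assms(2,3))
next
  fix r :: real and y :: 'a assume "0 \<le> r" "r \<le> 1" "norm y \<le> r"
  then show "norm (f' y) \<le> F' r"
    using majorizes_norm[OF assms(1)] by (simp add: assms(2,3))
qed

lemma continuous_on_det:
  fixes A :: "'c::topological_space \<Rightarrow> 'a::real_normed_field ^ 'n ^ 'n"
  assumes "\<And>i j. continuous_on U (\<lambda>z. A z $ i $ j)"
  shows "continuous_on U (\<lambda>z. det (A z))"
  unfolding det_def by (intro continuous_intros assms)

text \<open>By Cramer's rule.\<close>

lemma continuous_on_return_gf:
  fixes P :: "'n::finite model"
  assumes P: "valid_model P"
  shows "continuous_on (cball 0 1 \<times> cball 0 1)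
    (\<lambda>z::'a::{real_normed_field,banach} \<times> 'a. return_gf P (fst z) (snd z) $ k)"
proof -
  let ?U = "cball 0 1 \<times> cball (0::'a) 1"
  let ?L = "\<lambda>z::'a \<times> 'a. L_mat P (fst z) (snd z)"
  have entry: "continuous_on ?U (\<lambda>z. ?L z $ i $ j)" for i j
  proof -
    have "continuous_on ?U (\<lambda>z. (if i = j then of_real (out_rate P (Some i)) else 0)
        - jump_gf P (Some i) (Some j) (fst z) (snd z))"
      by (intro continuous_intros continuous_on_jump_gf P)
    then show ?thesis
      by (rule continuous_on_eq) (auto simp: L_mat_eq[OF P])
  qed
  have "continuous_on ?U (\<lambda>z. det (\<chi> i j. if j = k then jump_gf P (Some i) None (fst z) (snd z) else ?L z $ i $ j) / det (?L z))"
  proof (intro continuous_on_divide continuous_on_det entry ballI)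
    show "continuous_on ?U (\<lambda>z. (\<chi> i j. if j = k then jump_gf P (Some i) None (fst z) (snd z) else ?L z $ i $ j) $ i $ j)" for i j
      by (cases "j = k") (auto intro!: continuous_on_jump_gf P entry)
  qed (auto simp: det_L_mat_nonzero[OF P])
  then show ?thesis
  proof (rule continuous_on_eq)
    fix z :: "'a \<times> 'a" assume "z \<in> ?U"
    then have z: "norm (fst z) \<le> 1" "norm (snd z) \<le> 1" by auto
    have "?L z *v return_gf P (fst z) (snd z) = (\<chi> k. jump_gf P (Some k) None (fst z) (snd z))"
      using return_gf_eq[OF P z] by blast
    then show "det (\<chi> i j. if j = k then jump_gf P (Some i) None (fst z) (snd z) else ?L z $ i $ j) / det (?L z) =
        return_gf P (fst z) (snd z) $ k"
      using cramer[OF det_L_mat_nonzero[OF P z]] by (simp cong: if_cong)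
  qed
qed

lemma continuous_on_T_denom:
  fixes P :: "'n::finite model"
  assumes P: "valid_model P"
  shows "continuous_on (cball 0 1 \<times> cball 0 1)
    (\<lambda>z::'a::{real_normed_field,banach} \<times> 'a. T_denom P (fst z) (snd z))"
proof -
  have "continuous_on (cball 0 1 \<times> cball 0 1)
      (\<lambda>z::'a \<times> 'a. \<Sum>k\<in>UNIV. jump_gf P None (Some k) (fst z) (snd z) * return_gf P (fst z) (snd z) $ k)"
    by (intro continuous_intros continuous_on_jump_gf continuous_on_return_gf P)
  then show ?thesis
    by (rule continuous_on_eq) (auto simp: T_denom_return_gf[OF P])
qed

lemma continuous_on_arrival_gf:
  "valid_model P \<Longrightarrow> continuous_on (cball 0 1 \<times> cball 0 1)
    (\<lambda>z::'a::{real_normed_field,banach} \<times> 'a. arrival_gf P (fst z) (snd z))"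
  unfolding arrival_gf_def by (intro continuous_intros continuous_on_T_denom continuous_on_jump_gf)

lemma return_gf_one:
  assumes P: "valid_model P"
  shows "return_gf P (1::real) 1 $ k = 1"
proof -
  have "L_mat P (1::real) 1 *v 1 = (\<chi> k. jump_gf P (Some k) None 1 1)"
  proof (subst L_mat_mult_eq_iff[OF P])
    have "out_rate P (Some k) = (\<Sum>m\<in>UNIV. jump_gf P (Some k) (Some m) (1::real) 1) + jump_gf P (Some k) None (1::real) 1" for k
      by (simp flip: sum_jump_gf_one add: UNIV_option_conv sum.reindex)
    then show "\<forall>k. of_real (out_rate P (Some k)) * (1::real ^ 'a) $ k =
        (\<Sum>m\<in>UNIV. jump_gf P (Some k) (Some m) 1 1 * 1 $ m) + (\<chi> k. jump_gf P (Some k) None 1 1) $ k"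
      by simp
  qed auto
  then have "1 = return_gf P (1::real) 1"
    by (subst (asm) return_gf_eq[OF P]) auto
  then show ?thesis by (metis one_index)
qed

lemma T_denom_one:
  assumes "valid_model P"
  shows "T_denom P (1::real) 1 = (\<Sum>k\<in>UNIV. jump_gf P None (Some k) 1 1)"
  by (simp add: T_denom_return_gf[OF assms] return_gf_one[OF assms])

lemma arrival_gf_one:
  assumes "valid_model P"
  shows "arrival_gf P (1::real) 1 = out_rate P None"
  by (simp add: arrival_gf_def T_denom_one[OF assms] UNIV_option_conv sum.reindex flip: sum_jump_gf_one)

lemma majorizes_arrival:
  fixes x :: "'a::{real_normed_field,banach}"
  assumes P: "valid_model P" and x: "norm x \<le> 1"
  shows "majorizes (\<lambda>r. r * arrival_gf P 1 r) (\<lambda>y. y * arrival_gf P x y)"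
proof -
  have "majorizes (\<lambda>r. r * ((\<Sum>k\<in>UNIV. jump_gf P None (Some k) 1 r * return_gf P 1 r $ k) + jump_gf P None None 1 r))
      (\<lambda>y. y * ((\<Sum>k\<in>UNIV. jump_gf P None (Some k) x y * return_gf P x y $ k) + jump_gf P None None x y))"
    by (intro majorizes_mult majorizes_ident majorizes_add majorizes_excursions majorizes_jump_gf assms)
  then show ?thesis
    by (rule majorizes_cong) (auto simp: arrival_gf_def T_denom_return_gf[OF P] x)
qed

text \<open>Clearing the denominator \<open>T_denom\<close> turns the equation \<open>G(x, y) = 0\<close> into a fixed point
  equation for \<open>y\<close> in which all power series have nonnegative coefficients.\<close>

lemma is_G_zero_iff:
  assumes P: "valid_model P" and x: "norm x \<le> 1"
  shows "is_G_zero P x y \<longleftrightarrow> norm y \<le> 1 \<and> T_denom P x y \<noteq> 0 \<and>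
    of_real (out_rate P None + qtwo_total P) * y = qtwo_gf P x + y * arrival_gf P x y"
proof (cases "norm y \<le> 1 \<and> T_denom P x y \<noteq> 0")
  case True
  then have "G_fun P x y = 0 \<longleftrightarrow>
      y * D_fun P None x y + (of_real (qtwo_total P) * y - qtwo_gf P x) = y * T_denom P x y"
    unfolding G_fun_def T_fun_def infsum_qtwo[OF P x] by (auto simp: field_simps)
  also have "\<dots> \<longleftrightarrow> of_real (out_rate P None + qtwo_total P) * y = qtwo_gf P x + y * arrival_gf P x y"
    using True by (auto simp: D_fun_eq[OF P x] arrival_gf_def algebra_simps)
  finally show ?thesis using True by (simp add: is_G_zero_def)
qed (auto simp: is_G_zero_def)

text \<open>The constant \<open>\<kappa>\<close> bounds the slope at \<open>1\<close> of the majorant of the right-hand side of the fixed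
  point equation.  That it stays below the factor of \<open>y\<close> on the left-hand side says that the second
  queue drifts downwards when it has priority.\<close>

locale contractive =
  fixes P :: "'n::finite model" and \<kappa> :: real
  assumes P: "valid_model P"
    and drift: "0 < r \<Longrightarrow> r < 1 \<Longrightarrow> out_rate P None - r * arrival_gf P 1 r \<le> \<kappa> * (1 - r)"
    and \<kappa>: "\<kappa> < out_rate P None + qtwo_total P"
begin

abbreviation "\<Gamma> \<equiv> out_rate P None + qtwo_total P"

lemma arrival_lipschitz:
  fixes x y z :: complex
  assumes "norm x \<le> 1" "norm y \<le> 1" "norm z \<le> 1"
  shows "norm (y * arrival_gf P x y - z * arrival_gf P x z) \<le> \<kappa> * norm (y - z)"
  by (rule majorizes_lipschitz[OF majorizes_arrival[OF P assms(1)] _ assms(2,3)])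
     (simp add: arrival_gf_one[OF P] drift)

lemma \<kappa>_nonneg: "0 \<le> \<kappa>"
  using order_trans[OF norm_ge_zero arrival_lipschitz[of 0 1 0]] by simp

lemma \<Gamma>_pos: "0 < \<Gamma>" using \<kappa> \<kappa>_nonneg by linarith

definition kernel_zero :: "complex \<Rightarrow> complex" where
  "kernel_zero x = (THE y. norm y \<le> 1 \<and> of_real \<Gamma> * y = qtwo_gf P x + y * arrival_gf P x y)"

lemma ex1_kernel_zero:
  assumes x: "norm x \<le> 1"
  shows "\<exists>!y. norm y \<le> 1 \<and> of_real \<Gamma> * y = qtwo_gf P x + y * arrival_gf P (x::complex) y"
proof -
  define f where "f y = (qtwo_gf P x + y * arrival_gf P x y) / of_real \<Gamma>" for y
  have "norm (f y) \<le> 1" if y: "norm y \<le> 1" for y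
  proof -
    have "norm (y * arrival_gf P x y) \<le> out_rate P None"
      using majorizes_norm[OF majorizes_arrival[OF P x], of 1 y] y by (simp add: arrival_gf_one[OF P])
    then have "norm (qtwo_gf P x + y * arrival_gf P x y) \<le> \<Gamma>"
      using norm_qtwo_gf_le[OF P x] by (intro norm_triangle_le) simp
    then show ?thesis using \<Gamma>_pos by (simp add: f_def norm_divide divide_le_eq_1_pos del: of_real_add)
  qed
  then have "f ` cball 0 1 \<subseteq> cball 0 1" by auto
  moreover have "dist (f y) (f z) \<le> \<kappa> / \<Gamma> * dist y z" if "y \<in> cball 0 1" "z \<in> cball 0 1" for y z
  proof -
    have "f y - f z = (y * arrival_gf P x y - z * arrival_gf P x z) / of_real \<Gamma>"
      by (simp add: f_def diff_divide_distrib add_divide_distrib del: of_real_add)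
    then have "norm (f y - f z) = norm (y * arrival_gf P x y - z * arrival_gf P x z) / \<Gamma>"
      using \<Gamma>_pos by (simp add: norm_divide del: of_real_add)
    then show ?thesis
      using arrival_lipschitz[OF x, of y z] that \<Gamma>_pos by (simp add: dist_norm divide_right_mono)
  qed
  moreover have "\<kappa> / \<Gamma> < 1" "0 \<le> \<kappa> / \<Gamma>" using \<kappa> \<kappa>_nonneg \<Gamma>_pos by auto
  ultimately have "\<exists>!y\<in>cball 0 1. f y = y"
    by (intro Banach_fix[where c="\<kappa> / \<Gamma>"]) (auto simp: complete_eq_closed)
  moreover have "f y = y \<longleftrightarrow> of_real \<Gamma> * y = qtwo_gf P x + y * arrival_gf P x y" for y
    using \<Gamma>_pos unfolding f_def by (subst divide_eq_eq) (auto simp: mult.commute simp del: of_real_add)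
  ultimately show ?thesis by simp
qed

lemma kernel_zero:
  assumes "norm x \<le> 1"
  shows "norm (kernel_zero x) \<le> 1" "of_real \<Gamma> * kernel_zero x = qtwo_gf P x + kernel_zero x * arrival_gf P x (kernel_zero x)"
  using theI'[OF ex1_kernel_zero[OF assms]] unfolding kernel_zero_def by auto

lemma kernel_zero_unique:
  assumes "norm x \<le> 1" "norm y \<le> 1" "of_real \<Gamma> * y = qtwo_gf P x + y * arrival_gf P x y"
  shows "y = kernel_zero x"
  using ex1_kernel_zero[OF assms(1)] kernel_zero[OF assms(1)] assms(2,3) by blast

lemma is_G_zero_iff_kernel_zero:
  assumes "norm x \<le> 1"
  shows "is_G_zero P x y \<longleftrightarrow> y = kernel_zero x \<and> T_denom P x (kernel_zero x) \<noteq> 0"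
  using kernel_zero[OF assms] kernel_zero_unique[OF assms] unfolding is_G_zero_iff[OF P assms] by blast

lemma Y_fun_eq:
  assumes "norm x \<le> 1" "is_G_zero P x \<eta>"
  shows "Y_fun P x = \<eta>" "kernel_zero x = \<eta>"
  using assms unfolding Y_fun_def by (auto simp: is_G_zero_iff_kernel_zero)

text \<open>The fixed point of a contraction depends continuously on a parameter.\<close>

lemma continuous_on_kernel_zero: "continuous_on (cball 0 1) kernel_zero"
  unfolding continuous_on_def
proof
  fix x0 :: complex assume x0: "x0 \<in> cball 0 1"
  let ?\<eta> = "kernel_zero x0"
  let ?e = "\<lambda>x. norm (qtwo_gf P x - qtwo_gf P x0) + norm (arrival_gf P x ?\<eta> - arrival_gf P x0 ?\<eta>)"
  have bound: "norm (kernel_zero x - ?\<eta>) \<le> ?e x / (\<Gamma> - \<kappa>)" if x: "x \<in> cball 0 1" for x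
  proof -
    let ?y = "kernel_zero x"
    have n: "norm x \<le> 1" "norm x0 \<le> 1" using x x0 by auto
    have "of_real \<Gamma> * (?y - ?\<eta>) = (qtwo_gf P x - qtwo_gf P x0)
        + (?y * arrival_gf P x ?y - ?\<eta> * arrival_gf P x ?\<eta>) + ?\<eta> * (arrival_gf P x ?\<eta> - arrival_gf P x0 ?\<eta>)"
      using kernel_zero(2)[OF n(1)] kernel_zero(2)[OF n(2)] by (simp add: right_diff_distrib del: of_real_add)
    then have "norm (of_real \<Gamma> * (?y - ?\<eta>)) \<le> norm (qtwo_gf P x - qtwo_gf P x0)
        + norm (?y * arrival_gf P x ?y - ?\<eta> * arrival_gf P x ?\<eta>) + norm (?\<eta> * (arrival_gf P x ?\<eta> - arrival_gf P x0 ?\<eta>))"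
      by (simp add: norm_triangle_le del: of_real_add norm_mult)
    also have "\<dots> \<le> norm (qtwo_gf P x - qtwo_gf P x0) + \<kappa> * norm (?y - ?\<eta>)
        + 1 * norm (arrival_gf P x ?\<eta> - arrival_gf P x0 ?\<eta>)"
      unfolding norm_mult using n kernel_zero(1)
      by (intro add_mono arrival_lipschitz mult_right_mono) auto
    finally have "\<Gamma> * norm (?y - ?\<eta>) \<le> ?e x + \<kappa> * norm (?y - ?\<eta>)"
      using \<Gamma>_pos by (simp add: norm_mult del: of_real_add)
    then show ?thesis using \<kappa> by (simp add: field_simps)
  qed
  have n0: "norm ?\<eta> \<le> 1" using kernel_zero(1) x0 by simp
  have "continuous_on (cball 0 1) (\<lambda>x. arrival_gf P x ?\<eta>)"
    by (rule continuous_on_compose2[OF continuous_on_arrival_gf[OF P], where f="\<lambda>x. (x, ?\<eta>)", simplified])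
       (use n0 in \<open>auto intro!: continuous_intros\<close>)
  then have "((\<lambda>x. ?e x / (\<Gamma> - \<kappa>)) \<longlongrightarrow>
      (norm (qtwo_gf P x0 - qtwo_gf P x0) + norm (arrival_gf P x0 ?\<eta> - arrival_gf P x0 ?\<eta>)) / (\<Gamma> - \<kappa>)) (at x0 within cball 0 1)"
    using continuous_on_qtwo_gf[OF P] x0 \<kappa> by (intro tendsto_intros) (auto simp: continuous_on_def)
  then have "((\<lambda>x. ?e x / (\<Gamma> - \<kappa>)) \<longlongrightarrow> 0) (at x0 within cball 0 1)" by simp
  then have "((\<lambda>x. kernel_zero x - ?\<eta>) \<longlongrightarrow> 0) (at x0 within cball 0 1)"
    by (rule Lim_null_comparison[rotated]) (use bound in \<open>auto simp: eventually_at_filter\<close>)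
  then show "(kernel_zero \<longlongrightarrow> ?\<eta>) (at x0 within cball 0 1)"
    by (simp add: Lim_null[symmetric])
qed

end

context stationary
begin

lemma Pi_gf_zero: "Pi_gf p k 0 0 = of_real (p (0, 0, k))"
proof -
  have "((\<lambda>d. of_real (p (fst d, snd d, k)) * (0 ^ fst d * 0 ^ snd d)) has_sum of_real (p (0, 0, k))) UNIV"
    by (rule has_sum_finite_neutralI[where B="{(0, 0)}"]) (auto simp: power_0_left split: if_splits)
  then have "Pi_gf p k 0 0 = of_real (p (0, 0, k))"
    using has_sum_unique[OF has_sum_Pi_gf[of 0 0 k]] by simp
  then show ?thesis .
qed

text \<open>At \<open>x = 1\<close> the kernel equation balances the arrivals at the second queue with its services,
  whose rate is reduced at least by the fraction of time in which both queues are empty.\<close>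

lemma arrival_drift:
  assumes r: "0 < r" "r < (1::real)" and pos: "0 < p (0, 0, None)"
  shows "r * (out_rate P None - arrival_gf P 1 r) \<le> qtwo_total P * (1 - r) * (1 - p (0, 0, None))"
proof -
  let ?\<Pi> = "Pi_gf p None (1::real) r" and ?c = "p (0, 0, None)"
  let ?Hd = "out_rate P None - arrival_gf P 1 r"
  have n: "norm (1::real) \<le> 1" "norm r \<le> 1" "norm (0::real) \<le> 1" using r by auto
  have Pi00: "Pi_gf p None (0::real) 0 = ?c" by (simp add: Pi_gf_zero)
  let ?f = "\<lambda>u v d. of_real (p (fst d, snd d, None)) * (u ^ fst d * v ^ snd d :: real)"
  have bb: "0 \<le> both_busy p 1 r"
  proof -
    have "((\<lambda>d. ?f 1 r d + - ?f 1 0 d + - ?f 0 r d + ?f 0 0 d) has_sum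
        Pi_gf p None 1 r + - Pi_gf p None 1 0 + - Pi_gf p None 0 r + Pi_gf p None 0 0) UNIV"
      by (intro has_sum_add has_sum_uminusI has_sum_Pi_gf n)
    \<comment> \<open>The summands are nonnegative because they factor.\<close>
    moreover have "0 \<le> ?f 1 r d + - ?f 1 0 d + - ?f 0 r d + ?f 0 0 d" for d
    proof -
      have "?f 1 r d + - ?f 1 0 d + - ?f 0 r d + ?f 0 0 d =
          p (fst d, snd d, None) * ((1 - 0 ^ fst d) * (r ^ snd d - 0 ^ snd d))"
        by (simp add: algebra_simps)
      also have "\<dots> \<ge> 0"
        using r by (intro mult_nonneg_nonneg p_nonneg) (auto simp: power_0_left)
      finally show ?thesis .
    qed
    ultimately have "0 \<le> Pi_gf p None 1 r + - Pi_gf p None 1 0 + - Pi_gf p None 0 r + Pi_gf p None 0 (0::real)"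
      by (rule has_sum_nonneg)
    then show ?thesis by (simp add: both_busy_def)
  qed
  have mono: "?c \<le> Pi_gf p None 1 (0::real)"
  proof -
    have "Pi_gf p None 0 (0::real) \<le> Pi_gf p None 1 (0::real)"
      by (rule has_sum_mono[OF has_sum_Pi_gf has_sum_Pi_gf])
         (auto simp: power_0_left intro!: p_nonneg mult_left_mono)
    then show ?thesis using Pi00 by simp
  qed
  have mono2: "Pi_gf p None 1 (0::real) \<le> ?\<Pi>"
    by (rule has_sum_mono[OF has_sum_Pi_gf has_sum_Pi_gf])
       (use r in \<open>auto simp: power_0_left intro!: p_nonneg mult_left_mono mult_nonneg_nonneg\<close>)
  have le1: "?\<Pi> \<le> 1"
  proof -
    have nn: "0 \<le> Pi_gf p k (1::real) 1" for k
      using has_sum_nonneg[OF has_sum_Pi_gf[of "1::real" 1 k]] p_nonneg by simp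
    have "?\<Pi> \<le> Pi_gf p None 1 1" using norm_Pi_gf_le[OF n(1,2), of None] by simp
    also have "\<dots> \<le> (\<Sum>k\<in>UNIV. Pi_gf p k (1::real) 1)"
      by (rule member_le_sum) (auto intro: nn)
    finally show ?thesis by (simp add: Pi_gf_one)
  qed
  have s1: "0 \<le> service1 P 1 r"
    unfolding service1_def using r
    by (auto intro!: mult_nonneg_nonneg infsum_nonneg qone_nonneg P power_le_one)
  have s2: "service2 P 1 r = - (qtwo_total P * (1 - r))"
    unfolding service2_def infsum_qtwo[OF P n(1)]
    by (simp add: qtwo_gf_def qtwo_total_def algebra_simps)
  have "r * ?Hd * ?\<Pi> + service1 P 1 r * (w * both_busy p 1 r + (Pi_gf p None 1 0 - ?c))
      + service2 P 1 r * ((1 - w) * both_busy p 1 r + (Pi_gf p None 0 r - ?c)) = 0"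
    using kernel_equation[OF n(1,2)] unfolding D_fun_eq[OF P n(1,2)]
    by (simp add: arrival_gf_def Pi00 diff_diff_eq add.commute)
  moreover have "0 \<le> service1 P 1 r * (w * both_busy p 1 r + (Pi_gf p None 1 0 - ?c))"
    using s1 bb w mono by (intro mult_nonneg_nonneg add_nonneg_nonneg) auto
  ultimately have "r * ?Hd * ?\<Pi> \<le> qtwo_total P * (1 - r) * ((1 - w) * both_busy p 1 r + (Pi_gf p None 0 r - ?c))"
    by (simp add: s2)
  also have "\<dots> \<le> qtwo_total P * (1 - r) * (both_busy p 1 r + (Pi_gf p None 0 r - ?c))"
  proof -
    have "0 \<le> qtwo_total P" unfolding qtwo_total_def by (intro infsum_nonneg qtwo_nonneg P)
    moreover have "(1 - w) * both_busy p 1 r \<le> both_busy p 1 r" using mult_right_mono[of "1 - w" 1 "both_busy p 1 r"] w bb by simp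
    ultimately show ?thesis using r by (intro mult_left_mono mult_nonneg_nonneg) auto
  qed
  also have "both_busy p 1 r + (Pi_gf p None 0 r - ?c) = ?\<Pi> - Pi_gf p None 1 0"
    by (simp add: both_busy_def Pi00)
  also have "qtwo_total P * (1 - r) * (?\<Pi> - Pi_gf p None 1 0) \<le> qtwo_total P * (1 - r) * ((1 - ?c) * ?\<Pi>)"
  proof (intro mult_left_mono mult_nonneg_nonneg)
    show "0 \<le> qtwo_total P" unfolding qtwo_total_def by (intro infsum_nonneg qtwo_nonneg P)
    have "?c * ?\<Pi> \<le> ?c" using le1 pos by simp
    then show "?\<Pi> - Pi_gf p None 1 0 \<le> (1 - ?c) * ?\<Pi>" using mono by (simp add: algebra_simps)
  qed (use r in auto)
  finally have "r * ?Hd * ?\<Pi> \<le> qtwo_total P * (1 - r) * (1 - ?c) * ?\<Pi>" by (simp add: mult.assoc)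
  moreover have "0 < ?\<Pi>" using pos mono mono2 by linarith
  ultimately show ?thesis by (simp add: mult_le_cancel_right_pos)
qed

lemma contractive:
  assumes pos: "0 < p (0, 0, None)" and q: "0 < qtwo_total P"
  shows "contractive P (out_rate P None + qtwo_total P * (1 - p (0, 0, None)))"
proof
  show "valid_model P" by (rule P)
  show "out_rate P None + qtwo_total P * (1 - p (0, 0, None)) < out_rate P None + qtwo_total P"
    using pos q by simp
  fix r :: real assume r: "0 < r" "r < 1"
  show "out_rate P None - r * arrival_gf P 1 r \<le>
      (out_rate P None + qtwo_total P * (1 - p (0, 0, None))) * (1 - r)"
    using arrival_drift[OF r pos] by (simp add: algebra_simps)
qed

text \<open>This is the kernel equation divided by \<open>x\<close> and multiplied by \<open>T\<close>.\<close>

lemma G_equation: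
  fixes x y :: complex
  assumes xy: "norm x \<le> 1" "norm y \<le> 1" and x0: "x \<noteq> 0" and T0: "T_denom P x y \<noteq> 0"
  shows "G_fun P x y * Pi_gf p None x y =
    G10_fun P x y * (of_real w * both_busy p x y + Pi_gf p None x 0) + G00_fun P x y * Pi_gf p None 0 0"
proof -
  define a where "a = of_real (qone_total P) * x - qone_gf P y"
  define b where "b = of_real (qtwo_total P) * y - qtwo_gf P x"
  define t T X W where "t = T_denom P x y" and "T = T_fun P x y" and "X = inverse x" and "W = complex_of_real w"
  have tT: "t * T = 1" using T0 by (simp add: t_def T_def T_fun_def)
  have xX: "x * X = 1" using x0 by (simp add: X_def)
  have s: "service1 P x y = y * a" "service2 P x y = x * b"
    by (simp_all add: service1_def service2_def a_def b_def infsum_qone[OF P xy(2)] infsum_qtwo[OF P xy(1)])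
  have G: "G_fun P x y = T * (y * D_fun P None x y + b) - y"
    "G10_fun P x y = T * (b - y * (X * a))" "G00_fun P x y = y * T * (X * a)"
    by (simp_all add: G_fun_def G10_fun_def G00_fun_def T_def X_def a_def b_def infsum_qtwo[OF P xy(1)]
        infsum_qone_scaled[OF P xy(2) x0])
  define g g1 g2 g0 D where "g = Pi_gf p None x y" and "g1 = Pi_gf p None x 0"
    and "g2 = Pi_gf p None 0 y" and "g0 = Pi_gf p None 0 (0::complex)" and "D = D_fun P None x y"
  have "x * y * (D - t) * g + y * a * (W * (g - g1 - g2 + g0) + (g1 - g0))
      + x * b * ((1 - W) * (g - g1 - g2 + g0) + (g2 - g0)) = 0"
    using kernel_equation[OF xy] unfolding s both_busy_def
    by (simp only: g_def g1_def g2_def g0_def D_def t_def W_def of_real_diff of_real_1)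
  then have "(T * (y * D + b) - y) * g = T * (b - y * (X * a)) * (W * (g - g1 - g2 + g0) + g1) + y * T * (X * a) * g0"
    using tT xX by algebra
  then show ?thesis
    unfolding G both_busy_def by (simp only: g_def g1_def g2_def g0_def D_def W_def)
qed

text \<open>Where \<open>K = 0\<close> the two services contribute equally to the kernel equation.  Then their
  weights \<open>w\<close> and \<open>1 - w\<close> add up, and the boundary values cancel except for that at the origin.\<close>

lemma curve_equation:
  fixes x y :: "'a::{real_normed_field,banach}"
  assumes xy: "norm x \<le> 1" "norm y \<le> 1" and K: "K_fun P x y = 0" and T0: "T_denom P x y \<noteq> 0"
  shows "(T_fun P x y * (x * y * D_fun P None x y + service1 P x y) - x * y) * Pi_gf p None x y =
    T_fun P x y * service1 P x y * of_real (p (0, 0, None))"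
    "R_fun P w x y = x * y * D_fun P None x y + service1 P x y" "C_fun P w x y = service1 P x y"
proof -
  have s12: "service2 P x y = service1 P x y"
    using K by (simp add: K_fun_def service1_def service2_def)
  show C: "C_fun P w x y = service1 P x y" by (simp add: C_fun_def K service1_def)
  have "(\<Sum>\<^sub>\<infinity>j. of_real (rate_interior P w (- 1) (int j)) * (x - y ^ j)) =
      of_real w * (\<Sum>\<^sub>\<infinity>j. of_real (qone P j) * (x - y ^ j))"
    by (simp add: rate_interior_def mult.assoc infsum_cmult_right')
  moreover have "(\<Sum>\<^sub>\<infinity>i. of_real (rate_interior P w (int i) (- 1)) * (y - x ^ i)) =
      of_real (1 - w) * (\<Sum>\<^sub>\<infinity>i. of_real (qtwo P i) * (y - x ^ i))"
    by (simp add: rate_interior_def mult.assoc infsum_cmult_right' del: of_real_diff)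
  ultimately have "R_fun P w x y = x * y * D_fun P None x y + of_real w * service1 P x y + of_real (1 - w) * service2 P x y"
    by (simp add: R_fun_def service1_def service2_def mult.left_commute)
  then show "R_fun P w x y = x * y * D_fun P None x y + service1 P x y"
    by (simp add: s12 algebra_simps)
  define t T W where "t = T_denom P x y" and "T = T_fun P x y" and "W = (of_real w :: 'a)"
  have tT: "t * T = 1" using T0 by (simp add: t_def T_def T_fun_def)
  define g g1 g2 g0 D s where "g = Pi_gf p None x y" and "g1 = Pi_gf p None x 0"
    and "g2 = Pi_gf p None 0 y" and "g0 = Pi_gf p None 0 (0::'a)" and "D = D_fun P None x y"
    and "s = service1 P x y"
  have "x * y * (D - t) * g + s * (W * (g - g1 - g2 + g0) + (g1 - g0))
      + s * ((1 - W) * (g - g1 - g2 + g0) + (g2 - g0)) = 0"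
    using kernel_equation[OF xy] unfolding s12 both_busy_def
    by (simp only: g_def g1_def g2_def g0_def D_def t_def W_def s_def of_real_diff of_real_1)
  then have "(T * (x * y * D + s) - x * y) * g = T * s * g0"
    using tT by algebra
  then show "(T_fun P x y * (x * y * D_fun P None x y + service1 P x y) - x * y) * Pi_gf p None x y =
    T_fun P x y * service1 P x y * of_real (p (0, 0, None))"
    by (simp only: g_def g0_def D_def s_def T_def Pi_gf_zero)
qed

end

section \<open>Consequences of stability\<close>

lemma eventually_zero_deriv:
  assumes "\<forall>\<^sub>F y in at_left (1::real). f y = (0::real)"
  shows "\<forall>\<^sub>F y in at_left 1. deriv f y = 0"
proof -
  obtain b where b: "b < 1" "\<And>y. b < y \<Longrightarrow> y < 1 \<Longrightarrow> f y = 0"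
    using assms by (auto simp: eventually_at_left_field)
  have "deriv f y = 0" if "b < y" "y < 1" for y
  proof (rule DERIV_imp_deriv)
    have "((\<lambda>_. 0) has_real_derivative 0) (at y)" by simp
    then show "(f has_real_derivative 0) (at y)"
      by (rule has_field_derivative_transform_within_open[where S="{b<..<1}"]) (use that b in auto)
  qed
  then show ?thesis
    using b(1) by (auto simp: eventually_at_left_field)
qed

text \<open>If one of the two functions vanished near \<open>1\<close>, so would the quotient of the derivatives.\<close>

lemma stability_frequently:
  assumes "stability_condition P w s"
  shows "\<exists>\<^sub>F y in at_left 1. R_fun P w (s y) y * T_fun P (s y) y - s y * y \<noteq> 0"
    and "\<exists>\<^sub>F y in at_left 1. T_fun P (s y) y * C_fun P w (s y) y \<noteq> 0"
proof -
  let ?f = "\<lambda>y. R_fun P w (s y) y * T_fun P (s y) y - s y * y"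
  let ?g = "\<lambda>y. T_fun P (s y) y * C_fun P w (s y) y"
  obtain l where l: "((\<lambda>y. deriv ?f y / deriv ?g y) \<longlongrightarrow> l) (at_left 1)"
    "inverse (1 + (\<Sum>k\<in>UNIV. F_fun P k (1::real) 1)) * l > 0"
    using assms unfolding stability_condition_def by blast
  have contr: False if "\<forall>\<^sub>F y in at_left 1. deriv ?f y / deriv ?g y = 0"
    using tendsto_unique[OF _ l(1) tendsto_eventually[OF that]] l(2) by simp
  show "\<exists>\<^sub>F y in at_left 1. ?f y \<noteq> 0"
  proof (rule ccontr)
    assume "\<not> ?thesis"
    then have "\<forall>\<^sub>F y in at_left 1. ?f y = 0" by (simp add: frequently_def)
    from eventually_zero_deriv[OF this] show False by (intro contr) (auto elim: eventually_mono)
  qed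
  show "\<exists>\<^sub>F y in at_left 1. ?g y \<noteq> 0"
  proof (rule ccontr)
    assume "\<not> ?thesis"
    then have "\<forall>\<^sub>F y in at_left 1. ?g y = 0" by (simp add: frequently_def)
    from eventually_zero_deriv[OF this] show False by (intro contr) (auto elim: eventually_mono)
  qed
qed

locale stationary_family =
  fixes P :: "'n::finite model" and p :: "real \<Rightarrow> nat \<times> nat \<times> 'n option \<Rightarrow> real" and s :: "real \<Rightarrow> real"
  assumes stationary: "0 < w \<Longrightarrow> w < 1 \<Longrightarrow> stationary P w (p w)"
    and branch: "kernel_branch P s"
    and stability: "0 < w \<Longrightarrow> w < 1 \<Longrightarrow> stability_condition P w s"
begin

lemma P: "valid_model P" using stationary[of "1/2"] by (auto simp: stationary_def)

lemma curve: "\<forall>\<^sub>F y in at_left 1. 0 < y \<and> y < 1 \<and> 0 < s y \<and> s y \<le> 1 \<and> K_fun P (s y) y = 0"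
proof -
  have "(s \<longlongrightarrow> 1) (at_left 1)" using branch by (simp add: kernel_branch_def)
  then have "\<forall>\<^sub>F y in at_left 1. 0 < s y" by (rule order_tendstoD) simp
  moreover have "\<forall>\<^sub>F y in at_left 1. \<bar>s y\<bar> \<le> 1 \<and> K_fun P (s y) y = 0"
    using branch unfolding kernel_branch_def by (auto elim: eventually_mono)
  moreover have "\<forall>\<^sub>F y in at_left (1::real). y \<in> {0<..<1}"
    by (rule eventually_at_left_real) simp
  ultimately show ?thesis by eventually_elim auto
qed

lemma curve_tendsto: "((\<lambda>y. (s y, y)) \<longlongrightarrow> (1, 1)) (at_left 1)"
  using branch by (intro tendsto_Pair) (auto simp: kernel_branch_def)

lemma continuous_along_curve:
  assumes "continuous_on (cball 0 1 \<times> cball 0 1) (\<lambda>z::real \<times> real. f (fst z) (snd z) :: real)"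
  shows "((\<lambda>y. f (s y) y) \<longlongrightarrow> f 1 1) (at_left 1)"
proof -
  have "((\<lambda>y. f (fst (s y, y)) (snd (s y, y))) \<longlongrightarrow> f (fst (1::real, 1::real)) (snd (1::real, 1::real))) (at_left 1)"
  proof (rule continuous_on_tendsto_compose[OF assms curve_tendsto])
    show "\<forall>\<^sub>F y in at_left 1. (s y, y) \<in> cball 0 1 \<times> cball 0 1"
      using curve by eventually_elim auto
  qed simp
  then show ?thesis by simp
qed

text \<open>The two sides of the kernel equation on the curve are \<open>curve_factor y * \<Pi>\<^sub>0(s(y), y)\<close> and
  \<open>curve_term y * \<Pi>\<^sub>0(0, 0)\<close>.\<close>

definition curve_factor :: "real \<Rightarrow> real" where
  "curve_factor y = T_fun P (s y) y * (s y * y * D_fun P None (s y) y + service1 P (s y) y) - s y * y"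

definition curve_term :: "real \<Rightarrow> real" where
  "curve_term y = T_fun P (s y) y * service1 P (s y) y"

lemma kernel_on_curve:
  assumes w: "0 < w" "w < 1"
  shows "\<forall>\<^sub>F y in at_left 1. T_denom P (s y) y \<noteq> 0 \<longrightarrow>
    curve_factor y * Pi_gf (p w) None (s y) y = curve_term y * p w (0, 0, None)"
    and "\<forall>\<^sub>F y in at_left 1. R_fun P w (s y) y * T_fun P (s y) y - s y * y = curve_factor y
      \<and> T_fun P (s y) y * C_fun P w (s y) y = curve_term y \<or> T_denom P (s y) y = 0"
proof -
  interpret stationary P w "p w" by (rule stationary[OF w])
  show "\<forall>\<^sub>F y in at_left 1. T_denom P (s y) y \<noteq> 0 \<longrightarrow>
    curve_factor y * Pi_gf (p w) None (s y) y = curve_term y * p w (0, 0, None)"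
    using curve
  proof eventually_elim
    case (elim y)
    then show ?case using curve_equation(1)[of "s y" y] by (simp add: curve_factor_def curve_term_def)
  qed
  show "\<forall>\<^sub>F y in at_left 1. R_fun P w (s y) y * T_fun P (s y) y - s y * y = curve_factor y
      \<and> T_fun P (s y) y * C_fun P w (s y) y = curve_term y \<or> T_denom P (s y) y = 0"
    using curve
  proof eventually_elim
    case (elim y)
    then show ?case using curve_equation(2,3)[of "s y" y] by (auto simp: curve_factor_def curve_term_def mult.commute)
  qed
qed

lemma Pi_gf_None_one_eq:
  assumes "0 < w" "w < 1" "0 < w'" "w' < 1"
  shows "Pi_gf (p w) None (1::real) 1 = Pi_gf (p w') None 1 1" "0 < Pi_gf (p w) None (1::real) 1"
proof -
  interpret a: stationary P w "p w" by (rule stationary[OF assms(1,2)])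
  interpret b: stationary P w' "p w'" by (rule stationary[OF assms(3,4)])
  let ?F = "1 + (\<Sum>k\<in>UNIV. F_fun P k (1::real) 1)"
  have "?F \<noteq> 0" using a.Pi_gf_None_one by auto
  then show "Pi_gf (p w) None (1::real) 1 = Pi_gf (p w') None 1 1"
    using a.Pi_gf_None_one b.Pi_gf_None_one by (metis mult_right_cancel)
  have "0 \<le> Pi_gf (p w) None (1::real) 1"
    using has_sum_nonneg[OF a.has_sum_Pi_gf[of "1::real" 1 None]] a.p_nonneg by simp
  moreover have "Pi_gf (p w) None (1::real) 1 \<noteq> 0" using a.Pi_gf_None_one by auto
  ultimately show "0 < Pi_gf (p w) None (1::real) 1" by simp
qed

lemma frequently_curve_term_nonzero:
  "\<exists>\<^sub>F y in at_left 1. curve_term y \<noteq> 0 \<and> T_denom P (s y) y \<noteq> 0"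
proof -
  have "\<exists>\<^sub>F y in at_left 1. T_fun P (s y) y * C_fun P (1/2) (s y) y \<noteq> 0"
    by (rule stability_frequently(2)[OF stability]) auto
  then show ?thesis
    by (rule frequently_rev_mp)
       (use kernel_on_curve(2)[of "1/2"] in \<open>auto simp: T_fun_def elim!: eventually_mono\<close>)
qed

text \<open>Along the curve \<open>x = s(y)\<close> the kernel equation does not depend on \<open>w\<close>, and it relates
  \<open>\<Pi>\<^sub>0(0,0)\<close> to values of \<open>\<Pi>\<^sub>0\<close> that tend to \<open>\<Pi>\<^sub>0(1,1)\<close>, which does not depend on \<open>w\<close> either.\<close>

lemma empty_probability_eq:
  assumes "0 < w" "w < 1" "0 < w'" "w' < 1"
  shows "p w (0, 0, None) = p w' (0, 0, None)"
proof -
  interpret a: stationary P w "p w" by (rule stationary[OF assms(1,2)])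
  interpret b: stationary P w' "p w'" by (rule stationary[OF assms(3,4)])
  let ?h = "\<lambda>y. p w (0, 0, None) * Pi_gf (p w') None (s y) y - p w' (0, 0, None) * Pi_gf (p w) None (s y) y"
  have lim: "(?h \<longlongrightarrow> p w (0, 0, None) * Pi_gf (p w') None 1 1 - p w' (0, 0, None) * Pi_gf (p w) None 1 1) (at_left 1)"
    by (intro tendsto_intros continuous_along_curve a.continuous_on_Pi_gf b.continuous_on_Pi_gf)
  have "\<exists>\<^sub>F y in at_left 1. ?h y = 0"
  proof (rule frequently_rev_mp[OF frequently_curve_term_nonzero])
    show "\<forall>\<^sub>F y in at_left 1. curve_term y \<noteq> 0 \<and> T_denom P (s y) y \<noteq> 0 \<longrightarrow> ?h y = 0"
      using kernel_on_curve(1)[OF assms(1,2)] kernel_on_curve(1)[OF assms(3,4)]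
    proof eventually_elim
      case (elim y)
      show ?case
      proof
        assume g: "curve_term y \<noteq> 0 \<and> T_denom P (s y) y \<noteq> 0"
        have "curve_term y * ?h y = 0" using elim g by algebra
        then show "?h y = 0" using g by simp
      qed
    qed
  qed
  then have "p w (0, 0, None) * Pi_gf (p w') None 1 1 - p w' (0, 0, None) * Pi_gf (p w) None 1 (1::real) = 0"
    using tendsto_imp_eventually_ne[OF lim, of 0] by (auto simp: frequently_def)
  then show ?thesis using Pi_gf_None_one_eq[OF assms] by simp
qed

text \<open>Otherwise phase \<open>0\<close> would never be left, and \<open>T_denom\<close> would vanish everywhere on the curve.\<close>

lemma T_denom_one_nonzero: "T_denom P (1::real) 1 \<noteq> 0"
proof
  assume "T_denom P (1::real) 1 = 0"
  then have sum0: "(\<Sum>k\<in>UNIV. jump_gf P None (Some k) (1::real) 1) = 0" by (simp add: T_denom_one[OF P])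
  have z: "jump_gf P None (Some k) (1::real) 1 = 0" for k
    using sum0 by (subst (asm) sum_nonneg_eq_0_iff) (auto intro!: jump_gf_real_nonneg P)
  have "T_denom P x y = 0" if "norm x \<le> 1" "norm y \<le> 1" for x y :: real
  proof -
    have "jump_gf P None (Some k) x y = 0" for k
      using norm_jump_gf_le[OF P that(1,2), of None "Some k"] by (simp add: z)
    then show ?thesis by (simp add: T_denom_return_gf[OF P that])
  qed
  then have "\<forall>\<^sub>F y in at_left 1. T_denom P (s y) y = 0"
    using curve by (auto elim!: eventually_mono)
  then have "\<forall>\<^sub>F y in at_left 1. \<not> (curve_term y \<noteq> 0 \<and> T_denom P (s y) y \<noteq> 0)"
    by (rule eventually_mono) simp
  then show False using frequently_curve_term_nonzero unfolding frequently_def by blast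
qed

text \<open>If \<open>\<Pi>\<^sub>0(0,0)\<close> were zero, the factor of \<open>\<Pi>\<^sub>0(s(y), y)\<close> would vanish near \<open>y = 1\<close>, and this is
  the function in the numerator of the stability condition.\<close>

lemma empty_probability_pos:
  assumes w: "0 < w" "w < 1"
  shows "0 < p w (0, 0, None)"
proof (rule ccontr)
  interpret stationary P w "p w" by (rule stationary[OF w])
  assume "\<not> ?thesis"
  then have c0: "p w (0, 0, None) = 0" using p_nonneg[of "(0, 0, None)"] by linarith
  have "((\<lambda>y. Pi_gf (p w) None (s y) y) \<longlongrightarrow> Pi_gf (p w) None 1 1) (at_left 1)"
    by (intro continuous_along_curve continuous_on_Pi_gf)
  then have "\<forall>\<^sub>F y in at_left 1. Pi_gf (p w) None (s y) y \<noteq> 0"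
    by (rule tendsto_imp_eventually_ne) (use Pi_gf_None_one_eq(2)[OF w w] in simp)
  moreover have "\<forall>\<^sub>F y in at_left 1. T_denom P (s y) y \<noteq> 0"
    by (rule tendsto_imp_eventually_ne[OF continuous_along_curve[OF continuous_on_T_denom[OF P]] T_denom_one_nonzero])
  ultimately have "\<forall>\<^sub>F y in at_left 1. R_fun P w (s y) y * T_fun P (s y) y - s y * y = 0"
    using kernel_on_curve[OF w] by eventually_elim (auto simp: c0)
  then show False
    using stability_frequently(1)[OF stability[OF w]] by (simp add: frequently_def)
qed

lemma service1_eq: "norm y \<le> 1 \<Longrightarrow> service1 P x y = y * (of_real (qone_total P) * x - qone_gf P y)"
  by (simp add: service1_def infsum_qone[OF P])

lemma K_fun_eq:
  assumes "norm x \<le> 1" "norm y \<le> 1"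
  shows "K_fun P x y = x * (of_real (qtwo_total P) * y - qtwo_gf P x) - y * (of_real (qone_total P) * x - qone_gf P y)"
  by (simp add: K_fun_def infsum_qone[OF P assms(2)] infsum_qtwo[OF P assms(1)])

lemma frequently_service:
  "\<exists>\<^sub>F y in at_left 1. (0 < y \<and> y < 1 \<and> 0 < s y \<and> s y \<le> 1 \<and> K_fun P (s y) y = 0) \<and>
    y * (qone_total P * s y - qone_gf P y) \<noteq> 0"
proof (rule frequently_rev_mp[OF frequently_curve_term_nonzero])
  show "\<forall>\<^sub>F y in at_left 1. curve_term y \<noteq> 0 \<and> T_denom P (s y) y \<noteq> 0 \<longrightarrow>
    (0 < y \<and> y < 1 \<and> 0 < s y \<and> s y \<le> 1 \<and> K_fun P (s y) y = 0) \<and>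
    y * (qone_total P * s y - qone_gf P y) \<noteq> 0"
    using curve by eventually_elim (auto simp: curve_term_def service1_eq)
qed

text \<open>Without services of the second queue, \<open>K = 0\<close> would force \<open>C = 0\<close>.\<close>

lemma qtwo_total_pos: "0 < qtwo_total P"
proof (rule ccontr)
  assume "\<not> ?thesis"
  moreover have "0 \<le> qtwo_total P" unfolding qtwo_total_def by (intro infsum_nonneg qtwo_nonneg P)
  ultimately have b0: "qtwo_total P = 0" by simp
  have q0: "qtwo_gf P x = 0" if "norm x \<le> 1" for x :: real
    using norm_qtwo_gf_le[OF P that] b0 by simp
  obtain y where "0 < y" "y < 1" "0 < s y" "s y \<le> 1" "K_fun P (s y) y = 0"
    "y * (qone_total P * s y - qone_gf P y) \<noteq> 0"
    using frequently_ex[OF frequently_service] by auto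
  then show False using K_fun_eq[of "s y" y] b0 q0[of "s y"] by simp
qed

text \<open>If \<open>y = qtwo_gf x / qtwo_total\<close> and \<open>x = qone_gf y / qone_total\<close> were inverse to each other,
  both summands of \<open>K\<close> would vanish on the graph.  By monotonicity \<open>K\<close> has no other zeros with positive
  coordinates, so that this graph would be the curve \<open>x = s(y)\<close>, on which \<open>C\<close> would vanish.\<close>

lemma services_not_inverse:
  shows "\<exists>x::real. 0 < x \<and> x < 1 \<and> qone_total P * x \<noteq> qone_gf P (qtwo_gf P x / qtwo_total P)"
proof (rule ccontr)
  assume "\<not> ?thesis"
  then have inv: "qone_total P * x = qone_gf P (qtwo_gf P x / qtwo_total P)" if "0 < x" "x < 1" for x :: real
    using that by blast
  let ?b = "qtwo_total P"
  note b = qtwo_total_pos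
  have inv1: "qone_total P * 1 = qone_gf P (qtwo_gf P 1 / ?b)"
  proof -
    have "qtwo_gf P (1::real) = ?b" by (simp add: qtwo_gf_def qtwo_total_def)
    then show ?thesis using b by (simp add: qone_gf_def qone_total_def)
  qed
  obtain y where y: "0 < y" "y < 1" "0 < s y" "s y \<le> 1" "K_fun P (s y) y = 0"
    "y * (qone_total P * s y - qone_gf P y) \<noteq> 0"
    using frequently_ex[OF frequently_service] by auto
  define v where "v = qtwo_gf P (s y) / ?b"
  have v: "0 \<le> v" "v \<le> 1"
  proof -
    show "0 \<le> v" unfolding v_def qtwo_gf_def using y b qtwo_nonneg[OF P]
      by (auto intro!: divide_nonneg_nonneg infsum_nonneg)
    show "v \<le> 1" using norm_qtwo_gf_le[OF P, of "s y"] y b by (simp add: v_def)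
  qed
  have mono: "qone_gf P u \<le> qone_gf P u'" if "0 \<le> u" "u \<le> u'" "u' \<le> (1::real)" for u u'
    unfolding qone_gf_def
  proof (rule infsum_mono)
    show "(\<lambda>j. of_real (qone P j) * u ^ j) summable_on UNIV" "(\<lambda>j. of_real (qone P j) * u' ^ j) summable_on UNIV"
      using that by (auto intro!: weighted_summable[where B=1] qone_summable_on qone_nonneg P
        simp: power_abs power_le_one simp del: of_real_eq_id)
    show "of_real (qone P j) * u ^ j \<le> of_real (qone P j) * u' ^ j" for j
      using that qone_nonneg[OF P] by (auto intro!: mult_left_mono power_mono)
  qed
  have s1: "qone_total P * s y = qone_gf P v"
    using inv[of "s y"] inv1 y by (cases "s y = 1") (auto simp: v_def)
  have K: "s y * (?b * (y - v)) = y * (qone_gf P v - qone_gf P y)"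
  proof -
    have bv: "?b * v = qtwo_gf P (s y)" using b by (simp add: v_def)
    have "s y * (?b * y - ?b * v) - y * (qone_gf P v - qone_gf P y) = 0"
      using K_fun_eq[of "s y" y] y unfolding bv by (simp add: s1)
    then show ?thesis by (simp add: right_diff_distrib)
  qed
  have "y = v"
  proof (rule ccontr)
    assume "y \<noteq> v"
    then consider "y < v" | "v < y" by linarith
    then show False
    proof cases
      case 1
      then have "s y * (?b * (y - v)) < 0" using y b by (intro mult_pos_neg) auto
      moreover have "0 \<le> y * (qone_gf P v - qone_gf P y)" using mono[of y v] 1 y v by simp
      ultimately show False using K by simp
    next
      case 2
      then have "0 < s y * (?b * (y - v))" using y b by simp
      moreover have "y * (qone_gf P v - qone_gf P y) \<le> 0"
        using mono[of v y] 2 y v by (simp add: mult_nonneg_nonpos)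
      ultimately show False using K by simp
    qed
  qed
  then show False using y s1 by simp
qed

text \<open>The drift estimate may be taken from any single \<open>w\<close>, here \<open>1/2\<close>, since the kernel \<open>G\<close> does not
  depend on \<open>w\<close>.\<close>

definition rate_bound :: real where
  "rate_bound = out_rate P None + qtwo_total P * (1 - p (1/2) (0, 0, None))"

sublocale contractive P rate_bound
  unfolding rate_bound_def
  by (rule stationary.contractive[OF stationary empty_probability_pos qtwo_total_pos]) auto

section \<open>The boundary term at the zero of the kernel\<close>

lemma G_fun_at_zero:
  assumes "norm x \<le> 1" "T_denom P x (kernel_zero x) \<noteq> 0"
  shows "G_fun P x (kernel_zero x) = 0"
  using is_G_zero_iff_kernel_zero[OF assms(1), of "kernel_zero x"] assms(2) by (simp add: is_G_zero_def)

text \<open>Only the right-hand side of \<open>G_equation\<close> remains at a zero of \<open>G\<close>; the term in parentheses is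
  the boundary term.\<close>

lemma boundary_equation:
  assumes w: "0 < w" "w < 1" and x: "norm x \<le> 1" "x \<noteq> 0" and T0: "T_denom P x (kernel_zero x) \<noteq> 0"
  shows "G10_fun P x (kernel_zero x) * (of_real w * both_busy (p w) x (kernel_zero x) + Pi_gf (p w) None x 0)
    + G00_fun P x (kernel_zero x) * of_real (p w (0, 0, None)) = 0"
proof -
  interpret stationary P w "p w" by (rule stationary[OF w])
  show ?thesis
    using G_equation[OF x(1) kernel_zero(1)[OF x(1)] x(2) T0] G_fun_at_zero[OF x(1) T0] by (simp add: Pi_gf_zero)
qed

lemma tendsto_at_zero:
  assumes f: "continuous_on (cball 0 1 \<times> cball 0 1) (\<lambda>z::complex \<times> complex. f (fst z) (snd z) :: complex)"
    and X: "X \<longlonglongrightarrow> x0" "\<And>n. norm (X n) \<le> 1" and x0: "norm x0 \<le> 1"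
  shows "(\<lambda>n. f (X n) (kernel_zero (X n))) \<longlonglongrightarrow> f x0 (kernel_zero x0)"
proof -
  have "(\<lambda>n. kernel_zero (X n)) \<longlonglongrightarrow> kernel_zero x0"
    by (rule continuous_on_tendsto_compose[OF continuous_on_kernel_zero X(1)]) (use X x0 in auto)
  then have "(\<lambda>n. (X n, kernel_zero (X n))) \<longlonglongrightarrow> (x0, kernel_zero x0)" by (intro tendsto_Pair X)
  then have "(\<lambda>n. f (fst (X n, kernel_zero (X n))) (snd (X n, kernel_zero (X n)))) \<longlonglongrightarrow> f (fst (x0, kernel_zero x0)) (snd (x0, kernel_zero x0))"
    by (rule continuous_on_tendsto_compose[OF f]) (use X x0 kernel_zero(1) in auto)
  then show ?thesis by simp
qed

text \<open>Where \<open>G\<^sub>1\<^sub>0\<close> vanishes at the zero of the kernel, so does \<open>G\<^sub>0\<^sub>0\<close>, because \<open>\<Pi>\<^sub>0(0,0) > 0\<close>.  If this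
  happened on an open set, the identity theorem would extend the two equations to the unit disc.\<close>

lemma G10_nonzero_dense:
  assumes x0: "norm x0 \<le> 1" "x0 \<noteq> 0" and T0: "T_denom P x0 (kernel_zero x0) \<noteq> 0"
  shows "\<exists>X. (\<forall>n. norm (X n) \<le> 1 \<and> X n \<noteq> 0 \<and> T_denom P (X n) (kernel_zero (X n)) \<noteq> 0 \<and>
      G10_fun P (X n) (kernel_zero (X n)) \<noteq> 0) \<and> X \<longlonglongrightarrow> x0"
proof -
  define N where "N = {x. norm x \<le> 1 \<and> x \<noteq> 0 \<and> T_denom P x (kernel_zero x) \<noteq> 0 \<and> G10_fun P x (kernel_zero x) \<noteq> 0}"
  have "x0 \<in> closure N"
  proof (rule ccontr)
    assume "x0 \<notin> closure N"
    then obtain e1 where e1: "e1 > 0" "\<And>x. x \<in> N \<Longrightarrow> \<not> dist x x0 < e1"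
      unfolding closure_approachable by blast
    have "continuous_on (cball 0 1) (\<lambda>x. T_denom P (fst (x, kernel_zero x)) (snd (x, kernel_zero x)))"
      by (rule continuous_on_compose2[OF continuous_on_T_denom[OF P]])
         (auto intro!: continuous_intros continuous_on_kernel_zero kernel_zero(1))
    then have "((\<lambda>x. T_denom P x (kernel_zero x)) \<longlongrightarrow> T_denom P x0 (kernel_zero x0)) (at x0 within cball 0 1)"
      using x0 by (simp add: continuous_on_def)
    from tendsto_imp_eventually_ne[OF this T0]
    obtain e2 where e2: "e2 > 0" "\<And>x. x \<in> cball 0 1 \<Longrightarrow> x \<noteq> x0 \<Longrightarrow> dist x x0 < e2 \<Longrightarrow> T_denom P x (kernel_zero x) \<noteq> 0"
      by (auto simp: eventually_at)
    \<comment> \<open>The third bound keeps \<open>x\<close> away from \<open>0\<close>, where \<open>G10_fun\<close> has a pole.\<close>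
    define e where "e = min (min e1 e2) (norm x0)"
    have e: "e > 0" using e1 e2 x0 by (simp add: e_def)
    define U where "U = ball x0 e \<inter> ball 0 1"
    have openU: "open U" by (simp add: U_def open_Int)
    have "x0 \<in> closure (ball 0 1)" using x0 by simp
    from closure_approachable[THEN iffD1, rule_format, OF this e]
    obtain y where "y \<in> ball 0 1" "dist y x0 < e" by blast
    then have "y \<in> U" by (simp add: U_def dist_commute)
    then have "U \<noteq> {}" by blast
    have onU: "qtwo_gf P x * (of_real (qone_total P) * x - qone_gf P (qtwo_gf P x / of_real (qtwo_total P))) = 0"
      if xU: "x \<in> U" for x
    proof -
      have x: "norm x \<le> 1" using xU by (simp add: U_def)
      have xe: "dist x x0 < e" using xU by (simp add: U_def dist_commute)
      have xn0: "x \<noteq> 0" using xe by (auto simp: e_def)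
      have T: "T_denom P x (kernel_zero x) \<noteq> 0"
        using e2(2)[of x] T0 x xe by (cases "x = x0") (auto simp: e_def)
      have "x \<notin> N" using e1(2)[of x] xe by (auto simp: e_def)
      then have G10: "G10_fun P x (kernel_zero x) = 0" using x xn0 T by (simp add: N_def)
      have G00: "G00_fun P x (kernel_zero x) = 0"
        using boundary_equation[of "1/2" x] G10 x xn0 T empty_probability_pos[of "1/2"] by simp
      define b where "b = of_real (qtwo_total P) * kernel_zero x - qtwo_gf P x"
      define a where "a = of_real (qone_total P) * x - qone_gf P (kernel_zero x)"
      have za: "kernel_zero x * a = 0"
        using G00 T xn0 by (simp add: G00_fun_def T_fun_def a_def infsum_qone_scaled[OF P kernel_zero(1)[OF x] xn0])
      have "b - kernel_zero x * (inverse x * a) = 0"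
        using G10 T unfolding G10_fun_def T_fun_def infsum_qone_scaled[OF P kernel_zero(1)[OF x] xn0] infsum_qtwo[OF P x]
        by (simp add: a_def b_def)
      then have "b = inverse x * (kernel_zero x * a)" by (simp add: mult.left_commute)
      then have "b = 0" using za by simp
      then have zx: "kernel_zero x = qtwo_gf P x / of_real (qtwo_total P)"
        using qtwo_total_pos by (simp add: b_def field_simps)
      show ?thesis using za qtwo_total_pos by (auto simp: a_def zx)
    qed
    have inner: "norm (qtwo_gf P x / of_real (qtwo_total P)) \<le> 1" if "x \<in> cball 0 1" for x :: complex
      using norm_qtwo_gf_le[OF P, of x] that qtwo_total_pos by (simp add: norm_divide)
    have hol2: "qtwo_gf P holomorphic_on ball (0::complex) 1"
      unfolding qtwo_gf_def[abs_def]
      by (rule holomorphic_weighted_infsum[where B=1])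
         (auto intro!: qtwo_summable_on qtwo_nonneg P continuous_intros holomorphic_intros
           simp: norm_power power_le_one)
    have hol1: "(\<lambda>x. qone_gf P (qtwo_gf P x / of_real (qtwo_total P))) holomorphic_on ball (0::complex) 1"
      unfolding qone_gf_def
      by (rule holomorphic_weighted_infsum[where B=1])
         (use qtwo_total_pos in \<open>auto intro!: qone_summable_on qone_nonneg P continuous_intros
           continuous_on_qtwo_gf hol2 holomorphic_intros power_le_one inner simp: norm_power simp del: norm_divide\<close>)
    have ext: "qtwo_gf P x * (of_real (qone_total P) * x - qone_gf P (qtwo_gf P x / of_real (qtwo_total P))) = 0"
      if "x \<in> ball 0 1" for x :: complex
    proof (rule analytic_continuation_open[where s=U and s'="ball 0 1" and g="\<lambda>_. 0" and z=x
        and f="\<lambda>x. qtwo_gf P x * (of_real (qone_total P) * x - qone_gf P (qtwo_gf P x / of_real (qtwo_total P)))"])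
      show "(\<lambda>x. qtwo_gf P x * (of_real (qone_total P) * x -
          qone_gf P (qtwo_gf P x / of_real (qtwo_total P)))) holomorphic_on ball (0::complex) 1"
        by (intro holomorphic_intros hol1 hol2)
    qed (use openU \<open>U \<noteq> {}\<close> onU that in \<open>auto simp: U_def\<close>)
    obtain r :: real where r: "0 < r" "r < 1" "qone_total P * r \<noteq> qone_gf P (qtwo_gf P r / qtwo_total P)"
      using services_not_inverse by blast
    have "qtwo_gf P r * (qone_total P * r - qone_gf P (qtwo_gf P r / qtwo_total P)) = 0"
    proof -
      have n: "\<bar>qtwo_gf P r / qtwo_total P\<bar> \<le> 1"
        using norm_qtwo_gf_le[OF P, of r] r qtwo_total_pos by simp
      have "complex_of_real (qtwo_gf P r * (qone_total P * r - qone_gf P (qtwo_gf P r / qtwo_total P))) =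
          qtwo_gf P (of_real r) * (of_real (qone_total P) * of_real r -
            qone_gf P (qtwo_gf P (of_real r) / of_real (qtwo_total P)))"
        using r qone_gf_of_real[OF P n, where 'a=complex] by (simp add: qtwo_gf_of_real[OF P])
      also have "\<dots> = 0" by (rule ext) (use r in simp)
      finally show ?thesis by (simp only: of_real_eq_0_iff)
    qed
    then have z: "qtwo_gf P r = 0" using r by simp
    have "qtwo P i = 0" for i
    proof -
      have "((\<lambda>i. of_real (qtwo P i) * r ^ i) has_sum qtwo_gf P r) UNIV"
        unfolding qtwo_gf_def using r
        by (intro has_sum_infsum weighted_summable[where B=1] qtwo_summable_on qtwo_nonneg P)
           (simp add: power_abs power_le_one)
      then have "of_real (qtwo P i) * r ^ i = 0"
        by (rule nonneg_has_sum_le_0D) (use z r qtwo_nonneg[OF P] in auto)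
      then show ?thesis using r by simp
    qed
    then have "qtwo_total P = 0" by (simp add: qtwo_total_def)
    then show False using qtwo_total_pos by simp
  qed
  then show ?thesis
    unfolding closure_sequential N_def by auto
qed

text \<open>Where \<open>G\<^sub>1\<^sub>0\<close> does not vanish, the boundary equation determines the boundary term by \<open>G\<^sub>1\<^sub>0\<close>,
  \<open>G\<^sub>0\<^sub>0\<close> and \<open>\<Pi>\<^sub>0(0,0)\<close>, hence independently of \<open>w\<close>.  These points are dense and the boundary term
  is continuous in \<open>x\<close> for every fixed \<open>w\<close>.\<close>

lemma boundary_term_constant:
  assumes w: "0 < w" "w < 1" and w': "0 < w'" "w' < 1"
    and x0: "norm x0 \<le> 1" "x0 \<noteq> 0" and T0: "T_denom P x0 (kernel_zero x0) \<noteq> 0"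
  shows "of_real w * both_busy (p w) x0 (kernel_zero x0) + Pi_gf (p w) None x0 0 =
    of_real w' * both_busy (p w') x0 (kernel_zero x0) + Pi_gf (p w') None x0 0"
proof -
  interpret a: stationary P w "p w" by (rule stationary[OF w])
  interpret b: stationary P w' "p w'" by (rule stationary[OF w'])
  obtain X where X: "\<And>n. norm (X n) \<le> 1" "\<And>n. X n \<noteq> 0" "\<And>n. T_denom P (X n) (kernel_zero (X n)) \<noteq> 0"
    "\<And>n. G10_fun P (X n) (kernel_zero (X n)) \<noteq> 0" "X \<longlonglongrightarrow> x0"
    using G10_nonzero_dense[OF x0 T0] by blast
  have cont: "continuous_on (cball 0 1 \<times> cball 0 1)
      (\<lambda>z::complex \<times> complex. of_real w * both_busy (p w) (fst z) (snd z) + Pi_gf (p w) None (fst z) 0)"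
    if "stationary P w (p w)" for w
  proof -
    interpret stationary P w "p w" by (rule that)
    have c: "continuous_on (cball 0 1 \<times> cball 0 1) (\<lambda>z::complex \<times> complex. Pi_gf (p w) None (u z) (v z))"
      if "continuous_on (cball 0 1 \<times> cball 0 1) u" "continuous_on (cball 0 1 \<times> cball 0 1) v"
        "\<And>z. z \<in> cball 0 1 \<times> cball 0 1 \<Longrightarrow> norm (u z) \<le> 1 \<and> norm (v z) \<le> 1" for u v
    proof -
      have "continuous_on (cball 0 1 \<times> cball 0 1) (\<lambda>z. Pi_gf (p w) None (fst (u z, v z)) (snd (u z, v z)))"
        by (rule continuous_on_compose2[OF continuous_on_Pi_gf])
           (use that in \<open>auto intro!: continuous_on_Pair\<close>)
      then show ?thesis by simp
    qed
    show ?thesis unfolding both_busy_def by (intro continuous_intros c) auto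
  qed
  have eq: "of_real w * both_busy (p w) (X n) (kernel_zero (X n)) + Pi_gf (p w) None (X n) 0 =
    of_real w' * both_busy (p w') (X n) (kernel_zero (X n)) + Pi_gf (p w') None (X n) 0" for n
    using boundary_equation[OF w X(1,2,3)[of n]] boundary_equation[OF w' X(1,2,3)[of n]] X(4)[of n]
      empty_probability_eq[OF w w'] by (metis add_right_cancel mult_left_cancel)
  have "(\<lambda>n. of_real w * both_busy (p w) (X n) (kernel_zero (X n)) + Pi_gf (p w) None (X n) 0) \<longlonglongrightarrow>
      of_real w * both_busy (p w) x0 (kernel_zero x0) + Pi_gf (p w) None x0 0"
    by (rule tendsto_at_zero[OF cont[OF a.stationary_axioms] X(5,1) x0(1)])
  moreover have "(\<lambda>n. of_real w' * both_busy (p w') (X n) (kernel_zero (X n)) + Pi_gf (p w') None (X n) 0) \<longlonglongrightarrow>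
      of_real w' * both_busy (p w') x0 (kernel_zero x0) + Pi_gf (p w') None x0 0"
    by (rule tendsto_at_zero[OF cont[OF b.stationary_axioms] X(5,1) x0(1)])
  ultimately show ?thesis unfolding eq using LIMSEQ_unique by blast
qed

end

section \<open>Coefficients of the expansion in powers of w\<close>

text \<open>Agreement for small positive \<open>w\<close> suffices: the difference of the series converges in a complex
  neighbourhood of \<open>0\<close>, where a nontrivial power series has isolated zeros.\<close>

lemma power_series_coeff_unique:
  fixes a b :: "nat \<Rightarrow> complex"
  assumes a: "\<forall>\<^sub>F w in at_right 0. (\<lambda>m. a m * of_real w ^ m) sums f w"
    and b: "\<forall>\<^sub>F w in at_right 0. (\<lambda>m. b m * of_real w ^ m) sums f w"
  shows "a m = b m"
proof (rule ccontr)
  assume neq: "a m \<noteq> b m"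
  \<comment> \<open>The factor \<open>w\<close> makes the series vanish at \<open>0\<close> whatever its constant coefficient is.\<close>
  define d where "d n = (case n of 0 \<Rightarrow> 0 | Suc k \<Rightarrow> a k - b k)" for n
  have "\<forall>\<^sub>F w in at_right 0. (\<lambda>n. d n * of_real w ^ n) sums 0"
    using a b
  proof eventually_elim
    case (elim w)
    have "(\<lambda>n. of_real w * (a n * of_real w ^ n - b n * of_real w ^ n)) sums (of_real w * (f w - f w))"
      by (intro sums_mult sums_diff elim)
    then have "(\<lambda>n. d (Suc n) * of_real w ^ Suc n) sums 0"
      by (simp add: d_def algebra_simps)
    then show ?case by (subst (asm) sums_Suc_iff) (simp add: d_def)
  qed
  then obtain e where e: "e > 0" "\<And>w. 0 < w \<Longrightarrow> w < e \<Longrightarrow> (\<lambda>n. d n * of_real w ^ n) sums 0"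
    by (auto simp: eventually_at_right_field)
  define F where "F z = (\<Sum>n. d n * z ^ n)" for z
  have sums: "(\<lambda>n. d n * (z - 0) ^ n) sums F z" if z: "norm (z - 0) < e / 2" for z
  proof -
    have "(\<lambda>n. d n * of_real (e / 2) ^ n) sums 0" by (rule e(2)) (use e in auto)
    from powser_inside[OF sums_summable[OF this], of z] show ?thesis using z e by (simp add: F_def summable_sums)
  qed
  have F0: "F 0 = 0" by (simp add: F_def d_def)
  have dm: "d (Suc m) \<noteq> 0" using neq by (simp add: d_def)
  have e2: "0 < e / 2" using e by simp
  have "\<exists>t>0. \<forall>z\<in>cball 0 t - {0}. F z \<noteq> 0"
    by (rule powser_0_nonzero[where r="e / 2" and a=d and \<xi>=0 and f=F and m="Suc m",
          OF e2 sums F0 dm zero_less_Suc]) auto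
  then obtain t where t: "0 < t" "\<And>z. z \<in> cball 0 t - {0} \<Longrightarrow> F z \<noteq> 0" by blast
  define w where "w = min t (e / 4)"
  have w: "0 < w" "w \<le> t" "w < e" using t e by (auto simp: w_def)
  have "F (of_real w) = 0" using e(2)[OF w(1,3)] by (simp add: F_def sums_unique[symmetric])
  moreover have "of_real w \<in> cball 0 t - {0::complex}" using w by simp
  ultimately show False using t(2) by blast
qed

lemma sums_constant_term: "(\<lambda>m. (if m = 0 then c else 0) * z ^ m) sums (c :: complex)"
  using sums_finite[of "{0 :: nat}" "\<lambda>m. (if m = 0 then c else 0) * z ^ m"] by simp

lemma sums_shift_mult:
  fixes a :: "nat \<Rightarrow> complex"
  assumes "(\<lambda>m. a m * z ^ m) sums s"
  shows "(\<lambda>m. (case m of 0 \<Rightarrow> 0 | Suc k \<Rightarrow> a k) * z ^ m) sums (z * s)"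
proof -
  have "(\<lambda>m. z * (a m * z ^ m)) sums (z * s)" by (rule sums_mult[OF assms])
  then have "(\<lambda>m. (case Suc m of 0 \<Rightarrow> 0 | Suc k \<Rightarrow> a k) * z ^ Suc m) sums (z * s)"
    by (simp add: mult.left_commute mult.assoc)
  then show ?thesis by (subst (asm) sums_Suc_iff) simp
qed

locale expanded_family = stationary_family +
  fixes V :: "'a option \<Rightarrow> nat \<Rightarrow> complex \<Rightarrow> complex \<Rightarrow> complex"
  assumes expansion: "norm x \<le> 1 \<Longrightarrow> norm y \<le> 1 \<Longrightarrow>
      (\<forall>\<^sub>F w in at_right 0. (\<lambda>m. V k m x y * of_real w ^ m) sums Pi_gf (p w) k x y)"
begin

lemma small_w: "\<forall>\<^sub>F w in at_right (0::real). 0 < w \<and> w < 1"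
  using eventually_at_right_real[of 0 "1::real"] by simp

lemma V_Some:
  assumes xy: "norm x \<le> 1" "norm y \<le> 1"
  shows "V (Some k) m x y = F_fun P k x y * V None m x y"
proof (rule power_series_coeff_unique[OF expansion[OF xy]])
  show "\<forall>\<^sub>F w in at_right 0. (\<lambda>m. F_fun P k x y * V None m x y * of_real w ^ m) sums Pi_gf (p w) (Some k) x y"
    using expansion[OF xy, of None] small_w
  proof eventually_elim
    case (elim w)
    interpret stationary P w "p w" using elim by (intro stationary) auto
    show ?case using sums_mult[OF elim(1), of "F_fun P k x y"]
      by (simp add: Pi_gf_Some[OF xy] mult.assoc)
  qed
qed

lemma V_origin:
  "V None 0 0 0 = of_real (p (1/2) (0, 0, None))" "m > 0 \<Longrightarrow> V None m 0 0 = 0"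
proof -
  let ?c = "complex_of_real (p (1/2) (0, 0, None))"
  have "V None m 0 0 = (if m = 0 then ?c else 0)" for m
  proof (rule power_series_coeff_unique[OF expansion])
    show "\<forall>\<^sub>F w in at_right 0. (\<lambda>m. (if m = 0 then ?c else 0) * of_real w ^ m) sums Pi_gf (p w) None 0 0"
      using small_w
    proof eventually_elim
      case (elim w)
      interpret stationary P w "p w" using elim by (intro stationary) auto
      have "p w (0, 0, None) = p (1/2) (0, 0, None)" using elim by (intro empty_probability_eq) auto
      then show ?case by (simp only: Pi_gf_zero sums_constant_term)
    qed
  qed auto
  from this[of 0] this[of m]
  show "V None 0 0 0 = ?c" "m > 0 \<Longrightarrow> V None m 0 0 = 0" by simp_all
qed

definition V_busy :: "nat \<Rightarrow> complex \<Rightarrow> complex \<Rightarrow> complex" where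
  "V_busy m x y = V None m x y - V None m x 0 - V None m 0 y + V None m 0 0"

lemma V_busy_sums:
  assumes xy: "norm x \<le> 1" "norm y \<le> 1"
  shows "\<forall>\<^sub>F w in at_right 0. (\<lambda>m. ((case m of 0 \<Rightarrow> 0 | Suc k \<Rightarrow> V_busy k x y) + V None m x 0) * of_real w ^ m)
    sums (of_real w * both_busy (p w) x y + Pi_gf (p w) None x 0)"
proof -
  have n: "norm (0::complex) \<le> 1" by simp
  show ?thesis
    using expansion[OF xy, of None] expansion[OF xy(1) n, of None] expansion[OF n xy(2), of None] expansion[OF n n, of None]
  proof eventually_elim
    case (elim w)
    have "(\<lambda>m. V_busy m x y * of_real w ^ m) sums both_busy (p w) x y"
      unfolding V_busy_def both_busy_def distrib_right left_diff_distrib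
      by (intro sums_add sums_diff elim)
    from sums_add[OF sums_shift_mult[OF this] elim(2)] show ?case by (simp add: distrib_right)
  qed
qed

lemma V_G_equation:
  assumes xy: "norm x \<le> 1" "norm y \<le> 1" and x0: "x \<noteq> 0" and T0: "T_denom P x y \<noteq> 0"
  shows "G_fun P x y * V None m x y =
    G10_fun P x y * ((case m of 0 \<Rightarrow> 0 | Suc k \<Rightarrow> V_busy k x y) + V None m x 0) + G00_fun P x y * V None m 0 0"
proof (rule power_series_coeff_unique)
  show "\<forall>\<^sub>F w in at_right 0. (\<lambda>m. G_fun P x y * V None m x y * of_real w ^ m) sums (G_fun P x y * Pi_gf (p w) None x y)"
    using expansion[OF xy, of None]
    by eventually_elim (simp add: mult.assoc sums_mult)
  have n: "norm (0::complex) \<le> 1" by simp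
  show "\<forall>\<^sub>F w in at_right 0. (\<lambda>m. (G10_fun P x y * ((case m of 0 \<Rightarrow> 0 | Suc k \<Rightarrow> V_busy k x y) + V None m x 0)
      + G00_fun P x y * V None m 0 0) * of_real w ^ m) sums (G_fun P x y * Pi_gf (p w) None x y)"
    using V_busy_sums[OF xy] expansion[OF n n, of None] small_w
  proof eventually_elim
    case (elim w)
    interpret stationary P w "p w" using elim by (intro stationary) auto
    from sums_add[OF sums_mult[OF elim(1)] sums_mult[OF elim(2)], of "G10_fun P x y" "G00_fun P x y"]
    show ?case unfolding G_equation[OF xy x0 T0] by (simp only: distrib_right mult.assoc)
  qed
qed

text \<open>The boundary term does not depend on \<open>w\<close>, which says that all its coefficients beyond the
  constant one vanish.\<close>

lemma V_boundary:
  assumes x: "norm x \<le> 1" "x \<noteq> 0" and \<eta>: "is_G_zero P x \<eta>"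
  shows "V_busy m x \<eta> + V None (Suc m) x 0 = 0"
proof -
  have z: "kernel_zero x = \<eta>" by (rule Y_fun_eq(2)[OF x(1) \<eta>])
  have n: "norm \<eta> \<le> 1" and T0: "T_denom P x \<eta> \<noteq> 0" using \<eta> by (auto simp: is_G_zero_def)
  let ?c = "of_real (1/2) * both_busy (p (1/2)) x \<eta> + Pi_gf (p (1/2)) None x 0"
  have "(case Suc m of 0 \<Rightarrow> 0 | Suc k \<Rightarrow> V_busy k x \<eta>) + V None (Suc m) x 0 = (if Suc m = 0 then ?c else 0)"
  proof (rule power_series_coeff_unique[OF V_busy_sums[OF x(1) n]])
    show "\<forall>\<^sub>F w in at_right 0. (\<lambda>m. (if m = 0 then ?c else 0) * of_real w ^ m) sums
        (of_real w * both_busy (p w) x \<eta> + Pi_gf (p w) None x 0)"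
      using small_w
    proof eventually_elim
      case (elim w)
      have "of_real w * both_busy (p w) x \<eta> + Pi_gf (p w) None x 0 = ?c"
        using boundary_term_constant[of w "1/2" x] elim x T0 unfolding z by auto
      then show ?case by (simp only: sums_constant_term)
    qed
  qed
  then show ?thesis by simp
qed

lemma V_Suc:
  assumes xy: "norm x \<le> 1" "norm y \<le> 1" and x0: "x \<noteq> 0" and T0: "T_denom P x y \<noteq> 0"
    and \<eta>: "is_G_zero P x \<eta>" and G0: "G_fun P x y \<noteq> 0"
  shows "V None (Suc m) x y = Q_fun P V (int m) x y * (G10_fun P x y / G_fun P x y)"
proof -
  have Y: "Y_fun P x = \<eta>" by (rule Y_fun_eq(1)[OF xy(1) \<eta>])
  have "V None (Suc m) x 0 = - V_busy m x \<eta>"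
    using V_boundary[OF xy(1) x0 \<eta>, of m] by (simp add: eq_neg_iff_add_eq_0 add.commute)
  then have "G_fun P x y * V None (Suc m) x y = G10_fun P x y * (V_busy m x y - V_busy m x \<eta>)"
    using V_G_equation[OF xy x0 T0, of "Suc m"] V_origin(2)[of "Suc m"] by simp
  also have "V_busy m x y - V_busy m x \<eta> = Q_fun P V (int m) x y"
    by (simp add: V_busy_def Q_fun_def Y)
  finally show ?thesis using G0 by (simp add: field_simps)
qed

lemma V_0:
  assumes xy: "norm x \<le> 1" "norm y \<le> 1" and x0: "x \<noteq> 0" and T0: "T_denom P x y \<noteq> 0"
    and \<eta>: "is_G_zero P x \<eta>" and G0: "G_fun P x y \<noteq> 0" and G10: "G10_fun P x (Y_fun P x) \<noteq> 0"
  shows "V None 0 x y =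
    (G00_fun P x y * G10_fun P x (Y_fun P x) - G00_fun P x (Y_fun P x) * G10_fun P x y) /
    (G_fun P x y * G10_fun P x (Y_fun P x)) * V None 0 0 0"
proof -
  have Y: "Y_fun P x = \<eta>" by (rule Y_fun_eq(1)[OF xy(1) \<eta>])
  have n: "norm \<eta> \<le> 1" and T\<eta>: "T_denom P x \<eta> \<noteq> 0" and "G_fun P x \<eta> = 0"
    using \<eta> by (auto simp: is_G_zero_def)
  then have "G10_fun P x \<eta> * V None 0 x 0 + G00_fun P x \<eta> * V None 0 0 0 = 0"
    using V_G_equation[OF xy(1) n x0 T\<eta>, of 0] by simp
  moreover have "G_fun P x y * V None 0 x y = G10_fun P x y * V None 0 x 0 + G00_fun P x y * V None 0 0 0"
    using V_G_equation[OF xy x0 T0, of 0] by simp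
  ultimately have "G_fun P x y * G10_fun P x \<eta> * V None 0 x y =
      (G00_fun P x y * G10_fun P x \<eta> - G00_fun P x \<eta> * G10_fun P x y) * V None 0 0 0"
    by algebra
  then show ?thesis using G0 G10 unfolding Y by (simp add: field_simps)
qed

end

lemma ctmc_stationary:
  fixes P :: "'n::finite model"
  assumes P: "valid_model P" and w: "0 < w" "w < 1" and ctmc: "ctmc M Z (transition_rate P w)"
    and limit: "\<And>z. ((\<lambda>t. measure M {\<omega> \<in> space M. Z t \<omega> = z}) \<longlongrightarrow> p z) at_top"
    and distribution: "(p has_sum 1) UNIV"
  shows "stationary P w p"
proof
  show "0 \<le> p z" for z by (rule tendsto_lowerbound[OF limit]) auto
  show "p z * (\<Sum>\<^sub>\<infinity>s\<in>-{z}. transition_rate P w z s) = (\<Sum>\<^sub>\<infinity>s\<in>-{z}. p s * transition_rate P w s z)" for z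
    by (rule limit_distribution_balance[OF ctmc transition_rate_bounded(2)[OF P w] limit distribution])
qed (fact P w distribution)+

theorem theorem1:
  fixes P :: "'n::finite model"
    and M :: "real \<Rightarrow> 'w measure"
    and Z :: "real \<Rightarrow> real \<Rightarrow> 'w \<Rightarrow> nat \<times> nat \<times> 'n option"
    and p :: "real \<Rightarrow> nat \<times> nat \<times> 'n option \<Rightarrow> real"
    and s :: "real \<Rightarrow> real"
    and V :: "'n option \<Rightarrow> nat \<Rightarrow> complex \<Rightarrow> complex \<Rightarrow> complex"
  assumes model: "valid_model P"
    and process: "\<And>w. 0 < w \<Longrightarrow> w < 1 \<Longrightarrow> ctmc (M w) (Z w) (transition_rate P w)"
    and limit: "\<And>w z. 0 < w \<Longrightarrow> w < 1 \<Longrightarrow>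
      ((\<lambda>t. measure (M w) {\<omega> \<in> space (M w). Z w t \<omega> = z}) \<longlongrightarrow> p w z) at_top"
    and distribution: "\<And>w. 0 < w \<Longrightarrow> w < 1 \<Longrightarrow> (p w has_sum 1) UNIV"
    and branch: "kernel_branch P s"
    and stability: "\<And>w. 0 < w \<Longrightarrow> w < 1 \<Longrightarrow> stability_condition P w s"
    and expansion: "\<And>k x y. norm x \<le> 1 \<Longrightarrow> norm y \<le> 1 \<Longrightarrow>
      (\<forall>\<^sub>F w in at_right 0. (\<lambda>m. V k m x y * of_real w ^ m) sums Pi_gf (p w) k x y)"
  shows
    "(\<forall>x. norm x \<le> 1 \<longrightarrow>
        (\<exists>\<^sub>\<le>\<^sub>1 y. is_G_zero P x y) \<and>
        ((\<forall>y. norm y \<le> 1 \<longrightarrow> T_denom P x y \<noteq> 0) \<longrightarrow> (\<exists>y. is_G_zero P x y))) \<and>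
     (\<forall>x y. norm x \<le> 1 \<and> norm y \<le> 1 \<and> x \<noteq> 0 \<and> T_denom P x y \<noteq> 0 \<and>
        (\<exists>\<eta>. is_G_zero P x \<eta>) \<and> G_fun P x y \<noteq> 0 \<longrightarrow>
        (\<forall>m>0. V None m x y = Q_fun P V (int m - 1) x y * (G10_fun P x y / G_fun P x y)) \<and>
        (G10_fun P x (Y_fun P x) \<noteq> 0 \<longrightarrow>
          V None 0 x y =
            (G00_fun P x y * G10_fun P x (Y_fun P x) - G00_fun P x (Y_fun P x) * G10_fun P x y) /
            (G_fun P x y * G10_fun P x (Y_fun P x)) * V None 0 0 0)) \<and>
     (\<forall>k m x y. norm x \<le> 1 \<and> norm y \<le> 1 \<longrightarrow>
        V (Some k) m x y = F_fun P k x y * V None m x y)"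
proof -
  interpret expanded_family P p s V
  proof (intro expanded_family.intro stationary_family.intro expanded_family_axioms.intro)
    show "stationary P w (p w)" if "0 < w" "w < 1" for w
      by (rule ctmc_stationary[OF model that process[OF that] limit[OF that] distribution[OF that]])
  qed (fact branch stability expansion)+
  show ?thesis
  proof (intro conjI allI impI)
    fix x :: complex assume x: "norm x \<le> 1"
    show "\<exists>\<^sub>\<le>\<^sub>1 y. is_G_zero P x y"
      by (simp add: Uniq_def is_G_zero_iff_kernel_zero[OF x])
    show "\<exists>y. is_G_zero P x y" if "\<forall>y. norm y \<le> 1 \<longrightarrow> T_denom P x y \<noteq> 0"
      using that kernel_zero(1)[OF x] by (simp add: is_G_zero_iff_kernel_zero[OF x])
  next
    fix x y :: complex and m :: nat
    assume "norm x \<le> 1 \<and> norm y \<le> 1 \<and> x \<noteq> 0 \<and> T_denom P x y \<noteq> 0 \<and>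
        (\<exists>\<eta>. is_G_zero P x \<eta>) \<and> G_fun P x y \<noteq> 0" and "m > 0"
    then show "V None m x y = Q_fun P V (int m - 1) x y * (G10_fun P x y / G_fun P x y)"
      using V_Suc[of x y _ "m - 1"] by (auto simp: of_nat_diff)
  next
    fix x y :: complex
    assume "norm x \<le> 1 \<and> norm y \<le> 1 \<and> x \<noteq> 0 \<and> T_denom P x y \<noteq> 0 \<and>
        (\<exists>\<eta>. is_G_zero P x \<eta>) \<and> G_fun P x y \<noteq> 0" and "G10_fun P x (Y_fun P x) \<noteq> 0"
    then show "V None 0 x y =
            (G00_fun P x y * G10_fun P x (Y_fun P x) - G00_fun P x (Y_fun P x) * G10_fun P x y) /
            (G_fun P x y * G10_fun P x (Y_fun P x)) * V None 0 0 0"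
      using V_0[of x y] by blast
  next
    fix k m and x y :: complex assume "norm x \<le> 1 \<and> norm y \<le> 1"
    then show "V (Some k) m x y = F_fun P k x y * V None m x y" using V_Some by blast
  qed
qed

end
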